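(* Let $\mathcal{C}$ be a difference $\lambda$-category with a chosen interpretation of base types. Whenever $s,t$ are unrestricted $\lambda_\epsilon$-terms with $s\sim_\epsilon t$ and typing derivations $\Gamma\vdash s:\tau$ and $\Gamma\vdash t:\tau$, their interpretations coincide: $[\![\Gamma\vdash s:\tau]\!]=[\![\Gamma\vdash t:\tau]\!]$ as morphisms $[\![\Gamma]\!]\to[\![\tau]\!]$ of $\mathcal{C}$.
   Context: Categorical setting. A Cartesian left additive category is a category with finite products in which each hom-set is a commutative monoid $(+,0)$ with $0\circ f=0$, $(f+g)\circ h=f\circ h+g\circ h$ and $\langle f_1,f_2\rangle+\langle g_1,g_2\rangle=\langle f_1+g_1,f_2+g_2\rangle$. An infinitesimal extension assigns to each hom-set a monoid homomorphism $\epsilon$ with $\epsilon\langle f,g\rangle=\langle\epsilon f,\epsilon g\rangle$. A Cartesian difference category is such a category with an infinitesimal extension and a difference combinator sending $f:A\to B$ to $\partial[f]:A\times A\to B$ such that (writing $\partial^2[f]=\partial[\partial[f]]$): (0) $f\circ(x+\epsilon(u))=f\circ x+\epsilon(\partial[f]\circ\langle x,u\rangle)$; (1) $\partial[f+g]=\partial[f]+\partial[g]$, $\partial[0]=0$, $\partial[\epsilon f]=\epsilon(\partial[f])$; (2) $\partial[f]\circ\langle x,u+v\rangle=\partial[f]\circ\langle x,u\rangle+\partial[f]\circ\langle x+\epsilon(u),v\rangle$ and $\partial[f]\circ\langle x,0\rangle=0$; (3) $\partial[\mathrm{Id}]=\pi_2$, $\partial[\pi_1]=\pi_1\circ\pi_2$,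 $\partial[\pi_2]=\pi_2\circ\pi_2$; (4) $\partial[\langle f,g\rangle]=\langle\partial[f],\partial[g]\rangle$, $\partial[!_A]=!_{A\times A}$; (5) $\partial[g\circ f]=\partial[g]\circ\langle f\circ\pi_1,\partial[f]\rangle$; (6) $\partial^2[f]\circ\langle\langle x,u\rangle,\langle0,v\rangle\rangle=\partial[f]\circ\langle x+\epsilon(u),v\rangle$; (7) $\partial^2[f]\circ\langle\langle x,u\rangle,\langle v,0\rangle\rangle=\partial^2[f]\circ\langle\langle x,v\rangle,\langle u,0\rangle\rangle$. A difference $\lambda$-category is a Cartesian difference category that is Cartesian closed (currying $\Lambda$, uncurrying $\Lambda^{-1}$, evaluation $\mathrm{ev}$) with $\Lambda(f+g)=\Lambda f+\Lambda g$, $\Lambda(0)=0$, and for $f:A\times B\to C$: $\partial[\Lambda f]=\Lambda\big(\partial[f]\circ\langle\pi_1\times\mathrm{Id},\pi_2\times0\rangle\big)$ and $\Lambda(\epsilon f)=\epsilon(\Lambda f)$. Syntax. Unrestricted terms: $t ::= x \mid \lambda x.t \mid (s\ t) \mid \mathsf{D}(s)\cdot t \mid \epsilon t \mid s+t \mid 0$, up to $\alpha$-equivalence; $\epsilon^k$ is iterated $\epsilon$. A relation $\sim$ is contextual if $t\sim t'$ implies $\lambda x.t\sim\lambda x.t'$, $\epsilon t\sim\epsilon t'$, and $s\sim s'$, $t\sim t'$ imply $(s\ t)\sim(s'\ t')$, $\mathsf{D}(s)\cdot t\sim\mathsf{D}(s')\cdot t'$, $s+t\sim s'+t'$. Differential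 equivalence $\sim_\epsilon$ is the least contextual equivalence relation containing: $(s+t)+e\sim s+(t+e)$; $s+0\sim s$; $s+t\sim t+s$; $\epsilon 0\sim 0$; $\epsilon(s+t)\sim\epsilon s+\epsilon t$; $\lambda x.0\sim 0$; $\lambda x.(s+t)\sim(\lambda x.s)+(\lambda x.t)$; $\lambda x.\epsilon t\sim\epsilon(\lambda x.t)$; $(0\ s)\sim 0$; $((s+t)\ e)\sim(s\ e)+(t\ e)$; $((\epsilon s)\ t)\sim\epsilon(s\ t)$; $\mathsf{D}(0)\cdot e\sim 0$; $\mathsf{D}(s+t)\cdot e\sim\mathsf{D}(s)\cdot e+\mathsf{D}(t)\cdot e$; $\mathsf{D}(\epsilon t)\cdot e\sim\epsilon(\mathsf{D}(t)\cdot e)$; $\mathsf{D}(s)\cdot 0\sim 0$; $\mathsf{D}(s)\cdot(t+e)\sim\mathsf{D}(s)\cdot t+\mathsf{D}(s)\cdot e+\epsilon(\mathsf{D}(\mathsf{D}(s)\cdot t)\cdot e)$; $\mathsf{D}(s)\cdot(\epsilon t)\sim\epsilon(\mathsf{D}(s)\cdot t)$; $\mathsf{D}(\mathsf{D}(s)\cdot t)\cdot e\sim\mathsf{D}(\mathsf{D}(s)\cdot e)\cdot t$; $\epsilon^2(\mathsf{D}(\mathsf{D}(s)\cdot t)\cdot e)\sim\epsilon(\mathsf{D}(\mathsf{D}(s)\cdot t)\cdot e)$; $(s\ (t+\epsilon e))\sim(s\ t)+\epsilon((\mathsf{D}(s)\cdot e)\ t)$. Types $\sigma,\tau::=\mathbf{t}\mid\sigma\Rightarrow\tau$;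 typing rules: $\Gamma\vdash x:\tau$ if $x:\tau$ in $\Gamma$; from $\Gamma\vdash s:\tau\Rightarrow\sigma$, $\Gamma\vdash t:\tau$ infer $\Gamma\vdash(s\ t):\sigma$ and $\Gamma\vdash\mathsf{D}(s)\cdot t:\tau\Rightarrow\sigma$; from $\Gamma,x:\tau\vdash t:\sigma$ infer $\Gamma\vdash\lambda x.t:\tau\Rightarrow\sigma$; $\Gamma\vdash0:\tau$; from $\Gamma\vdash s:\tau$, $\Gamma\vdash t:\tau$ infer $\Gamma\vdash s+t:\tau$; from $\Gamma\vdash t:\tau$ infer $\Gamma\vdash\epsilon t:\tau$. Interpretation: given objects $O_{\mathbf{t}}$, $[\![\mathbf{t}]\!]=O_{\mathbf{t}}$, $[\![\sigma\Rightarrow\tau]\!]=[\![\sigma]\!]\Rightarrow[\![\tau]\!]$, $[\![\cdot]\!]=1$, $[\![\Gamma,x:\tau]\!]=[\![\Gamma]\!]\times[\![\tau]\!]$; by induction on typing: $[\![x_1:\tau_1,\ldots,x_n:\tau_n\vdash x_k]\!]=\pi_2\circ\pi_1^{n-k}$; $[\![0]\!]=0$; $[\![s+t]\!]=[\![s]\!]+[\![t]\!]$; $[\![\epsilon t]\!]=\epsilon[\![t]\!]$; $[\![\lambda x.t]\!]=\Lambda[\![t]\!]$; $[\![(s\ t)]\!]=\mathrm{ev}\circ\langle[\![s]\!],[\![t]\!]\rangle$; $[\![\Gamma\vdash\mathsf{D}(s)\cdot t:\sigma\Rightarrow\tau]\!]=\Lambda\big(\partial[\Lambda^{-1}[\![s]\!]]\circ\langle\mathrm{Id},\langle0,[\![t]\!]\circ\pi_1\rangle\rangle\big):[\![\Gamma]\!]\to[\![\sigma]\!]\Rightarrow[\![\tau]\!]$.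 *)

theory Defs
  imports Main
begin

section \<open>Cartesian left additive categories and infinitesimal extensions\<close>

text \<open>
  Operations on arrows are only constrained on well-typed arguments. Operations whose source or
  target cannot be read off from their arrow arguments take the relevant objects as arguments, as an
  object may be a product (or an exponential) in several ways. Composition is in applicative order:
  \<open>g \<cdot> f\<close> is \<open>g\<close> after \<open>f\<close>.
\<close>

record ('o, 'm) cat =
  Obj :: "'o set"
  Arr :: "'m set"
  Dom :: "'m \<Rightarrow> 'o"
  Cod :: "'m \<Rightarrow> 'o"
  Idn :: "'o \<Rightarrow> 'm"
  Comp :: "'m \<Rightarrow> 'm \<Rightarrow> 'm"  (infixr "\<cdot>\<index>" 75)

definition Hom :: "('o, 'm, 'x) cat_scheme \<Rightarrow> 'o \<Rightarrow> 'o \<Rightarrow> 'm set" where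
  "Hom C A B = {f \<in> Arr C. Dom C f = A \<and> Cod C f = B}"

locale category =
  fixes C :: "('o, 'm, 'x) cat_scheme" (structure)
  assumes Dom_Obj: "f \<in> Arr C \<Longrightarrow> Dom C f \<in> Obj C"
    and Cod_Obj: "f \<in> Arr C \<Longrightarrow> Cod C f \<in> Obj C"
    and Id_Hom: "A \<in> Obj C \<Longrightarrow> Idn C A \<in> Hom C A A"
    and Comp_Hom: "\<lbrakk>f \<in> Hom C A B; g \<in> Hom C B D\<rbrakk> \<Longrightarrow> g \<cdot> f \<in> Hom C A D"
    and Comp_Id: "f \<in> Hom C A B \<Longrightarrow> f \<cdot> Idn C A = f"
    and Id_Comp: "f \<in> Hom C A B \<Longrightarrow> Idn C B \<cdot> f = f"
    and Comp_assoc: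
      "\<lbrakk>f \<in> Hom C A B; g \<in> Hom C B D; h \<in> Hom C D E\<rbrakk> \<Longrightarrow> (h \<cdot> g) \<cdot> f = h \<cdot> (g \<cdot> f)"

record ('o, 'm) cart_cat = "('o, 'm) cat" +
  One :: 'o
  Bang :: "'o \<Rightarrow> 'm"
  Prod :: "'o \<Rightarrow> 'o \<Rightarrow> 'o"  (infixr "\<otimes>\<index>" 80)
  Pi1 :: "'o \<Rightarrow> 'o \<Rightarrow> 'm"  ("\<pi>\<^sub>1\<index>")
  Pi2 :: "'o \<Rightarrow> 'o \<Rightarrow> 'm"  ("\<pi>\<^sub>2\<index>")
  Pairing :: "'m \<Rightarrow> 'm \<Rightarrow> 'm"  ("\<langle>_,/ _\<rangle>\<index>")

locale cartesian_category = category C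
  for C :: "('o, 'm, 'x) cart_cat_scheme" (structure) +
  assumes One_Obj: "One C \<in> Obj C"
    and Bang_Hom: "A \<in> Obj C \<Longrightarrow> Bang C A \<in> Hom C A (One C)"
    and Bang_unique: "f \<in> Hom C A (One C) \<Longrightarrow> f = Bang C A"
    and Prod_Obj: "\<lbrakk>A \<in> Obj C; B \<in> Obj C\<rbrakk> \<Longrightarrow> A \<otimes> B \<in> Obj C"
    and Pi1_Hom: "\<lbrakk>A \<in> Obj C; B \<in> Obj C\<rbrakk> \<Longrightarrow> \<pi>\<^sub>1 A B \<in> Hom C (A \<otimes> B) A"
    and Pi2_Hom: "\<lbrakk>A \<in> Obj C; B \<in> Obj C\<rbrakk> \<Longrightarrow> \<pi>\<^sub>2 A B \<in> Hom C (A \<otimes> B) B"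
    and Pair_Hom: "\<lbrakk>f \<in> Hom C X A; g \<in> Hom C X B\<rbrakk> \<Longrightarrow> \<langle>f, g\<rangle> \<in> Hom C X (A \<otimes> B)"
    and Pi1_Pair: "\<lbrakk>f \<in> Hom C X A; g \<in> Hom C X B\<rbrakk> \<Longrightarrow> \<pi>\<^sub>1 A B \<cdot> \<langle>f, g\<rangle> = f"
    and Pi2_Pair: "\<lbrakk>f \<in> Hom C X A; g \<in> Hom C X B\<rbrakk> \<Longrightarrow> \<pi>\<^sub>2 A B \<cdot> \<langle>f, g\<rangle> = g"
    and Pair_Pi: "\<lbrakk>A \<in> Obj C; B \<in> Obj C; h \<in> Hom C X (A \<otimes> B)\<rbrakk>
      \<Longrightarrow> \<langle>\<pi>\<^sub>1 A B \<cdot> h, \<pi>\<^sub>2 A B \<cdot> h\<rangle> = h"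

text \<open>The arrow \<open>f \<times> g\<close>, for \<open>f\<close> with source \<open>A\<close> and \<open>g\<close> with source \<open>B\<close>.\<close>

definition ProdMap :: "('o, 'm, 'x) cart_cat_scheme \<Rightarrow> 'o \<Rightarrow> 'o \<Rightarrow> 'm \<Rightarrow> 'm \<Rightarrow> 'm" where
  "ProdMap C A B f g = \<langle>f \<cdot>\<^bsub>C\<^esub> \<pi>\<^sub>1\<^bsub>C\<^esub> A B, g \<cdot>\<^bsub>C\<^esub> \<pi>\<^sub>2\<^bsub>C\<^esub> A B\<rangle>\<^bsub>C\<^esub>"

record ('o, 'm) left_add_cat = "('o, 'm) cart_cat" +
  Plus :: "'m \<Rightarrow> 'm \<Rightarrow> 'm"  (infixl "\<oplus>\<index>" 65)
  Null :: "'o \<Rightarrow> 'o \<Rightarrow> 'm"  ("\<zero>\<index>")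

locale cartesian_left_additive_category = cartesian_category C
  for C :: "('o, 'm, 'x) left_add_cat_scheme" (structure) +
  assumes Plus_Hom: "\<lbrakk>f \<in> Hom C A B; g \<in> Hom C A B\<rbrakk> \<Longrightarrow> f \<oplus> g \<in> Hom C A B"
    and Null_Hom: "\<lbrakk>A \<in> Obj C; B \<in> Obj C\<rbrakk> \<Longrightarrow> \<zero> A B \<in> Hom C A B"
    and Plus_assoc: "\<lbrakk>f \<in> Hom C A B; g \<in> Hom C A B; h \<in> Hom C A B\<rbrakk>
      \<Longrightarrow> (f \<oplus> g) \<oplus> h = f \<oplus> (g \<oplus> h)"
    and Plus_commute: "\<lbrakk>f \<in> Hom C A B; g \<in> Hom C A B\<rbrakk> \<Longrightarrow> f \<oplus> g = g \<oplus> f"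
    and Plus_Null: "f \<in> Hom C A B \<Longrightarrow> f \<oplus> \<zero> A B = f"
    and Null_Comp: "\<lbrakk>D \<in> Obj C; f \<in> Hom C A B\<rbrakk> \<Longrightarrow> \<zero> B D \<cdot> f = \<zero> A D"
    and Plus_Comp: "\<lbrakk>f \<in> Hom C B D; g \<in> Hom C B D; h \<in> Hom C A B\<rbrakk>
      \<Longrightarrow> (f \<oplus> g) \<cdot> h = (f \<cdot> h) \<oplus> (g \<cdot> h)"
    and Pair_Plus: "\<lbrakk>f1 \<in> Hom C X A; g1 \<in> Hom C X A; f2 \<in> Hom C X B; g2 \<in> Hom C X B\<rbrakk>
      \<Longrightarrow> \<langle>f1, f2\<rangle> \<oplus> \<langle>g1, g2\<rangle> = \<langle>f1 \<oplus> g1, f2 \<oplus> g2\<rangle>"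

record ('o, 'm) inf_cat = "('o, 'm) left_add_cat" +
  Infin :: "'m \<Rightarrow> 'm"  ("\<epsilon>\<index>")

locale infinitesimal_extension = cartesian_left_additive_category C
  for C :: "('o, 'm, 'x) inf_cat_scheme" (structure) +
  assumes Inf_Hom: "f \<in> Hom C A B \<Longrightarrow> \<epsilon> f \<in> Hom C A B"
    and Inf_Plus: "\<lbrakk>f \<in> Hom C A B; g \<in> Hom C A B\<rbrakk> \<Longrightarrow> \<epsilon> (f \<oplus> g) = \<epsilon> f \<oplus> \<epsilon> g"
    and Inf_Null: "\<lbrakk>A \<in> Obj C; B \<in> Obj C\<rbrakk> \<Longrightarrow> \<epsilon> (\<zero> A B) = \<zero> A B"
    and Inf_Pair: "\<lbrakk>f \<in> Hom C X A; g \<in> Hom C X B\<rbrakk> \<Longrightarrow> \<epsilon> \<langle>f, g\<rangle> = \<langle>\<epsilon> f, \<epsilon> g\<rangle>"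


section \<open>Cartesian difference categories\<close>

record ('o, 'm) diff_cat = "('o, 'm) inf_cat" +
  Diff :: "'m \<Rightarrow> 'm"  ("\<partial>\<index>")

locale cartesian_difference_category = infinitesimal_extension C
  for C :: "('o, 'm, 'x) diff_cat_scheme" (structure) +
  assumes Diff_Hom: "f \<in> Hom C A B \<Longrightarrow> \<partial> f \<in> Hom C (A \<otimes> A) B"
    and CdC0: "\<lbrakk>f \<in> Hom C A B; x \<in> Hom C X A; u \<in> Hom C X A\<rbrakk>
      \<Longrightarrow> f \<cdot> (x \<oplus> \<epsilon> u) = (f \<cdot> x) \<oplus> \<epsilon> (\<partial> f \<cdot> \<langle>x, u\<rangle>)"
    and CdC1_Plus: "\<lbrakk>f \<in> Hom C A B; g \<in> Hom C A B\<rbrakk> \<Longrightarrow> \<partial> (f \<oplus> g) = \<partial> f \<oplus> \<partial> g"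
    and CdC1_Null: "\<lbrakk>A \<in> Obj C; B \<in> Obj C\<rbrakk> \<Longrightarrow> \<partial> (\<zero> A B) = \<zero> (A \<otimes> A) B"
    and CdC1_Inf: "f \<in> Hom C A B \<Longrightarrow> \<partial> (\<epsilon> f) = \<epsilon> (\<partial> f)"
    and CdC2_Plus: "\<lbrakk>f \<in> Hom C A B; x \<in> Hom C X A; u \<in> Hom C X A; v \<in> Hom C X A\<rbrakk>
      \<Longrightarrow> \<partial> f \<cdot> \<langle>x, u \<oplus> v\<rangle> = (\<partial> f \<cdot> \<langle>x, u\<rangle>) \<oplus> (\<partial> f \<cdot> \<langle>x \<oplus> \<epsilon> u, v\<rangle>)"
    and CdC2_Null: "\<lbrakk>f \<in> Hom C A B; x \<in> Hom C X A\<rbrakk> \<Longrightarrow> \<partial> f \<cdot> \<langle>x, \<zero> X A\<rangle> = \<zero> X B"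
    and CdC3_Id: "A \<in> Obj C \<Longrightarrow> \<partial> (Idn C A) = \<pi>\<^sub>2 A A"
    and CdC3_Pi1: "\<lbrakk>A \<in> Obj C; B \<in> Obj C\<rbrakk>
      \<Longrightarrow> \<partial> (\<pi>\<^sub>1 A B) = \<pi>\<^sub>1 A B \<cdot> \<pi>\<^sub>2 (A \<otimes> B) (A \<otimes> B)"
    and CdC3_Pi2: "\<lbrakk>A \<in> Obj C; B \<in> Obj C\<rbrakk>
      \<Longrightarrow> \<partial> (\<pi>\<^sub>2 A B) = \<pi>\<^sub>2 A B \<cdot> \<pi>\<^sub>2 (A \<otimes> B) (A \<otimes> B)"
    and CdC4_Pair: "\<lbrakk>f \<in> Hom C X A; g \<in> Hom C X B\<rbrakk> \<Longrightarrow> \<partial> \<langle>f, g\<rangle> = \<langle>\<partial> f, \<partial> g\<rangle>"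
    and CdC4_Bang: "A \<in> Obj C \<Longrightarrow> \<partial> (Bang C A) = Bang C (A \<otimes> A)"
    and CdC5: "\<lbrakk>f \<in> Hom C A B; g \<in> Hom C B D\<rbrakk>
      \<Longrightarrow> \<partial> (g \<cdot> f) = \<partial> g \<cdot> \<langle>f \<cdot> \<pi>\<^sub>1 A A, \<partial> f\<rangle>"
    and CdC6: "\<lbrakk>f \<in> Hom C A B; x \<in> Hom C X A; u \<in> Hom C X A; v \<in> Hom C X A\<rbrakk>
      \<Longrightarrow> \<partial> (\<partial> f) \<cdot> \<langle>\<langle>x, u\<rangle>, \<langle>\<zero> X A, v\<rangle>\<rangle> = \<partial> f \<cdot> \<langle>x \<oplus> \<epsilon> u, v\<rangle>"
    and CdC7: "\<lbrakk>f \<in> Hom C A B; x \<in> Hom C X A; u \<in> Hom C X A; v \<in> Hom C X A\<rbrakk>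
      \<Longrightarrow> \<partial> (\<partial> f) \<cdot> \<langle>\<langle>x, u\<rangle>, \<langle>v, \<zero> X A\<rangle>\<rangle> = \<partial> (\<partial> f) \<cdot> \<langle>\<langle>x, v\<rangle>, \<langle>u, \<zero> X A\<rangle>\<rangle>"


section \<open>Difference lambda-categories\<close>

record ('o, 'm) diff_lambda_cat = "('o, 'm) diff_cat" +
  Exp :: "'o \<Rightarrow> 'o \<Rightarrow> 'o"  (infixr "\<rightarrow>\<index>" 70)
  Ev :: "'o \<Rightarrow> 'o \<Rightarrow> 'm"
  Lam :: "'o \<Rightarrow> 'o \<Rightarrow> 'm \<Rightarrow> 'm"  ("\<Lambda>\<index>")

text \<open>
  \<open>\<Lambda> A B f\<close> is the currying of an arrow \<open>f\<close> with source \<open>A \<otimes> B\<close>, and \<open>Unlam C A B D g\<close> is the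
  uncurrying of \<open>g\<close> from \<open>A\<close> to the exponential of \<open>B\<close> and \<open>D\<close>.
\<close>

definition Unlam :: "('o, 'm, 'x) diff_lambda_cat_scheme \<Rightarrow> 'o \<Rightarrow> 'o \<Rightarrow> 'o \<Rightarrow> 'm \<Rightarrow> 'm" where
  "Unlam C A B D g = Ev C B D \<cdot>\<^bsub>C\<^esub> ProdMap C A B g (Idn C B)"

locale difference_lambda_category = cartesian_difference_category C
  for C :: "('o, 'm, 'x) diff_lambda_cat_scheme" (structure) +
  assumes Exp_Obj: "\<lbrakk>A \<in> Obj C; B \<in> Obj C\<rbrakk> \<Longrightarrow> A \<rightarrow> B \<in> Obj C"
    and Ev_Hom: "\<lbrakk>A \<in> Obj C; B \<in> Obj C\<rbrakk> \<Longrightarrow> Ev C A B \<in> Hom C ((A \<rightarrow> B) \<otimes> A) B"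
    and Lam_Hom: "\<lbrakk>A \<in> Obj C; B \<in> Obj C; f \<in> Hom C (A \<otimes> B) D\<rbrakk>
      \<Longrightarrow> \<Lambda> A B f \<in> Hom C A (B \<rightarrow> D)"
    and Unlam_Lam: "\<lbrakk>A \<in> Obj C; B \<in> Obj C; f \<in> Hom C (A \<otimes> B) D\<rbrakk>
      \<Longrightarrow> Unlam C A B D (\<Lambda> A B f) = f"
    and Lam_Unlam: "\<lbrakk>B \<in> Obj C; D \<in> Obj C; g \<in> Hom C A (B \<rightarrow> D)\<rbrakk>
      \<Longrightarrow> \<Lambda> A B (Unlam C A B D g) = g"
    and Lam_Plus: "\<lbrakk>A \<in> Obj C; B \<in> Obj C; f \<in> Hom C (A \<otimes> B) D; g \<in> Hom C (A \<otimes> B) D\<rbrakk>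
      \<Longrightarrow> \<Lambda> A B (f \<oplus> g) = \<Lambda> A B f \<oplus> \<Lambda> A B g"
    and Lam_Null: "\<lbrakk>A \<in> Obj C; B \<in> Obj C; D \<in> Obj C\<rbrakk>
      \<Longrightarrow> \<Lambda> A B (\<zero> (A \<otimes> B) D) = \<zero> A (B \<rightarrow> D)"
    and Diff_Lam: "\<lbrakk>A \<in> Obj C; B \<in> Obj C; f \<in> Hom C (A \<otimes> B) D\<rbrakk>
      \<Longrightarrow> \<partial> (\<Lambda> A B f) =
          \<Lambda> (A \<otimes> A) B (\<partial> f \<cdot> \<langle>ProdMap C (A \<otimes> A) B (\<pi>\<^sub>1 A A) (Idn C B),
                            ProdMap C (A \<otimes> A) B (\<pi>\<^sub>2 A A) (\<zero> B B)\<rangle>)"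
    and Lam_Inf: "\<lbrakk>A \<in> Obj C; B \<in> Obj C; f \<in> Hom C (A \<otimes> B) D\<rbrakk>
      \<Longrightarrow> \<Lambda> A B (\<epsilon> f) = \<epsilon> (\<Lambda> A B f)"


section \<open>Unrestricted terms and differential equivalence\<close>

text \<open>
  Terms up to alpha-equivalence are represented with de Bruijn indices; \<open>TDiff s t\<close> is
  \<open>D(s) \<cdot> t\<close>. None of the generating equations moves a term across a binder, so no index
  shifting occurs below.
\<close>

datatype trm =
    TVar nat
  | TLam trm
  | TApp trm trm
  | TDiff trm trm
  | TEps trm
  | TPlus trm trm
  | TZero

inductive diff_equiv :: "trm \<Rightarrow> trm \<Rightarrow> bool"  (infix "\<sim>\<^sub>\<epsilon>" 50) where
  refl: "t \<sim>\<^sub>\<epsilon> t"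
| sym: "s \<sim>\<^sub>\<epsilon> t \<Longrightarrow> t \<sim>\<^sub>\<epsilon> s"
| trans: "s \<sim>\<^sub>\<epsilon> t \<Longrightarrow> t \<sim>\<^sub>\<epsilon> e \<Longrightarrow> s \<sim>\<^sub>\<epsilon> e"
| cong_Lam: "t \<sim>\<^sub>\<epsilon> t' \<Longrightarrow> TLam t \<sim>\<^sub>\<epsilon> TLam t'"
| cong_Eps: "t \<sim>\<^sub>\<epsilon> t' \<Longrightarrow> TEps t \<sim>\<^sub>\<epsilon> TEps t'"
| cong_App: "s \<sim>\<^sub>\<epsilon> s' \<Longrightarrow> t \<sim>\<^sub>\<epsilon> t' \<Longrightarrow> TApp s t \<sim>\<^sub>\<epsilon> TApp s' t'"
| cong_Diff: "s \<sim>\<^sub>\<epsilon> s' \<Longrightarrow> t \<sim>\<^sub>\<epsilon> t' \<Longrightarrow> TDiff s t \<sim>\<^sub>\<epsilon> TDiff s' t'"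
| cong_Plus: "s \<sim>\<^sub>\<epsilon> s' \<Longrightarrow> t \<sim>\<^sub>\<epsilon> t' \<Longrightarrow> TPlus s t \<sim>\<^sub>\<epsilon> TPlus s' t'"
| Plus_assoc: "TPlus (TPlus s t) e \<sim>\<^sub>\<epsilon> TPlus s (TPlus t e)"
| Plus_Zero: "TPlus s TZero \<sim>\<^sub>\<epsilon> s"
| Plus_commute: "TPlus s t \<sim>\<^sub>\<epsilon> TPlus t s"
| Eps_Zero: "TEps TZero \<sim>\<^sub>\<epsilon> TZero"
| Eps_Plus: "TEps (TPlus s t) \<sim>\<^sub>\<epsilon> TPlus (TEps s) (TEps t)"
| Lam_Zero: "TLam TZero \<sim>\<^sub>\<epsilon> TZero"
| Lam_Plus: "TLam (TPlus s t) \<sim>\<^sub>\<epsilon> TPlus (TLam s) (TLam t)"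
| Lam_Eps: "TLam (TEps t) \<sim>\<^sub>\<epsilon> TEps (TLam t)"
| App_Zero: "TApp TZero s \<sim>\<^sub>\<epsilon> TZero"
| App_Plus: "TApp (TPlus s t) e \<sim>\<^sub>\<epsilon> TPlus (TApp s e) (TApp t e)"
| App_Eps: "TApp (TEps s) t \<sim>\<^sub>\<epsilon> TEps (TApp s t)"
| Diff_Zero_left: "TDiff TZero e \<sim>\<^sub>\<epsilon> TZero"
| Diff_Plus_left: "TDiff (TPlus s t) e \<sim>\<^sub>\<epsilon> TPlus (TDiff s e) (TDiff t e)"
| Diff_Eps_left: "TDiff (TEps t) e \<sim>\<^sub>\<epsilon> TEps (TDiff t e)"
| Diff_Zero_right: "TDiff s TZero \<sim>\<^sub>\<epsilon> TZero"
| Diff_Plus_right: "TDiff s (TPlus t e) \<sim>\<^sub>\<epsilon>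
    TPlus (TPlus (TDiff s t) (TDiff s e)) (TEps (TDiff (TDiff s t) e))"
| Diff_Eps_right: "TDiff s (TEps t) \<sim>\<^sub>\<epsilon> TEps (TDiff s t)"
| Diff_Diff_swap: "TDiff (TDiff s t) e \<sim>\<^sub>\<epsilon> TDiff (TDiff s e) t"
| Eps_Eps_Diff_Diff: "TEps (TEps (TDiff (TDiff s t) e)) \<sim>\<^sub>\<epsilon> TEps (TDiff (TDiff s t) e)"
| App_Taylor: "TApp s (TPlus t (TEps e)) \<sim>\<^sub>\<epsilon> TPlus (TApp s t) (TEps (TApp (TDiff s e) t))"


section \<open>Typing derivations\<close>

text \<open>
  The type parameter \<open>'b\<close> is the set of base types. Contexts list the most recently bound variable
  first, so that \<open>\<Gamma>, x : \<tau>\<close> is \<open>\<tau> # \<Gamma>\<close> and the de Bruijn index of a variable is its position.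
  Terms carry no type annotations, so a judgement may have several derivations (in \<open>(0 s)\<close> the
  type of \<open>s\<close> is not determined). Hence derivations are objects in their own right, and a node
  records the context and types that its interpretation refers to.
\<close>

datatype 'b ty = Base 'b | Fun "'b ty" "'b ty"  (infixr "\<Rrightarrow>" 60)

type_synonym 'b ctx = "'b ty list"

datatype 'b deriv =
    DVar "'b ctx" nat
  | DApp "'b ctx" "'b ty" "'b ty" "'b deriv" "'b deriv"
  | DDiff "'b ctx" "'b ty" "'b ty" "'b deriv" "'b deriv"
  | DLam "'b ctx" "'b ty" "'b ty" "'b deriv"
  | DZero "'b ctx" "'b ty"
  | DPlus "'b deriv" "'b deriv"
  | DEps "'b deriv"

inductive derives :: "'b deriv \<Rightarrow> 'b ctx \<Rightarrow> trm \<Rightarrow> 'b ty \<Rightarrow> bool"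
  ("_ \<triangleright> _ \<turnstile> _ : _" [51, 51, 51, 51] 50) where
  "k < length \<Gamma> \<Longrightarrow> DVar \<Gamma> k \<triangleright> \<Gamma> \<turnstile> TVar k : \<Gamma> ! k"
| "\<lbrakk>d \<triangleright> \<Gamma> \<turnstile> s : (\<tau> \<Rrightarrow> \<sigma>); e \<triangleright> \<Gamma> \<turnstile> t : \<tau>\<rbrakk> \<Longrightarrow> DApp \<Gamma> \<tau> \<sigma> d e \<triangleright> \<Gamma> \<turnstile> TApp s t : \<sigma>"
| "\<lbrakk>d \<triangleright> \<Gamma> \<turnstile> s : (\<tau> \<Rrightarrow> \<sigma>); e \<triangleright> \<Gamma> \<turnstile> t : \<tau>\<rbrakk> \<Longrightarrow> DDiff \<Gamma> \<tau> \<sigma> d e \<triangleright> \<Gamma> \<turnstile> TDiff s t : (\<tau> \<Rrightarrow> \<sigma>)"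
| "d \<triangleright> (\<tau> # \<Gamma>) \<turnstile> t : \<sigma> \<Longrightarrow> DLam \<Gamma> \<tau> \<sigma> d \<triangleright> \<Gamma> \<turnstile> TLam t : (\<tau> \<Rrightarrow> \<sigma>)"
| "DZero \<Gamma> \<tau> \<triangleright> \<Gamma> \<turnstile> TZero : \<tau>"
| "\<lbrakk>d \<triangleright> \<Gamma> \<turnstile> s : \<tau>; e \<triangleright> \<Gamma> \<turnstile> t : \<tau>\<rbrakk> \<Longrightarrow> DPlus d e \<triangleright> \<Gamma> \<turnstile> TPlus s t : \<tau>"
| "d \<triangleright> \<Gamma> \<turnstile> t : \<tau> \<Longrightarrow> DEps d \<triangleright> \<Gamma> \<turnstile> TEps t : \<tau>"


section \<open>Interpretation in a difference lambda-category\<close>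

primrec ty_obj :: "('o, 'm, 'x) diff_lambda_cat_scheme \<Rightarrow> ('b \<Rightarrow> 'o) \<Rightarrow> 'b ty \<Rightarrow> 'o" where
  "ty_obj C I (Base b) = I b"
| "ty_obj C I (\<sigma> \<Rrightarrow> \<tau>) = ty_obj C I \<sigma> \<rightarrow>\<^bsub>C\<^esub> ty_obj C I \<tau>"

primrec ctx_obj :: "('o, 'm, 'x) diff_lambda_cat_scheme \<Rightarrow> ('b \<Rightarrow> 'o) \<Rightarrow> 'b ctx \<Rightarrow> 'o" where
  "ctx_obj C I [] = One C"
| "ctx_obj C I (\<tau> # \<Gamma>) = ctx_obj C I \<Gamma> \<otimes>\<^bsub>C\<^esub> ty_obj C I \<tau>"

text \<open>The arrow \<open>\<pi>\<^sub>2 \<cdot> \<pi>\<^sub>1 \<cdot> \<dots> \<cdot> \<pi>\<^sub>1\<close> with \<open>k\<close> first projections, for the variable with index \<open>k\<close>.\<close>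

fun var_arr :: "('o, 'm, 'x) diff_lambda_cat_scheme \<Rightarrow> ('b \<Rightarrow> 'o) \<Rightarrow> 'b ctx \<Rightarrow> nat \<Rightarrow> 'm" where
  "var_arr C I (\<tau> # \<Gamma>) 0 = \<pi>\<^sub>2\<^bsub>C\<^esub> (ctx_obj C I \<Gamma>) (ty_obj C I \<tau>)"
| "var_arr C I (\<tau> # \<Gamma>) (Suc k) = var_arr C I \<Gamma> k \<cdot>\<^bsub>C\<^esub> \<pi>\<^sub>1\<^bsub>C\<^esub> (ctx_obj C I \<Gamma>) (ty_obj C I \<tau>)"
| "var_arr C I [] k = undefined"

primrec interp :: "('o, 'm, 'x) diff_lambda_cat_scheme \<Rightarrow> ('b \<Rightarrow> 'o) \<Rightarrow> 'b deriv \<Rightarrow> 'm" where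
  "interp C I (DVar \<Gamma> k) = var_arr C I \<Gamma> k"
| "interp C I (DApp \<Gamma> \<tau> \<sigma> d e) =
     Ev C (ty_obj C I \<tau>) (ty_obj C I \<sigma>) \<cdot>\<^bsub>C\<^esub> \<langle>interp C I d, interp C I e\<rangle>\<^bsub>C\<^esub>"
| "interp C I (DDiff \<Gamma> \<tau> \<sigma> d e) =
     (let G = ctx_obj C I \<Gamma>; T = ty_obj C I \<tau>; S = ty_obj C I \<sigma>; P = G \<otimes>\<^bsub>C\<^esub> T
      in \<Lambda>\<^bsub>C\<^esub> G T (\<partial>\<^bsub>C\<^esub> (Unlam C G T S (interp C I d)) \<cdot>\<^bsub>C\<^esub>
           \<langle>Idn C P, \<langle>\<zero>\<^bsub>C\<^esub> P G, interp C I e \<cdot>\<^bsub>C\<^esub> \<pi>\<^sub>1\<^bsub>C\<^esub> G T\<rangle>\<^bsub>C\<^esub>\<rangle>\<^bsub>C\<^esub>))"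
| "interp C I (DLam \<Gamma> \<tau> \<sigma> d) = \<Lambda>\<^bsub>C\<^esub> (ctx_obj C I \<Gamma>) (ty_obj C I \<tau>) (interp C I d)"
| "interp C I (DZero \<Gamma> \<tau>) = \<zero>\<^bsub>C\<^esub> (ctx_obj C I \<Gamma>) (ty_obj C I \<tau>)"
| "interp C I (DPlus d e) = interp C I d \<oplus>\<^bsub>C\<^esub> interp C I e"
| "interp C I (DEps d) = \<epsilon>\<^bsub>C\<^esub> (interp C I d)"

context difference_lambda_category
begin

lemma ty_obj_Obj: "(\<And>b. I b \<in> Obj C) \<Longrightarrow> ty_obj C I \<tau> \<in> Obj C"
  by (induction \<tau>) (auto intro: Exp_Obj)

lemma ctx_obj_Obj: "(\<And>b. I b \<in> Obj C) \<Longrightarrow> ctx_obj C I \<Gamma> \<in> Obj C"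
  by (induction \<Gamma>) (auto intro: One_Obj Prod_Obj ty_obj_Obj)

lemma var_arr_Hom:
  assumes "\<And>b. I b \<in> Obj C" and "k < length \<Gamma>"
  shows "var_arr C I \<Gamma> k \<in> Hom C (ctx_obj C I \<Gamma>) (ty_obj C I (\<Gamma> ! k))"
  using assms(2)
proof (induction \<Gamma> arbitrary: k)
  case (Cons \<tau> \<Gamma>)
  then show ?case
    by (cases k) (auto intro!: Pi2_Hom Comp_Hom[OF Pi1_Hom] ty_obj_Obj ctx_obj_Obj assms(1))
qed simp

lemma Unlam_Hom:
  assumes "A \<in> Obj C" "B \<in> Obj C" "D \<in> Obj C" "g \<in> Hom C A (B \<rightarrow> D)"
  shows "Unlam C A B D g \<in> Hom C (A \<otimes> B) D"
  unfolding Unlam_def ProdMap_def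
  using assms by (blast intro: Comp_Hom Pair_Hom Ev_Hom Pi1_Hom Pi2_Hom Id_Hom)

theorem interp_Hom:
  assumes I: "\<And>b. I b \<in> Obj C" and d: "d \<triangleright> \<Gamma> \<turnstile> t : \<tau>"
  shows "interp C I d \<in> Hom C (ctx_obj C I \<Gamma>) (ty_obj C I \<tau>)"
  using d
proof (induction rule: derives.induct)
  case (1 k \<Gamma>)
  then show ?case by (simp add: var_arr_Hom I)
next
  case (2 d \<Gamma> s \<tau> \<sigma> e t)
  then show ?case
    by (auto intro: Comp_Hom Pair_Hom Ev_Hom ty_obj_Obj I)
next
  case (3 d \<Gamma> s \<tau> \<sigma> e t)
  note o = ctx_obj_Obj[where I = I and \<Gamma> = \<Gamma>, OF I] ty_obj_Obj[where I = I and \<tau> = \<tau>, OF I]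
    ty_obj_Obj[where I = I and \<tau> = \<sigma>, OF I]
  have "Unlam C (ctx_obj C I \<Gamma>) (ty_obj C I \<tau>) (ty_obj C I \<sigma>) (interp C I d)
      \<in> Hom C (ctx_obj C I \<Gamma> \<otimes> ty_obj C I \<tau>) (ty_obj C I \<sigma>)"
    using 3 o by (simp add: Unlam_Hom)
  then show ?case
    using 3 o unfolding interp.simps ty_obj.simps Let_def
    by (blast intro: Lam_Hom Comp_Hom Pair_Hom Diff_Hom Id_Hom Null_Hom Pi1_Hom Prod_Obj)
qed (auto intro: Lam_Hom Null_Hom Plus_Hom Inf_Hom ty_obj_Obj ctx_obj_Obj I)

end

end

(*
Two obstacles separate the theorem from a routine induction: a term has many typing derivations,
and a proof of s ~ t may pass through terms that have none.

Canonical forms remove the second one. Every term, typable or not, is expanded into a multiset of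
atoms, an atom being the set of all (context, type, arrow) triples that are values of one summand.
Equivalent terms get the same multiset, and the interpretation of any derivation of t is a sum of
values of the atoms of t.

It remains to see that an atom has at most one value at a given context and type. For this, binary
logical relations are set up between the interpretations of arbitrary pairs of types: equality at
equal base types, the total relation where the types differ in shape, and maps all of whose
iterated derivatives preserve the relations as exponentials. These relational objects again form
a model, the relation between a type and itself is equality, and any two values of an atom are related.
*)
theory Submission
  imports Defs "HOL-Library.Multiset"
begin

text \<open>The Taylor rule for application shapes the canonical forms. Application is not additive
  in its argument, so the argument stays a sum inside the atom, yet its infinitesimal summands must
  be able to leave it. Since D(s).(\<epsilon> e) equals \<epsilon>(D(s).e), one differentiates along
  such a summand as it stands, without recovering e; a flag saying "infinitesimal" suffices.

  Different types really meet: the type of t is lost in the type of (s t), so values computed at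
  different argument types must be compared. An arrow may preserve a relation while its derivative
  does not, hence the demand on all iterated derivatives. The critical case is then evaluation,
  whose derivative has to be expressed by evaluations again.

  Two facts about \<epsilon> are missing from the axioms: that it commutes with precomposition, and
  that it is idempotent on second differential applications. Both are extracted from axiom (6), the
  first with the help of exponentials, the second from third derivatives.\<close>

section \<open>Calculating in difference lambda-categories\<close>

context category
begin

text \<open>Hom-set membership is split into three facts so that the typing conditions of composites
  can be discharged by rewriting; the axioms are restated below in that format.\<close>

lemma Hom_iff: "f \<in> Hom C A B \<longleftrightarrow> f \<in> Arr C \<and> Dom C f = A \<and> Cod C f = B"
  by (auto simp: Hom_def)

lemma Hom_ObjD: "f \<in> Hom C A B \<Longrightarrow> A \<in> Obj C \<and> B \<in> Obj C"
  using Dom_Obj Cod_Obj by (auto simp: Hom_def)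

lemma Id_simps [simp]:
  assumes "A \<in> Obj C"
  shows "Idn C A \<in> Arr C" "Dom C (Idn C A) = A" "Cod C (Idn C A) = A"
  using Id_Hom[OF assms] by (auto simp: Hom_def)

lemma Comp_simps [simp]:
  assumes "f \<in> Arr C" "g \<in> Arr C" "Dom C g = Cod C f"
  shows "g \<cdot> f \<in> Arr C" "Dom C (g \<cdot> f) = Dom C f" "Cod C (g \<cdot> f) = Cod C g"
  using Comp_Hom[of f "Dom C f" "Cod C f" g "Cod C g"] assms by (auto simp: Hom_def)

lemma Comp_Id_simp [simp]: "f \<in> Arr C \<Longrightarrow> Dom C f = A \<Longrightarrow> f \<cdot> Idn C A = f"
  using Comp_Id[of f A "Cod C f"] by (auto simp: Hom_def)

lemma Id_Comp_simp [simp]: "f \<in> Arr C \<Longrightarrow> Cod C f = A \<Longrightarrow> Idn C A \<cdot> f = f"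
  using Id_Comp[of f "Dom C f" A] by (auto simp: Hom_def)

lemma Comp_assoc_simp [simp]:
  "\<lbrakk>f \<in> Arr C; g \<in> Arr C; h \<in> Arr C; Dom C g = Cod C f; Dom C h = Cod C g\<rbrakk>
    \<Longrightarrow> (h \<cdot> g) \<cdot> f = h \<cdot> (g \<cdot> f)"
  using Comp_assoc[of f "Dom C f" "Cod C f" g "Cod C g" h "Cod C h"] by (auto simp: Hom_def)

declare Dom_Obj [simp] Cod_Obj [simp]

end

context cartesian_category
begin

declare One_Obj [simp] Prod_Obj [simp]

lemma Pi_simps [simp]:
  assumes "A \<in> Obj C" "B \<in> Obj C"
  shows "\<pi>\<^sub>1 A B \<in> Arr C" "Dom C (\<pi>\<^sub>1 A B) = A \<otimes> B" "Cod C (\<pi>\<^sub>1 A B) = A"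
    and "\<pi>\<^sub>2 A B \<in> Arr C" "Dom C (\<pi>\<^sub>2 A B) = A \<otimes> B" "Cod C (\<pi>\<^sub>2 A B) = B"
  using Pi1_Hom[OF assms] Pi2_Hom[OF assms] by (auto simp: Hom_def)

lemma Pair_simps [simp]:
  assumes "f \<in> Arr C" "g \<in> Arr C" "Dom C f = Dom C g"
  shows "\<langle>f, g\<rangle> \<in> Arr C" "Dom C \<langle>f, g\<rangle> = Dom C g" "Cod C \<langle>f, g\<rangle> = Cod C f \<otimes> Cod C g"
  using Pair_Hom[of f "Dom C f" "Cod C f" g "Cod C g"] assms by (auto simp: Hom_def)

lemma Pi_Pair_simps [simp]:
  assumes "f \<in> Arr C" "g \<in> Arr C" "Dom C f = Dom C g" "Cod C f = A" "Cod C g = B"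
  shows "\<pi>\<^sub>1 A B \<cdot> \<langle>f, g\<rangle> = f" "\<pi>\<^sub>2 A B \<cdot> \<langle>f, g\<rangle> = g"
  using Pi1_Pair[of f "Dom C f" A g B] Pi2_Pair[of f "Dom C f" A g B] assms
  by (auto simp: Hom_def)

lemma Pair_Pi_simp:
  assumes "A \<in> Obj C" "B \<in> Obj C" "h \<in> Arr C" "Cod C h = A \<otimes> B"
  shows "\<langle>\<pi>\<^sub>1 A B \<cdot> h, \<pi>\<^sub>2 A B \<cdot> h\<rangle> = h"
  using Pair_Pi[of A B h "Dom C h"] assms by (auto simp: Hom_def)

lemma Pair_ext:
  assumes "A \<in> Obj C" "B \<in> Obj C" "h \<in> Arr C" "Cod C h = A \<otimes> B"
    and "k \<in> Arr C" "Cod C k = A \<otimes> B"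
    and "\<pi>\<^sub>1 A B \<cdot> h = \<pi>\<^sub>1 A B \<cdot> k" "\<pi>\<^sub>2 A B \<cdot> h = \<pi>\<^sub>2 A B \<cdot> k"
  shows "h = k"
  using Pair_Pi_simp[of A B h] Pair_Pi_simp[of A B k] assms by metis

lemma Pair_Comp [simp]:
  assumes "f \<in> Arr C" "g \<in> Arr C" "h \<in> Arr C" "Dom C f = Cod C h" "Dom C g = Cod C h"
  shows "\<langle>f, g\<rangle> \<cdot> h = \<langle>f \<cdot> h, g \<cdot> h\<rangle>"
proof (rule Pair_ext[of "Cod C f" "Cod C g"])
  have "\<pi>\<^sub>1 (Cod C f) (Cod C g) \<cdot> (\<langle>f, g\<rangle> \<cdot> h) = (\<pi>\<^sub>1 (Cod C f) (Cod C g) \<cdot> \<langle>f, g\<rangle>) \<cdot> h"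
    using assms by (intro Comp_assoc_simp[symmetric]) auto
  then show "\<pi>\<^sub>1 (Cod C f) (Cod C g) \<cdot> (\<langle>f, g\<rangle> \<cdot> h) = \<pi>\<^sub>1 (Cod C f) (Cod C g) \<cdot> \<langle>f \<cdot> h, g \<cdot> h\<rangle>"
    using assms by simp
  have "\<pi>\<^sub>2 (Cod C f) (Cod C g) \<cdot> (\<langle>f, g\<rangle> \<cdot> h) = (\<pi>\<^sub>2 (Cod C f) (Cod C g) \<cdot> \<langle>f, g\<rangle>) \<cdot> h"
    using assms by (intro Comp_assoc_simp[symmetric]) auto
  then show "\<pi>\<^sub>2 (Cod C f) (Cod C g) \<cdot> (\<langle>f, g\<rangle> \<cdot> h) = \<pi>\<^sub>2 (Cod C f) (Cod C g) \<cdot> \<langle>f \<cdot> h, g \<cdot> h\<rangle>"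
    using assms by simp
qed (use assms in auto)

lemma Pair_Pi_Id [simp]:
  assumes "A \<in> Obj C" "B \<in> Obj C"
  shows "\<langle>\<pi>\<^sub>1 A B, \<pi>\<^sub>2 A B\<rangle> = Idn C (A \<otimes> B)"
  using Pair_Pi_simp[of A B "Idn C (A \<otimes> B)"] assms by simp

end

context cartesian_left_additive_category
begin

lemma Plus_simps [simp]:
  assumes "f \<in> Arr C" "g \<in> Arr C" "Dom C f = Dom C g" "Cod C f = Cod C g"
  shows "f \<oplus> g \<in> Arr C" "Dom C (f \<oplus> g) = Dom C g" "Cod C (f \<oplus> g) = Cod C g"
  using Plus_Hom[of f "Dom C f" "Cod C f" g] assms by (auto simp: Hom_def)

lemma Null_simps [simp]:
  assumes "A \<in> Obj C" "B \<in> Obj C"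
  shows "\<zero> A B \<in> Arr C" "Dom C (\<zero> A B) = A" "Cod C (\<zero> A B) = B"
  using Null_Hom[OF assms] by (auto simp: Hom_def)

lemma Plus_Null_simp [simp]: "f \<in> Arr C \<Longrightarrow> Dom C f = A \<Longrightarrow> Cod C f = B \<Longrightarrow> f \<oplus> \<zero> A B = f"
  using Plus_Null[of f A B] by (auto simp: Hom_def)

lemma Plus_commute_simp:
  assumes "f \<in> Arr C" "g \<in> Arr C" "Dom C f = Dom C g" "Cod C f = Cod C g"
  shows "f \<oplus> g = g \<oplus> f"
  using Plus_commute[of f "Dom C f" "Cod C f" g] assms by (auto simp: Hom_def)

lemma Plus_assoc_simp:
  assumes "f \<in> Arr C" "g \<in> Arr C" "h \<in> Arr C" "Dom C f = Dom C g" "Cod C f = Cod C g"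
    "Dom C g = Dom C h" "Cod C g = Cod C h"
  shows "(f \<oplus> g) \<oplus> h = f \<oplus> (g \<oplus> h)"
  using Plus_assoc[of f "Dom C f" "Cod C f" g h] assms by (auto simp: Hom_def)

lemma Plus_left_commute_simp:
  assumes "f \<in> Arr C" "g \<in> Arr C" "h \<in> Arr C" "Dom C f = Dom C g" "Cod C f = Cod C g"
    "Dom C g = Dom C h" "Cod C g = Cod C h"
  shows "f \<oplus> (g \<oplus> h) = g \<oplus> (f \<oplus> h)"
  using assms Plus_assoc_simp[of f g h] Plus_assoc_simp[of g f h] Plus_commute_simp[of f g] by metis

lemmas Plus_ac = Plus_assoc_simp Plus_commute_simp Plus_left_commute_simp

lemma Null_Plus_simp [simp]: "f \<in> Arr C \<Longrightarrow> Dom C f = A \<Longrightarrow> Cod C f = B \<Longrightarrow> \<zero> A B \<oplus> f = f"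
  using Plus_commute_simp[of "\<zero> A B" f] Plus_Null_simp[of f A B] by auto

lemma Null_Comp_simp [simp]:
  "\<lbrakk>D \<in> Obj C; f \<in> Arr C; Cod C f = B\<rbrakk> \<Longrightarrow> \<zero> B D \<cdot> f = \<zero> (Dom C f) D"
  using Null_Comp[of D f "Dom C f" B] by (auto simp: Hom_def)

lemma Plus_Comp_simp [simp]:
  "\<lbrakk>f \<in> Arr C; g \<in> Arr C; h \<in> Arr C; Dom C f = Cod C h; Dom C g = Cod C h; Cod C f = Cod C g\<rbrakk>
    \<Longrightarrow> (f \<oplus> g) \<cdot> h = (f \<cdot> h) \<oplus> (g \<cdot> h)"
  using Plus_Comp[of f "Dom C f" "Cod C f" g h "Dom C h"] by (auto simp: Hom_def)

lemma Pair_Plus_simp [simp]: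
  "\<lbrakk>f1 \<in> Arr C; f2 \<in> Arr C; g1 \<in> Arr C; g2 \<in> Arr C; Dom C f1 = Dom C g1; Dom C f2 = Dom C g1;
    Dom C g2 = Dom C g1; Cod C f1 = Cod C g1; Cod C f2 = Cod C g2\<rbrakk>
    \<Longrightarrow> \<langle>f1, f2\<rangle> \<oplus> \<langle>g1, g2\<rangle> = \<langle>f1 \<oplus> g1, f2 \<oplus> g2\<rangle>"
  using Pair_Plus[of f1 "Dom C g1" "Cod C g1" g1 f2 "Cod C g2" g2] by (auto simp: Hom_def)

text \<open>Postcomposition need not preserve sums, so this is not an instance of left additivity: the
  components of a zero arrow are units for the addition of arrows.\<close>

lemma Pi_Null [simp]:
  assumes "X \<in> Obj C" "A \<in> Obj C" "B \<in> Obj C"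
  shows "\<pi>\<^sub>1 A B \<cdot> \<zero> X (A \<otimes> B) = \<zero> X A" "\<pi>\<^sub>2 A B \<cdot> \<zero> X (A \<otimes> B) = \<zero> X B"
proof -
  define a b where "a = \<pi>\<^sub>1 A B \<cdot> \<zero> X (A \<otimes> B)" and "b = \<pi>\<^sub>2 A B \<cdot> \<zero> X (A \<otimes> B)"
  have [simp]: "a \<in> Arr C" "Dom C a = X" "Cod C a = A" "b \<in> Arr C" "Dom C b = X" "Cod C b = B"
    using assms by (simp_all add: a_def b_def)
  have z: "\<zero> X (A \<otimes> B) = \<langle>a, b\<rangle>"
    unfolding a_def b_def using assms by (intro Pair_Pi_simp[symmetric]) auto
  have "\<langle>\<zero> X A, \<zero> X B\<rangle> \<oplus> \<langle>a, b\<rangle> = \<langle>\<zero> X A, \<zero> X B\<rangle>"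
    unfolding z[symmetric] using assms by (intro Plus_Null_simp) auto
  then have e: "\<langle>a, b\<rangle> = \<langle>\<zero> X A, \<zero> X B\<rangle>"
    using assms by simp
  show "\<pi>\<^sub>1 A B \<cdot> \<zero> X (A \<otimes> B) = \<zero> X A" "\<pi>\<^sub>2 A B \<cdot> \<zero> X (A \<otimes> B) = \<zero> X B"
    unfolding z e using assms by simp_all
qed

lemma Null_Prod:
  assumes "X \<in> Obj C" "A \<in> Obj C" "B \<in> Obj C"
  shows "\<zero> X (A \<otimes> B) = \<langle>\<zero> X A, \<zero> X B\<rangle>"
  using assms by (simp add: Pair_ext[of A B])

lemma Pi_Plus [simp]:
  assumes "A \<in> Obj C" "B \<in> Obj C" "h \<in> Arr C" "k \<in> Arr C" "Dom C h = Dom C k"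
    "Cod C h = A \<otimes> B" "Cod C k = A \<otimes> B"
  shows "\<pi>\<^sub>1 A B \<cdot> (h \<oplus> k) = \<pi>\<^sub>1 A B \<cdot> h \<oplus> \<pi>\<^sub>1 A B \<cdot> k"
    "\<pi>\<^sub>2 A B \<cdot> (h \<oplus> k) = \<pi>\<^sub>2 A B \<cdot> h \<oplus> \<pi>\<^sub>2 A B \<cdot> k"
proof -
  have "h \<oplus> k = \<langle>\<pi>\<^sub>1 A B \<cdot> h, \<pi>\<^sub>2 A B \<cdot> h\<rangle> \<oplus> \<langle>\<pi>\<^sub>1 A B \<cdot> k, \<pi>\<^sub>2 A B \<cdot> k\<rangle>"
    using assms by (simp only: Pair_Pi_simp)
  also have "\<dots> = \<langle>\<pi>\<^sub>1 A B \<cdot> h \<oplus> \<pi>\<^sub>1 A B \<cdot> k, \<pi>\<^sub>2 A B \<cdot> h \<oplus> \<pi>\<^sub>2 A B \<cdot> k\<rangle>"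
    using assms by simp
  finally have e: "h \<oplus> k = \<dots>" .
  show "\<pi>\<^sub>1 A B \<cdot> (h \<oplus> k) = \<pi>\<^sub>1 A B \<cdot> h \<oplus> \<pi>\<^sub>1 A B \<cdot> k"
    "\<pi>\<^sub>2 A B \<cdot> (h \<oplus> k) = \<pi>\<^sub>2 A B \<cdot> h \<oplus> \<pi>\<^sub>2 A B \<cdot> k"
    unfolding e using assms by simp_all
qed

end

context infinitesimal_extension
begin

lemma Inf_simps [simp]:
  assumes "f \<in> Arr C"
  shows "\<epsilon> f \<in> Arr C" "Dom C (\<epsilon> f) = Dom C f" "Cod C (\<epsilon> f) = Cod C f"
  using Inf_Hom[of f "Dom C f" "Cod C f"] assms by (auto simp: Hom_def)

lemma Inf_Plus_simp [simp]:
  "\<lbrakk>f \<in> Arr C; g \<in> Arr C; Dom C f = Dom C g; Cod C f = Cod C g\<rbrakk> \<Longrightarrow> \<epsilon> (f \<oplus> g) = \<epsilon> f \<oplus> \<epsilon> g"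
  using Inf_Plus[of f "Dom C f" "Cod C f" g] by (auto simp: Hom_def)

declare Inf_Null [simp]

lemma Inf_Pair_simp [simp]:
  "\<lbrakk>f \<in> Arr C; g \<in> Arr C; Dom C f = Dom C g\<rbrakk> \<Longrightarrow> \<epsilon> \<langle>f, g\<rangle> = \<langle>\<epsilon> f, \<epsilon> g\<rangle>"
  using Inf_Pair[of f "Dom C f" "Cod C f" g "Cod C g"] by (auto simp: Hom_def)

lemma Pi_Inf [simp]:
  assumes "A \<in> Obj C" "B \<in> Obj C" "h \<in> Arr C" "Cod C h = A \<otimes> B"
  shows "\<pi>\<^sub>1 A B \<cdot> \<epsilon> h = \<epsilon> (\<pi>\<^sub>1 A B \<cdot> h)" "\<pi>\<^sub>2 A B \<cdot> \<epsilon> h = \<epsilon> (\<pi>\<^sub>2 A B \<cdot> h)"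
proof -
  have "\<epsilon> h = \<epsilon> \<langle>\<pi>\<^sub>1 A B \<cdot> h, \<pi>\<^sub>2 A B \<cdot> h\<rangle>"
    using assms by (simp only: Pair_Pi_simp)
  then have e: "\<epsilon> h = \<langle>\<epsilon> (\<pi>\<^sub>1 A B \<cdot> h), \<epsilon> (\<pi>\<^sub>2 A B \<cdot> h)\<rangle>"
    using assms by simp
  show "\<pi>\<^sub>1 A B \<cdot> \<epsilon> h = \<epsilon> (\<pi>\<^sub>1 A B \<cdot> h)" "\<pi>\<^sub>2 A B \<cdot> \<epsilon> h = \<epsilon> (\<pi>\<^sub>2 A B \<cdot> h)"
    unfolding e using assms by simp_all
qed

end

context cartesian_difference_category
begin

lemma Diff_simps [simp]:
  assumes "f \<in> Arr C"
  shows "\<partial> f \<in> Arr C" "Dom C (\<partial> f) = Dom C f \<otimes> Dom C f" "Cod C (\<partial> f) = Cod C f"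
  using Diff_Hom[of f "Dom C f" "Cod C f"] assms by (auto simp: Hom_def)

lemma Diff_arith [simp]:
  "\<lbrakk>f \<in> Arr C; g \<in> Arr C; Dom C f = Dom C g; Cod C f = Cod C g\<rbrakk> \<Longrightarrow> \<partial> (f \<oplus> g) = \<partial> f \<oplus> \<partial> g"
  "\<lbrakk>A \<in> Obj C; B \<in> Obj C\<rbrakk> \<Longrightarrow> \<partial> (\<zero> A B) = \<zero> (A \<otimes> A) B"
  "f \<in> Arr C \<Longrightarrow> \<partial> (\<epsilon> f) = \<epsilon> (\<partial> f)"
  "A \<in> Obj C \<Longrightarrow> \<partial> (Idn C A) = \<pi>\<^sub>2 A A"
  "\<lbrakk>A \<in> Obj C; B \<in> Obj C\<rbrakk> \<Longrightarrow> \<partial> (\<pi>\<^sub>1 A B) = \<pi>\<^sub>1 A B \<cdot> \<pi>\<^sub>2 (A \<otimes> B) (A \<otimes> B)"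
  "\<lbrakk>A \<in> Obj C; B \<in> Obj C\<rbrakk> \<Longrightarrow> \<partial> (\<pi>\<^sub>2 A B) = \<pi>\<^sub>2 A B \<cdot> \<pi>\<^sub>2 (A \<otimes> B) (A \<otimes> B)"
  "\<lbrakk>f \<in> Arr C; g \<in> Arr C; Dom C f = Dom C g\<rbrakk> \<Longrightarrow> \<partial> \<langle>f, g\<rangle> = \<langle>\<partial> f, \<partial> g\<rangle>"
  "\<lbrakk>f \<in> Arr C; g \<in> Arr C; Dom C g = Cod C f\<rbrakk>
    \<Longrightarrow> \<partial> (g \<cdot> f) = \<partial> g \<cdot> \<langle>f \<cdot> \<pi>\<^sub>1 (Dom C f) (Dom C f), \<partial> f\<rangle>"
proof -
  show "\<partial> (f \<oplus> g) = \<partial> f \<oplus> \<partial> g"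
    if "f \<in> Arr C" "g \<in> Arr C" "Dom C f = Dom C g" "Cod C f = Cod C g"
    using CdC1_Plus[of f "Dom C f" "Cod C f" g] that by (simp add: Hom_def)
  show "\<partial> (\<epsilon> f) = \<epsilon> (\<partial> f)" if "f \<in> Arr C"
    using CdC1_Inf[of f "Dom C f" "Cod C f"] that by (simp add: Hom_def)
  show "\<partial> \<langle>f, g\<rangle> = \<langle>\<partial> f, \<partial> g\<rangle>" if "f \<in> Arr C" "g \<in> Arr C" "Dom C f = Dom C g"
    using CdC4_Pair[of f "Dom C f" "Cod C f" g "Cod C g"] that by (simp add: Hom_def)
  show "\<partial> (g \<cdot> f) = \<partial> g \<cdot> \<langle>f \<cdot> \<pi>\<^sub>1 (Dom C f) (Dom C f), \<partial> f\<rangle>"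
    if "f \<in> Arr C" "g \<in> Arr C" "Dom C g = Cod C f"
    using CdC5[of f "Dom C f" "Cod C f" g "Cod C g"] that by (simp add: Hom_def)
qed (rule CdC1_Null CdC3_Id CdC3_Pi1 CdC3_Pi2; assumption)+

lemma Diff_Pair_Null [simp]:
  "\<lbrakk>f \<in> Arr C; x \<in> Arr C; Dom C f = A; Cod C x = A; Dom C x = X\<rbrakk>
    \<Longrightarrow> \<partial> f \<cdot> \<langle>x, \<zero> X A\<rangle> = \<zero> X (Cod C f)"
  using CdC2_Null[of f A "Cod C f" x X] by (simp add: Hom_def)

lemma Taylor:
  "\<lbrakk>f \<in> Arr C; x \<in> Arr C; u \<in> Arr C; Cod C x = Dom C f; Cod C u = Dom C f; Dom C u = Dom C x\<rbrakk>
    \<Longrightarrow> f \<cdot> (x \<oplus> \<epsilon> u) = (f \<cdot> x) \<oplus> \<epsilon> (\<partial> f \<cdot> \<langle>x, u\<rangle>)"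
  using CdC0[of f "Dom C f" "Cod C f" x "Dom C x" u] by (simp add: Hom_def)

lemma Diff_direction_Plus:
  "\<lbrakk>f \<in> Arr C; x \<in> Arr C; u \<in> Arr C; v \<in> Arr C; Cod C x = Dom C f; Cod C u = Dom C f;
    Cod C v = Dom C f; Dom C u = Dom C x; Dom C v = Dom C x\<rbrakk>
    \<Longrightarrow> \<partial> f \<cdot> \<langle>x, u \<oplus> v\<rangle> = (\<partial> f \<cdot> \<langle>x, u\<rangle>) \<oplus> (\<partial> f \<cdot> \<langle>x \<oplus> \<epsilon> u, v\<rangle>)"
  using CdC2_Plus[of f "Dom C f" "Cod C f" x "Dom C x" u v] by (simp add: Hom_def)

lemma Diff_Diff_linear:
  "\<lbrakk>f \<in> Arr C; x \<in> Arr C; u \<in> Arr C; v \<in> Arr C; Cod C x = A; Cod C u = A;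
    Cod C v = A; Dom C f = A; Dom C u = X; Dom C v = X; Dom C x = X\<rbrakk>
    \<Longrightarrow> \<partial> (\<partial> f) \<cdot> \<langle>\<langle>x, u\<rangle>, \<langle>\<zero> X A, v\<rangle>\<rangle> = \<partial> f \<cdot> \<langle>x \<oplus> \<epsilon> u, v\<rangle>"
  using CdC6[of f "Dom C f" "Cod C f" x "Dom C x" u v] by (simp add: Hom_def)

lemma Diff_Diff_swap:
  "\<lbrakk>f \<in> Arr C; x \<in> Arr C; u \<in> Arr C; v \<in> Arr C; Cod C x = A; Cod C u = A;
    Cod C v = A; Dom C f = A; Dom C u = X; Dom C v = X; Dom C x = X\<rbrakk>
    \<Longrightarrow> \<partial> (\<partial> f) \<cdot> \<langle>\<langle>x, u\<rangle>, \<langle>v, \<zero> X A\<rangle>\<rangle> = \<partial> (\<partial> f) \<cdot> \<langle>\<langle>x, v\<rangle>, \<langle>u, \<zero> X A\<rangle>\<rangle>"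
  using CdC7[of f "Dom C f" "Cod C f" x "Dom C x" u v] by (simp add: Hom_def)

text \<open>Axiom (0) for \<open>\<partial> f\<close> itself, starting from the direction zero: the
  zeroth-order term vanishes, and axiom (6) turns the second derivative back into a first
  one.\<close>

lemma Diff_direction_Inf:
  assumes "f \<in> Arr C" "x \<in> Arr C" "u \<in> Arr C" "Cod C x = Dom C f" "Cod C u = Dom C f"
    "Dom C u = Dom C x"
  shows "\<partial> f \<cdot> \<langle>x, \<epsilon> u\<rangle> = \<epsilon> (\<partial> f \<cdot> \<langle>x, u\<rangle>)"
proof -
  let ?A = "Dom C f" and ?X = "Dom C x"
  have "\<partial> f \<cdot> \<langle>x, \<epsilon> u\<rangle> = \<partial> f \<cdot> (\<langle>x, \<zero> ?X ?A\<rangle> \<oplus> \<epsilon> \<langle>\<zero> ?X ?A, u\<rangle>)"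
    using assms by simp
  also have "\<dots> = \<epsilon> (\<partial> (\<partial> f) \<cdot> \<langle>\<langle>x, \<zero> ?X ?A\<rangle>, \<langle>\<zero> ?X ?A, u\<rangle>\<rangle>)"
    using assms by (subst Taylor) auto
  also have "\<dots> = \<epsilon> (\<partial> f \<cdot> \<langle>x, u\<rangle>)"
    using assms by (subst Diff_Diff_linear) auto
  finally show ?thesis .
qed

end

section \<open>Currying, evaluation and the derivatives of evaluation\<close>

context difference_lambda_category
begin

declare Exp_Obj [simp]

lemma Ev_simps [simp]:
  assumes "A \<in> Obj C" "B \<in> Obj C"
  shows "Ev C A B \<in> Arr C" "Dom C (Ev C A B) = (A \<rightarrow> B) \<otimes> A" "Cod C (Ev C A B) = B"
  using Ev_Hom[OF assms] by (auto simp: Hom_iff)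

lemma Lam_simps [simp]:
  assumes "f \<in> Arr C" "Dom C f = A \<otimes> B" "A \<in> Obj C" "B \<in> Obj C"
  shows "\<Lambda> A B f \<in> Arr C" "Dom C (\<Lambda> A B f) = A" "Cod C (\<Lambda> A B f) = B \<rightarrow> Cod C f"
  using Lam_Hom[of A B f "Cod C f"] assms by (auto simp: Hom_iff)

lemma Unlam_eq:
  assumes "B \<in> Obj C" "D \<in> Obj C" "g \<in> Arr C" "Dom C g = A" "Cod C g = B \<rightarrow> D"
  shows "Unlam C A B D g = Ev C B D \<cdot> \<langle>g \<cdot> \<pi>\<^sub>1 A B, \<pi>\<^sub>2 A B\<rangle>"
  using assms by (auto simp: Unlam_def ProdMap_def)

lemma Unlam_simps [simp]:
  assumes "B \<in> Obj C" "D \<in> Obj C" "g \<in> Arr C" "Dom C g = A" "Cod C g = B \<rightarrow> D"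
  shows "Unlam C A B D g \<in> Arr C" "Dom C (Unlam C A B D g) = A \<otimes> B" "Cod C (Unlam C A B D g) = D"
  using Unlam_Hom[of A B D g] assms by (auto simp: Hom_iff)

lemma Unlam_Lam_simp [simp]:
  assumes "f \<in> Arr C" "Dom C f = A \<otimes> B" "A \<in> Obj C" "B \<in> Obj C" "Cod C f = D"
  shows "Unlam C A B D (\<Lambda> A B f) = f"
  using Unlam_Lam[of A B f D] assms by (auto simp: Hom_iff)

lemma Lam_Unlam_simp [simp]:
  assumes "B \<in> Obj C" "D \<in> Obj C" "g \<in> Arr C" "Dom C g = A" "Cod C g = B \<rightarrow> D"
  shows "\<Lambda> A B (Unlam C A B D g) = g"
  using Lam_Unlam[of B D g A] assms by (auto simp: Hom_iff)

lemma Unlam_inject: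
  assumes "B \<in> Obj C" "D \<in> Obj C" "g \<in> Arr C" "Dom C g = A" "Cod C g = B \<rightarrow> D"
    "h \<in> Arr C" "Dom C h = A" "Cod C h = B \<rightarrow> D"
    and "Unlam C A B D g = Unlam C A B D h"
  shows "g = h"
  using Lam_Unlam_simp[of B D g A] Lam_Unlam_simp[of B D h A] assms by metis

lemma Unlam_Pair:
  assumes "B \<in> Obj C" "D \<in> Obj C" "g \<in> Arr C" "Dom C g = A" "Cod C g = B \<rightarrow> D"
    "x \<in> Arr C" "a \<in> Arr C" "Cod C x = A" "Cod C a = B" "Dom C a = Dom C x"
  shows "Unlam C A B D g \<cdot> \<langle>x, a\<rangle> = Ev C B D \<cdot> \<langle>g \<cdot> x, a\<rangle>"
  using assms by (auto simp: Unlam_eq)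

text \<open>Turns postcomposition with \<open>Ev\<close>, about which left additivity says nothing,
  into precomposition of an uncurried arrow. Additivity of evaluation in its function
  follows.\<close>

lemma Ev_eq_Unlam:
  assumes "B \<in> Obj C" "D \<in> Obj C" "g \<in> Arr C" "Cod C g = B \<rightarrow> D"
    "a \<in> Arr C" "Cod C a = B" "Dom C a = Dom C g"
  shows "Ev C B D \<cdot> \<langle>g, a\<rangle> = Unlam C (Dom C g) B D g \<cdot> \<langle>Idn C (Dom C g), a\<rangle>"
  using assms by (simp add: Unlam_Pair)

lemma Ev_Lam_Comp [simp]:
  assumes "f \<in> Arr C" "Dom C f = A \<otimes> B" "A \<in> Obj C" "B \<in> Obj C" "Cod C f = D"
    "x \<in> Arr C" "a \<in> Arr C" "Cod C x = A" "Cod C a = B" "Dom C a = Dom C x"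
  shows "Ev C B D \<cdot> \<langle>\<Lambda> A B f \<cdot> x, a\<rangle> = f \<cdot> \<langle>x, a\<rangle>"
  using Unlam_Pair[of B D "\<Lambda> A B f" A x a] assms Cod_Obj[of f] by simp

lemma Ev_Lam [simp]:
  assumes "f \<in> Arr C" "Dom C f = A \<otimes> B" "A \<in> Obj C" "B \<in> Obj C" "Cod C f = D"
    "a \<in> Arr C" "Cod C a = B" "Dom C a = A"
  shows "Ev C B D \<cdot> \<langle>\<Lambda> A B f, a\<rangle> = f \<cdot> \<langle>Idn C A, a\<rangle>"
  using Ev_Lam_Comp[of f A B D "Idn C A" a] assms Cod_Obj[of f] by simp

lemma Unlam_Comp:
  assumes "B \<in> Obj C" "D \<in> Obj C" "g \<in> Arr C" "Dom C g = A" "Cod C g = B \<rightarrow> D"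
    "x \<in> Arr C" "Cod C x = A" "Dom C x = X"
  shows "Unlam C X B D (g \<cdot> x) = Unlam C A B D g \<cdot> \<langle>x \<cdot> \<pi>\<^sub>1 X B, \<pi>\<^sub>2 X B\<rangle>"
  using assms by (auto simp: Unlam_eq)

lemma Lam_Comp:
  assumes "f \<in> Arr C" "Dom C f = A \<otimes> B" "A \<in> Obj C" "B \<in> Obj C"
    "x \<in> Arr C" "Cod C x = A" "Dom C x = X"
  shows "\<Lambda> A B f \<cdot> x = \<Lambda> X B (f \<cdot> \<langle>x \<cdot> \<pi>\<^sub>1 X B, \<pi>\<^sub>2 X B\<rangle>)"
  by (rule Unlam_inject[where A = X and B = B and D = "Cod C f"])
    (use assms in \<open>auto simp: Unlam_Comp\<close>)

lemma Unlam_Plus [simp]: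
  assumes "B \<in> Obj C" "D \<in> Obj C" "g \<in> Arr C" "Dom C g = A" "Cod C g = B \<rightarrow> D"
    "h \<in> Arr C" "Dom C h = A" "Cod C h = B \<rightarrow> D"
  shows "Unlam C A B D (g \<oplus> h) = Unlam C A B D g \<oplus> Unlam C A B D h"
proof -
  let ?g = "Unlam C A B D g" and ?h = "Unlam C A B D h"
  have [simp]: "A \<in> Obj C" using assms Dom_Obj by blast
  have "\<Lambda> A B (?g \<oplus> ?h) = \<Lambda> A B ?g \<oplus> \<Lambda> A B ?h"
    using assms by (intro Lam_Plus) (auto simp: Hom_iff)
  then have "Unlam C A B D (\<Lambda> A B (?g \<oplus> ?h)) = Unlam C A B D (g \<oplus> h)"
    using assms by simp
  then show ?thesis using assms by simp
qed

lemma Unlam_Null [simp]: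
  assumes "A \<in> Obj C" "B \<in> Obj C" "D \<in> Obj C"
  shows "Unlam C A B D (\<zero> A (B \<rightarrow> D)) = \<zero> (A \<otimes> B) D"
  using Unlam_Lam_simp[of "\<zero> (A \<otimes> B) D" A B D] assms by (simp add: Lam_Null)

lemma Unlam_Inf [simp]:
  assumes "B \<in> Obj C" "D \<in> Obj C" "g \<in> Arr C" "Dom C g = A" "Cod C g = B \<rightarrow> D"
  shows "Unlam C A B D (\<epsilon> g) = \<epsilon> (Unlam C A B D g)"
proof -
  let ?g = "Unlam C A B D g"
  have [simp]: "A \<in> Obj C" using assms Dom_Obj by blast
  have "\<Lambda> A B (\<epsilon> ?g) = \<epsilon> (\<Lambda> A B ?g)"
    using assms by (intro Lam_Inf) (auto simp: Hom_iff)
  then have "Unlam C A B D (\<Lambda> A B (\<epsilon> ?g)) = Unlam C A B D (\<epsilon> g)"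
    using assms by simp
  then show ?thesis using assms by simp
qed

lemma Ev_Null [simp]:
  assumes "X \<in> Obj C" "A \<in> Obj C" "B \<in> Obj C" "a \<in> Arr C" "Dom C a = X" "Cod C a = A"
  shows "Ev C A B \<cdot> \<langle>\<zero> X (A \<rightarrow> B), a\<rangle> = \<zero> X B"
  using assms by (simp add: Ev_eq_Unlam)

lemma Ev_Plus [simp]:
  assumes "A \<in> Obj C" "B \<in> Obj C" "f \<in> Arr C" "g \<in> Arr C" "Dom C f = Dom C a" "Dom C g = Dom C a"
    "Cod C f = A \<rightarrow> B" "Cod C g = A \<rightarrow> B" "a \<in> Arr C" "Cod C a = A"
  shows "Ev C A B \<cdot> \<langle>f \<oplus> g, a\<rangle> = Ev C A B \<cdot> \<langle>f, a\<rangle> \<oplus> Ev C A B \<cdot> \<langle>g, a\<rangle>"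
  using assms by (simp add: Ev_eq_Unlam)

lemma Lam_Ev:
  assumes "A \<in> Obj C" "B \<in> Obj C"
  shows "\<Lambda> (A \<rightarrow> B) A (Ev C A B) = Idn C (A \<rightarrow> B)"
  by (rule Unlam_inject[where A = "A \<rightarrow> B" and B = A and D = B])
    (use assms in \<open>auto simp: Unlam_eq\<close>)

text \<open>Evaluation is linear in its function. By \<open>Lam_Ev\<close> the identity is a
  currying of \<open>Ev\<close>; its derivative is a projection on the one hand and is given by
  \<open>Diff_Lam\<close> on the other.\<close>

lemma Diff_Ev_left:
  assumes "A \<in> Obj C" "B \<in> Obj C" "f \<in> Arr C" "h \<in> Arr C" "a \<in> Arr C" "Dom C f = X"
    "Dom C h = X" "Dom C a = X" "Cod C f = A \<rightarrow> B" "Cod C h = A \<rightarrow> B" "Cod C a = A"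
  shows "\<partial> (Ev C A B) \<cdot> \<langle>\<langle>f, a\<rangle>, \<langle>h, \<zero> X A\<rangle>\<rangle> = Ev C A B \<cdot> \<langle>h, a\<rangle>"
proof -
  let ?E = "A \<rightarrow> B"
  have "\<pi>\<^sub>2 ?E ?E = \<Lambda> (?E \<otimes> ?E) A (\<partial> (Ev C A B) \<cdot>
      \<langle>ProdMap C (?E \<otimes> ?E) A (\<pi>\<^sub>1 ?E ?E) (Idn C A), ProdMap C (?E \<otimes> ?E) A (\<pi>\<^sub>2 ?E ?E) (\<zero> A A)\<rangle>)"
    using Diff_Lam[of ?E A "Ev C A B" B] assms(1,2) by (simp add: Lam_Ev Hom_iff)
  then have "Ev C A B \<cdot> \<langle>\<pi>\<^sub>2 ?E ?E \<cdot> \<langle>f, h\<rangle>, a\<rangle> = Ev C A B \<cdot> \<langle>\<Lambda> (?E \<otimes> ?E) A (\<partial> (Ev C A B) \<cdot>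
      \<langle>ProdMap C (?E \<otimes> ?E) A (\<pi>\<^sub>1 ?E ?E) (Idn C A), ProdMap C (?E \<otimes> ?E) A (\<pi>\<^sub>2 ?E ?E) (\<zero> A A)\<rangle>) \<cdot> \<langle>f, h\<rangle>, a\<rangle>"
    by (rule arg_cong)
  then show ?thesis
    using assms by (simp add: ProdMap_def)
qed

lemma Diff_Unlam_Pair:
  assumes "B \<in> Obj C" "D \<in> Obj C" "g \<in> Arr C" "Dom C g = A" "Cod C g = B \<rightarrow> D"
    "x \<in> Arr C" "u \<in> Arr C" "a \<in> Arr C" "b \<in> Arr C" "Cod C x = A" "Cod C u = A" "Cod C a = B"
    "Cod C b = B" "Dom C x = X" "Dom C u = X" "Dom C a = X" "Dom C b = X"
  shows "\<partial> (Unlam C A B D g) \<cdot> \<langle>\<langle>x, a\<rangle>, \<langle>u, b\<rangle>\<rangle> =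
    \<partial> (Ev C B D) \<cdot> \<langle>\<langle>g \<cdot> x, a\<rangle>, \<langle>\<partial> g \<cdot> \<langle>x, u\<rangle>, b\<rangle>\<rangle>"
  using assms by (auto simp: Unlam_eq)

text \<open>With no increment of the function, only the derivative of the uncurried \<open>f\<close>
  in its second argument remains: the derivative of \<open>f\<close> along zero vanishes.\<close>

lemma Diff_Ev_right:
  assumes "A \<in> Obj C" "B \<in> Obj C" "f \<in> Arr C" "a \<in> Arr C" "b \<in> Arr C" "Dom C f = X"
    "Dom C a = X" "Dom C b = X" "Cod C f = A \<rightarrow> B" "Cod C a = A" "Cod C b = A"
  shows "\<partial> (Ev C A B) \<cdot> \<langle>\<langle>f, a\<rangle>, \<langle>\<zero> X (A \<rightarrow> B), b\<rangle>\<rangle> =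
    \<partial> (Unlam C X A B f) \<cdot> \<langle>\<langle>Idn C X, a\<rangle>, \<langle>\<zero> X X, b\<rangle>\<rangle>"
  using assms by (auto simp: Diff_Unlam_Pair)

text \<open>The direction is split into a function part and an argument part. Axiom (2) moves the
  base point by \<epsilon> of the part treated first, whence
  \<open>f \<oplus> \<epsilon> h\<close>.\<close>

lemma Diff_Ev:
  assumes "A \<in> Obj C" "B \<in> Obj C" "f \<in> Arr C" "h \<in> Arr C" "a \<in> Arr C" "b \<in> Arr C" "Dom C f = X"
    "Dom C h = X" "Dom C a = X" "Dom C b = X" "Cod C f = A \<rightarrow> B" "Cod C h = A \<rightarrow> B" "Cod C a = A"
    "Cod C b = A"
  shows "\<partial> (Ev C A B) \<cdot> \<langle>\<langle>f, a\<rangle>, \<langle>h, b\<rangle>\<rangle> =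
    Ev C A B \<cdot> \<langle>h, a\<rangle> \<oplus> \<partial> (Ev C A B) \<cdot> \<langle>\<langle>f \<oplus> \<epsilon> h, a\<rangle>, \<langle>\<zero> X (A \<rightarrow> B), b\<rangle>\<rangle>"
proof -
  have X: "X \<in> Obj C" using assms by auto
  then have "\<partial> (Ev C A B) \<cdot> \<langle>\<langle>f, a\<rangle>, \<langle>h, b\<rangle>\<rangle> =
    \<partial> (Ev C A B) \<cdot> \<langle>\<langle>f, a\<rangle>, \<langle>h, \<zero> X A\<rangle> \<oplus> \<langle>\<zero> X (A \<rightarrow> B), b\<rangle>\<rangle>"
    using assms by simp
  also have "\<dots> = Ev C A B \<cdot> \<langle>h, a\<rangle> \<oplus>
      \<partial> (Ev C A B) \<cdot> \<langle>\<langle>f, a\<rangle> \<oplus> \<epsilon> \<langle>h, \<zero> X A\<rangle>, \<langle>\<zero> X (A \<rightarrow> B), b\<rangle>\<rangle>"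
    using assms X by (subst Diff_direction_Plus) (auto simp: Diff_Ev_left simp del: Pair_Plus_simp)
  finally show ?thesis using assms X by simp
qed

text \<open>The linearity law \<open>Diff_Ev_left\<close>, read as an equation between arrows in the
  three variables \<open>f\<close>, \<open>a\<close>, \<open>h\<close>, is differentiated in the
  direction that moves only \<open>a\<close>.\<close>

lemma Diff_Diff_Ev:
  assumes "A \<in> Obj C" "B \<in> Obj C" "f \<in> Arr C" "h \<in> Arr C" "a \<in> Arr C" "b \<in> Arr C" "Dom C f = X"
    "Dom C h = X" "Dom C a = X" "Dom C b = X" "Cod C f = A \<rightarrow> B" "Cod C h = A \<rightarrow> B" "Cod C a = A"
    "Cod C b = A"
  shows "\<partial> (\<partial> (Ev C A B)) \<cdot>
      \<langle>\<langle>\<langle>f, a\<rangle>, \<langle>h, \<zero> X A\<rangle>\<rangle>, \<langle>\<langle>\<zero> X (A \<rightarrow> B), b\<rangle>, \<zero> X ((A \<rightarrow> B) \<otimes> A)\<rangle>\<rangle> =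
    \<partial> (Ev C A B) \<cdot> \<langle>\<langle>h, a\<rangle>, \<langle>\<zero> X (A \<rightarrow> B), b\<rangle>\<rangle>"
proof -
  have X: "X \<in> Obj C" using assms by auto
  let ?E = "A \<rightarrow> B"
  let ?P = "(?E \<otimes> A) \<otimes> ?E"
  have "\<partial> (Ev C A B) \<cdot> \<langle>Idn C (?E \<otimes> A) \<cdot> \<pi>\<^sub>1 (?E \<otimes> A) ?E, \<langle>\<pi>\<^sub>2 (?E \<otimes> A) ?E, \<zero> ?P A\<rangle>\<rangle> =
      Ev C A B \<cdot> \<langle>\<pi>\<^sub>2 (?E \<otimes> A) ?E, \<pi>\<^sub>2 ?E A \<cdot> \<pi>\<^sub>1 (?E \<otimes> A) ?E\<rangle>"
    unfolding Pair_Pi_Id[OF Exp_Obj[OF assms(1,2)] assms(1), symmetric]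
    using assms(1,2) by (simp add: Diff_Ev_left del: Pair_Pi_Id)
  from arg_cong[where f = "\<lambda>g. \<partial> g \<cdot> \<langle>\<langle>\<langle>f, a\<rangle>, h\<rangle>, \<langle>\<langle>\<zero> X ?E, b\<rangle>, \<zero> X ?E\<rangle>\<rangle>", OF this]
  show ?thesis using assms X by (simp add: Null_Prod)
qed

text \<open>The axioms do not say that \<open>\<epsilon>\<close> commutes with precomposition. It does, because the second
  derivative of evaluation expresses \<open>\<epsilon>\<close> by an arrow that does not mention it.\<close>

lemma Inf_eq_Diff_Diff_Ev:
  assumes "b \<in> Arr C" "Dom C b = X" "Cod C b = A"
  shows "\<epsilon> b = \<partial> (\<partial> (Ev C A A)) \<cdot>
    \<langle>\<langle>\<zero> X ((A \<rightarrow> A) \<otimes> A), \<langle>\<Lambda> X A (\<pi>\<^sub>2 X A), \<zero> X A\<rangle>\<rangle>, \<langle>\<zero> X ((A \<rightarrow> A) \<otimes> A), \<langle>\<zero> X (A \<rightarrow> A), b\<rangle>\<rangle>\<rangle>"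
    (is "_ = ?R")
proof -
  have o [simp]: "X \<in> Obj C" "A \<in> Obj C" using assms by auto
  let ?E = "A \<rightarrow> A"
  let ?Z = "\<zero> X (?E \<otimes> A)"
  \<comment> \<open>The currying of the second projection names the identity function on
    \<open>A\<close>. Its derivative along \<open>b\<close> is \<open>b\<close>, so the \<epsilon>
    that axiom (6) puts in front of \<open>?h\<close> ends up in front of \<open>b\<close>.\<close>
  let ?h = "\<langle>\<Lambda> X A (\<pi>\<^sub>2 X A), \<zero> X A\<rangle>" and ?b = "\<langle>\<zero> X ?E, b\<rangle>"
  have "?R = \<partial> (Ev C A A) \<cdot> \<langle>?Z \<oplus> \<epsilon> ?h, ?b\<rangle>"
    using assms by (intro Diff_Diff_linear) auto
  also have "\<dots> = \<partial> (Ev C A A) \<cdot> (\<langle>?Z, ?b\<rangle> \<oplus> \<epsilon> \<langle>?h, ?Z\<rangle>)"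
    using assms by simp
  also have "\<dots> = \<partial> (Ev C A A) \<cdot> \<langle>?Z, ?b\<rangle> \<oplus> \<epsilon> (\<partial> (\<partial> (Ev C A A)) \<cdot> \<langle>\<langle>?Z, ?b\<rangle>, \<langle>?h, ?Z\<rangle>\<rangle>)"
    using assms by (intro Taylor) auto
  also have "\<partial> (Ev C A A) \<cdot> \<langle>?Z, ?b\<rangle> = \<zero> X A"
    using assms by (simp add: Null_Prod Diff_Ev_right)
  also have "\<partial> (\<partial> (Ev C A A)) \<cdot> \<langle>\<langle>?Z, ?b\<rangle>, \<langle>?h, ?Z\<rangle>\<rangle> =
      \<partial> (\<partial> (Ev C A A)) \<cdot> \<langle>\<langle>?Z, ?h\<rangle>, \<langle>?b, ?Z\<rangle>\<rangle>"
    using assms by (intro Diff_Diff_swap) auto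
  also have "\<dots> = \<partial> (\<partial> (Ev C A A)) \<cdot> \<langle>\<langle>\<langle>\<zero> X ?E, \<zero> X A\<rangle>, ?h\<rangle>, \<langle>?b, ?Z\<rangle>\<rangle>"
    by (simp only: Null_Prod o Exp_Obj)
  also have "\<dots> = \<partial> (Ev C A A) \<cdot> \<langle>\<langle>\<Lambda> X A (\<pi>\<^sub>2 X A), \<zero> X A\<rangle>, ?b\<rangle>"
    using assms by (intro Diff_Diff_Ev) auto
  also have "\<dots> = b"
    using assms by (simp add: Diff_Ev_right)
  finally show ?thesis using assms by simp
qed

lemma Inf_Comp [simp]:
  assumes "b \<in> Arr C" "k \<in> Arr C" "Dom C b = Cod C k"
  shows "\<epsilon> b \<cdot> k = \<epsilon> (b \<cdot> k)"
  using assms by (simp add: Inf_eq_Diff_Diff_Ev Lam_Comp)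

text \<open>Differentiate the identity \<open>\<partial>\<^sup>2[f] \<cdot> \<langle>\<langle>x, 0\<rangle>, \<langle>0, v\<rangle>\<rangle> = \<partial>[f] \<cdot> \<langle>x, v\<rangle>\<close> with respect to \<open>v\<close>.\<close>

lemma Inf_Inf_Diff_base:
  assumes "f \<in> Arr C" "x \<in> Arr C" "v \<in> Arr C" "w \<in> Arr C" "Dom C f = A" "Cod C x = A" "Cod C v = A"
    "Cod C w = A" "Dom C x = X" "Dom C v = X" "Dom C w = X"
  shows "\<partial> f \<cdot> \<langle>x \<oplus> \<epsilon> (\<epsilon> v), w\<rangle> = \<partial> f \<cdot> \<langle>x \<oplus> \<epsilon> v, w\<rangle>"
proof -
  have o [simp]: "X \<in> Obj C" "A \<in> Obj C" using assms by auto
  let ?P = "A \<otimes> A"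
  have "\<partial> (\<partial> f) \<cdot> \<langle>\<langle>\<pi>\<^sub>1 A A, \<zero> ?P A\<rangle>, \<langle>\<zero> ?P A, \<pi>\<^sub>2 A A\<rangle>\<rangle> = \<partial> f"
    using assms by (simp add: Diff_Diff_linear)
  from arg_cong[where f = "\<lambda>g. \<partial> g \<cdot> \<langle>\<langle>x, v\<rangle>, \<langle>\<zero> X A, w\<rangle>\<rangle>", OF this]
  have "\<partial> (\<partial> (\<partial> f)) \<cdot> \<langle>\<langle>\<langle>x, \<zero> X A\<rangle>, \<langle>\<zero> X A, v\<rangle>\<rangle>, \<langle>\<langle>\<zero> X A, \<zero> X A\<rangle>, \<langle>\<zero> X A, w\<rangle>\<rangle>\<rangle> =
      \<partial> (\<partial> f) \<cdot> \<langle>\<langle>x, v\<rangle>, \<langle>\<zero> X A, w\<rangle>\<rangle>"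
    using assms by simp
  also have "\<dots> = \<partial> f \<cdot> \<langle>x \<oplus> \<epsilon> v, w\<rangle>"
    using assms by (simp add: Diff_Diff_linear)
  finally have e: "\<partial> (\<partial> (\<partial> f)) \<cdot> \<langle>\<langle>\<langle>x, \<zero> X A\<rangle>, \<langle>\<zero> X A, v\<rangle>\<rangle>, \<langle>\<langle>\<zero> X A, \<zero> X A\<rangle>, \<langle>\<zero> X A, w\<rangle>\<rangle>\<rangle> =
      \<partial> f \<cdot> \<langle>x \<oplus> \<epsilon> v, w\<rangle>" .
  \<comment> \<open>The same third derivative computed by axiom (6) twice, first for
    \<open>\<partial> f\<close> and then for \<open>f\<close>; each use contributes one \<epsilon>
    to \<open>v\<close>.\<close>
  have "\<partial> (\<partial> (\<partial> f)) \<cdot> \<langle>\<langle>\<langle>x, \<zero> X A\<rangle>, \<langle>\<zero> X A, v\<rangle>\<rangle>, \<langle>\<langle>\<zero> X A, \<zero> X A\<rangle>, \<langle>\<zero> X A, w\<rangle>\<rangle>\<rangle> =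
      \<partial> (\<partial> f) \<cdot> \<langle>\<langle>x, \<zero> X A\<rangle> \<oplus> \<epsilon> \<langle>\<zero> X A, v\<rangle>, \<langle>\<zero> X A, w\<rangle>\<rangle>"
    using Diff_Diff_linear[of "\<partial> f" "\<langle>x, \<zero> X A\<rangle>" "\<langle>\<zero> X A, v\<rangle>" "\<langle>\<zero> X A, w\<rangle>" "A \<otimes> A" X]
      assms by (simp add: Null_Prod)
  also have "\<dots> = \<partial> f \<cdot> \<langle>x \<oplus> \<epsilon> (\<epsilon> v), w\<rangle>"
    using assms by (simp add: Diff_Diff_linear)
  finally show ?thesis using e by simp
qed

text \<open>The derivative of \<open>Inf_Inf_Diff_base\<close> in the variable \<open>v\<close>,
  taken at zero: there both base points reduce to \<open>x\<close>, and every \<epsilon> on the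
  direction moves out by linearity.\<close>

lemma Inf_Inf_Diff_Diff:
  assumes "f \<in> Arr C" "x \<in> Arr C" "v \<in> Arr C" "w \<in> Arr C" "Dom C f = A" "Cod C x = A" "Cod C v = A"
    "Cod C w = A" "Dom C x = X" "Dom C v = X" "Dom C w = X"
  shows "\<epsilon> (\<epsilon> (\<partial> (\<partial> f) \<cdot> \<langle>\<langle>x, w\<rangle>, \<langle>v, \<zero> X A\<rangle>\<rangle>)) = \<epsilon> (\<partial> (\<partial> f) \<cdot> \<langle>\<langle>x, w\<rangle>, \<langle>v, \<zero> X A\<rangle>\<rangle>)"
proof -
  have o [simp]: "X \<in> Obj C" "A \<in> Obj C" using assms by auto
  have i: "\<partial> (\<partial> f) \<cdot> \<langle>\<langle>x, w\<rangle>, \<langle>\<epsilon> u, \<zero> X A\<rangle>\<rangle> = \<epsilon> (\<partial> (\<partial> f) \<cdot> \<langle>\<langle>x, w\<rangle>, \<langle>u, \<zero> X A\<rangle>\<rangle>)"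
    if "u \<in> Arr C" "Dom C u = X" "Cod C u = A" for u
    using Diff_direction_Inf[of "\<partial> f" "\<langle>x, w\<rangle>" "\<langle>u, \<zero> X A\<rangle>"] assms that by simp
  let ?x = "\<pi>\<^sub>1 A A \<cdot> \<pi>\<^sub>1 (A \<otimes> A) A" and ?w = "\<pi>\<^sub>2 A A \<cdot> \<pi>\<^sub>1 (A \<otimes> A) A" and ?v = "\<pi>\<^sub>2 (A \<otimes> A) A"
  have "\<partial> f \<cdot> \<langle>?x \<oplus> \<epsilon> (\<epsilon> ?v), ?w\<rangle> = \<partial> f \<cdot> \<langle>?x \<oplus> \<epsilon> ?v, ?w\<rangle>"
    using assms by (intro Inf_Inf_Diff_base) auto
  from arg_cong[where f = "\<lambda>g. \<partial> g \<cdot> \<langle>\<langle>\<langle>x, w\<rangle>, \<zero> X A\<rangle>, \<langle>\<langle>\<zero> X A, \<zero> X A\<rangle>, v\<rangle>\<rangle>", OF this]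
  show ?thesis using assms by (simp add: i)
qed

section \<open>The differential application of arrows\<close>

definition dapp :: "'o \<Rightarrow> 'o \<Rightarrow> 'o \<Rightarrow> 'm \<Rightarrow> 'm \<Rightarrow> 'm" where
  "dapp A B D f g = \<Lambda> A B (\<partial> (Unlam C A B D f) \<cdot>
     \<langle>Idn C (A \<otimes> B), \<langle>\<zero> (A \<otimes> B) A, g \<cdot> \<pi>\<^sub>1 A B\<rangle>\<rangle>)"

context
  fixes A B D :: 'o
  assumes obj [simp]: "A \<in> Obj C" "B \<in> Obj C" "D \<in> Obj C"
begin

lemma dapp_Hom:
  assumes "f \<in> Hom C A (B \<rightarrow> D)" "g \<in> Hom C A B"
  shows "dapp A B D f g \<in> Hom C A (B \<rightarrow> D)"
  using assms by (simp add: dapp_def Hom_iff)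

lemma dapp_simps [simp]:
  assumes "f \<in> Arr C" "g \<in> Arr C" "Dom C f = A" "Dom C g = A" "Cod C f = B \<rightarrow> D" "Cod C g = B"
  shows "dapp A B D f g \<in> Arr C" "Dom C (dapp A B D f g) = A" "Cod C (dapp A B D f g) = B \<rightarrow> D"
  using dapp_Hom[of f g] assms by (auto simp: Hom_iff)

lemma Unlam_dapp:
  assumes "f \<in> Arr C" "g \<in> Arr C" "Dom C f = A" "Dom C g = A" "Cod C f = B \<rightarrow> D" "Cod C g = B"
  shows "Unlam C A B D (dapp A B D f g) = \<partial> (Unlam C A B D f) \<cdot>
     \<langle>Idn C (A \<otimes> B), \<langle>\<zero> (A \<otimes> B) A, g \<cdot> \<pi>\<^sub>1 A B\<rangle>\<rangle>"
  using assms by (simp add: dapp_def)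

lemma Unlam_injectH:
  assumes "Unlam C A B D g = Unlam C A B D h" "g \<in> Hom C A (B \<rightarrow> D)" "h \<in> Hom C A (B \<rightarrow> D)"
  shows "g = h"
  using assms by (intro Unlam_inject[of B D g A h]) (auto simp: Hom_iff)

lemma dapp_Plus_left:
  assumes "f \<in> Hom C A (B \<rightarrow> D)" "f' \<in> Hom C A (B \<rightarrow> D)" "g \<in> Hom C A B"
  shows "dapp A B D (f \<oplus> f') g = dapp A B D f g \<oplus> dapp A B D f' g"
  by (rule Unlam_injectH) (use assms in \<open>simp_all add: Hom_iff Unlam_dapp\<close>)

lemma dapp_Null_left:
  assumes "g \<in> Hom C A B"
  shows "dapp A B D (\<zero> A (B \<rightarrow> D)) g = \<zero> A (B \<rightarrow> D)"
  by (rule Unlam_injectH) (use assms in \<open>simp_all add: Hom_iff Unlam_dapp\<close>)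

lemma dapp_Inf_left:
  assumes "f \<in> Hom C A (B \<rightarrow> D)" "g \<in> Hom C A B"
  shows "dapp A B D (\<epsilon> f) g = \<epsilon> (dapp A B D f g)"
  by (rule Unlam_injectH) (use assms in \<open>simp_all add: Hom_iff Unlam_dapp\<close>)

lemma dapp_Null_right:
  assumes "f \<in> Hom C A (B \<rightarrow> D)"
  shows "dapp A B D f (\<zero> A B) = \<zero> A (B \<rightarrow> D)"
  by (rule Unlam_injectH) (use assms in \<open>simp_all add: Hom_iff Unlam_dapp flip: Null_Prod\<close>)

lemma dapp_Inf_right:
  assumes "f \<in> Hom C A (B \<rightarrow> D)" "g \<in> Hom C A B"
  shows "dapp A B D f (\<epsilon> g) = \<epsilon> (dapp A B D f g)"
proof (rule Unlam_injectH)
  let ?P = "A \<otimes> B"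
  have "\<partial> (Unlam C A B D f) \<cdot> \<langle>Idn C ?P, \<epsilon> \<langle>\<zero> ?P A, g \<cdot> \<pi>\<^sub>1 A B\<rangle>\<rangle> =
    \<epsilon> (\<partial> (Unlam C A B D f) \<cdot> \<langle>Idn C ?P, \<langle>\<zero> ?P A, g \<cdot> \<pi>\<^sub>1 A B\<rangle>\<rangle>)"
    using assms by (intro Diff_direction_Inf) (auto simp: Hom_iff)
  then show "Unlam C A B D (dapp A B D f (\<epsilon> g)) = Unlam C A B D (\<epsilon> (dapp A B D f g))"
    using assms by (simp add: Hom_iff Unlam_dapp)
qed (use assms in \<open>simp_all add: Hom_iff\<close>)

text \<open>The direction \<open>g\<close> depends on the context only, and the second
  differentiation keeps the context fixed, so the direction contributes zero. What is left has the
  shape required by axiom (7).\<close>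

lemma Unlam_dapp_dapp:
  assumes "f \<in> Hom C A (B \<rightarrow> D)" "g \<in> Hom C A B" "h \<in> Hom C A B"
  defines "P \<equiv> A \<otimes> B"
  shows "Unlam C A B D (dapp A B D (dapp A B D f g) h) = \<partial> (\<partial> (Unlam C A B D f)) \<cdot>
    \<langle>\<langle>Idn C P, \<langle>\<zero> P A, g \<cdot> \<pi>\<^sub>1 A B\<rangle>\<rangle>, \<langle>\<langle>\<zero> P A, h \<cdot> \<pi>\<^sub>1 A B\<rangle>, \<zero> P P\<rangle>\<rangle>"
  using assms(1-3) unfolding P_def by (simp add: Hom_iff Unlam_dapp Null_Prod)

lemma dapp_swap:
  assumes "f \<in> Hom C A (B \<rightarrow> D)" "g \<in> Hom C A B" "h \<in> Hom C A B"
  shows "dapp A B D (dapp A B D f g) h = dapp A B D (dapp A B D f h) g"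
proof (rule Unlam_injectH)
  show "Unlam C A B D (dapp A B D (dapp A B D f g) h) = Unlam C A B D (dapp A B D (dapp A B D f h) g)"
    unfolding Unlam_dapp_dapp[OF assms] Unlam_dapp_dapp[OF assms(1,3,2)]
    using assms by (intro Diff_Diff_swap) (auto simp: Hom_iff)
qed (use assms in \<open>simp_all add: Hom_iff\<close>)

lemma Inf_Inf_dapp_dapp:
  assumes "f \<in> Hom C A (B \<rightarrow> D)" "g \<in> Hom C A B" "h \<in> Hom C A B"
  shows "\<epsilon> (\<epsilon> (dapp A B D (dapp A B D f g) h)) = \<epsilon> (dapp A B D (dapp A B D f g) h)"
proof (rule Unlam_injectH)
  have "Unlam C A B D (\<epsilon> (\<epsilon> (dapp A B D (dapp A B D f g) h))) =
      \<epsilon> (\<epsilon> (Unlam C A B D (dapp A B D (dapp A B D f g) h)))"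
    using assms by (simp add: Hom_iff)
  also have "\<dots> = \<epsilon> (Unlam C A B D (dapp A B D (dapp A B D f g) h))"
    unfolding Unlam_dapp_dapp[OF assms]
    using assms by (intro Inf_Inf_Diff_Diff) (auto simp: Hom_iff)
  finally show "Unlam C A B D (\<epsilon> (\<epsilon> (dapp A B D (dapp A B D f g) h))) =
      Unlam C A B D (\<epsilon> (dapp A B D (dapp A B D f g) h))"
    using assms by (simp add: Hom_iff)
qed (use assms in \<open>simp_all add: Hom_iff\<close>)

text \<open>Axiom (2) leaves one derivative at a base point shifted by \<epsilon>; axiom (0),
  applied to that derivative, converts the shift into the correction term with a second
  derivative.\<close>

lemma dapp_Plus_right:
  assumes "f \<in> Hom C A (B \<rightarrow> D)" "g \<in> Hom C A B" "h \<in> Hom C A B"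
  shows "dapp A B D f (g \<oplus> h) =
    (dapp A B D f g \<oplus> dapp A B D f h) \<oplus> \<epsilon> (dapp A B D (dapp A B D f g) h)"
proof (rule Unlam_injectH)
  let ?P = "A \<otimes> B" and ?F = "Unlam C A B D f"
  let ?u = "\<langle>\<zero> ?P A, g \<cdot> \<pi>\<^sub>1 A B\<rangle>" and ?v = "\<langle>\<zero> ?P A, h \<cdot> \<pi>\<^sub>1 A B\<rangle>"
  have "\<partial> ?F \<cdot> \<langle>Idn C ?P \<oplus> \<epsilon> ?u, ?v\<rangle> = \<partial> ?F \<cdot> (\<langle>Idn C ?P, ?v\<rangle> \<oplus> \<epsilon> \<langle>?u, \<zero> ?P ?P\<rangle>)"
    using assms by (simp add: Hom_iff)
  also have "\<dots> = \<partial> ?F \<cdot> \<langle>Idn C ?P, ?v\<rangle> \<oplus> \<epsilon> (\<partial> (\<partial> ?F) \<cdot> \<langle>\<langle>Idn C ?P, ?v\<rangle>, \<langle>?u, \<zero> ?P ?P\<rangle>\<rangle>)"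
    using assms by (intro Taylor) (auto simp: Hom_iff)
  also have "\<partial> (\<partial> ?F) \<cdot> \<langle>\<langle>Idn C ?P, ?v\<rangle>, \<langle>?u, \<zero> ?P ?P\<rangle>\<rangle> = Unlam C A B D (dapp A B D (dapp A B D f h) g)"
    using Unlam_dapp_dapp[OF assms(1,3,2)] by simp
  also have "\<dots> = Unlam C A B D (dapp A B D (dapp A B D f g) h)"
    using dapp_swap[OF assms] by simp
  finally have e: "\<partial> ?F \<cdot> \<langle>Idn C ?P \<oplus> \<epsilon> ?u, ?v\<rangle> =
    \<partial> ?F \<cdot> \<langle>Idn C ?P, ?v\<rangle> \<oplus> \<epsilon> (Unlam C A B D (dapp A B D (dapp A B D f g) h))" .
  have "Unlam C A B D (dapp A B D f (g \<oplus> h)) = \<partial> ?F \<cdot> \<langle>Idn C ?P, ?u \<oplus> ?v\<rangle>"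
    using assms by (simp add: Hom_iff Unlam_dapp)
  also have "\<dots> = \<partial> ?F \<cdot> \<langle>Idn C ?P, ?u\<rangle> \<oplus> \<partial> ?F \<cdot> \<langle>Idn C ?P \<oplus> \<epsilon> ?u, ?v\<rangle>"
    using assms by (intro Diff_direction_Plus) (auto simp: Hom_iff)
  finally show "Unlam C A B D (dapp A B D f (g \<oplus> h)) = Unlam C A B D
      ((dapp A B D f g \<oplus> dapp A B D f h) \<oplus> \<epsilon> (dapp A B D (dapp A B D f g) h))"
    unfolding e using assms Unlam_dapp[of f g] Unlam_dapp[of f h]
    by (simp add: Hom_iff Plus_assoc_simp)
qed (use assms in \<open>simp_all add: Hom_iff\<close>)

lemma Ev_Inf:
  assumes "f \<in> Hom C A (B \<rightarrow> D)" "g \<in> Hom C A B"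
  shows "Ev C B D \<cdot> \<langle>\<epsilon> f, g\<rangle> = \<epsilon> (Ev C B D \<cdot> \<langle>f, g\<rangle>)"
  using assms by (simp add: Ev_eq_Unlam Hom_iff)

text \<open>Axiom (0) for the uncurried \<open>f\<close>. The increment keeps its \<epsilon> inside
  \<open>dapp\<close> because canonical forms differentiate along infinitesimal summands as a
  whole.\<close>

lemma Ev_Taylor:
  assumes "f \<in> Hom C A (B \<rightarrow> D)" "g \<in> Hom C A B" "h \<in> Hom C A B"
  shows "Ev C B D \<cdot> \<langle>f, g \<oplus> \<epsilon> h\<rangle> =
    Ev C B D \<cdot> \<langle>f, g\<rangle> \<oplus> Ev C B D \<cdot> \<langle>dapp A B D f (\<epsilon> h), g\<rangle>"
proof -
  have "Ev C B D \<cdot> \<langle>f, g \<oplus> \<epsilon> h\<rangle> = Unlam C A B D f \<cdot> (\<langle>Idn C A, g\<rangle> \<oplus> \<epsilon> \<langle>\<zero> A A, h\<rangle>)"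
    using assms by (simp add: Ev_eq_Unlam Hom_iff)
  also have "\<dots> = Unlam C A B D f \<cdot> \<langle>Idn C A, g\<rangle> \<oplus>
      \<epsilon> (\<partial> (Unlam C A B D f) \<cdot> \<langle>\<langle>Idn C A, g\<rangle>, \<langle>\<zero> A A, h\<rangle>\<rangle>)"
    using assms by (intro Taylor) (auto simp: Hom_iff)
  also have "\<epsilon> (\<partial> (Unlam C A B D f) \<cdot> \<langle>\<langle>Idn C A, g\<rangle>, \<langle>\<zero> A A, h\<rangle>\<rangle>) =
      Ev C B D \<cdot> \<langle>dapp A B D f (\<epsilon> h), g\<rangle>"
    using assms by (simp add: dapp_Inf_right Ev_Inf dapp_Hom)
      (simp add: Hom_iff Ev_eq_Unlam Unlam_dapp)
  finally show ?thesis
    using assms by (simp add: Ev_eq_Unlam Hom_iff)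
qed

end

end

section \<open>Relational objects\<close>

text \<open>A binary relation in the style of Kripke or of diffeology: \<open>plot\<close> tells,
  for each stage, which pairs of generalized elements of the two objects are related.\<close>

datatype ('o, 'm) robj = RObj (lobj: 'o) (robj: 'o) (plot: "'o \<Rightarrow> 'm \<Rightarrow> 'm \<Rightarrow> bool")

context difference_lambda_category
begin

text \<open>Closure under \<open>\<partial>\<close> is what makes a plot smooth when it is regarded
  as a map out of the diagonal object of its stage.\<close>

definition wf_robj :: "('o, 'm) robj \<Rightarrow> bool" where
  "wf_robj W \<longleftrightarrow> lobj W \<in> Obj C \<and> robj W \<in> Obj C \<and>
     (\<forall>X p p'. plot W X p p' \<longrightarrow>
        p \<in> Hom C X (lobj W) \<and> p' \<in> Hom C X (robj W) \<and>
        (\<forall>Y. \<forall>h \<in> Hom C Y X. plot W Y (p \<cdot> h) (p' \<cdot> h)) \<and>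
        plot W (X \<otimes> X) (\<partial> p) (\<partial> p') \<and> plot W X (\<epsilon> p) (\<epsilon> p') \<and>
        (\<forall>q q'. plot W X q q' \<longrightarrow> plot W X (p \<oplus> q) (p' \<oplus> q'))) \<and>
     (\<forall>X \<in> Obj C. plot W X (\<zero> X (lobj W)) (\<zero> X (robj W)))"

definition triv :: "'o \<Rightarrow> ('o, 'm) robj" where
  "triv A = RObj A A (\<lambda>X p p'. p \<in> Hom C X A \<and> p' = p)"

definition totR :: "'o \<Rightarrow> 'o \<Rightarrow> ('o, 'm) robj" where
  "totR A A' = RObj A A' (\<lambda>X p p'. p \<in> Hom C X A \<and> p' \<in> Hom C X A')"

definition prodR :: "('o, 'm) robj \<Rightarrow> ('o, 'm) robj \<Rightarrow> ('o, 'm) robj" where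
  "prodR W V = RObj (lobj W \<otimes> lobj V) (robj W \<otimes> robj V) (\<lambda>X p p'.
     p \<in> Hom C X (lobj W \<otimes> lobj V) \<and> p' \<in> Hom C X (robj W \<otimes> robj V) \<and>
     plot W X (\<pi>\<^sub>1 (lobj W) (lobj V) \<cdot> p) (\<pi>\<^sub>1 (robj W) (robj V) \<cdot> p') \<and>
     plot V X (\<pi>\<^sub>2 (lobj W) (lobj V) \<cdot> p) (\<pi>\<^sub>2 (robj W) (robj V) \<cdot> p'))"

definition pres :: "('o, 'm) robj \<Rightarrow> ('o, 'm) robj \<Rightarrow> 'm \<Rightarrow> 'm \<Rightarrow> bool" where
  "pres W V f f' \<longleftrightarrow> f \<in> Hom C (lobj W) (lobj V) \<and> f' \<in> Hom C (robj W) (robj V) \<and>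
     (\<forall>X p p'. plot W X p p' \<longrightarrow> plot V X (f \<cdot> p) (f' \<cdot> p'))"

text \<open>Counting orders makes closure properties provable by induction. The source varies in
  these inductions, since each differentiation doubles it.\<close>

primrec smoothn :: "nat \<Rightarrow> ('o, 'm) robj \<Rightarrow> ('o, 'm) robj \<Rightarrow> 'm \<Rightarrow> 'm \<Rightarrow> bool" where
  "smoothn 0 = pres"
| "smoothn (Suc n) = (\<lambda>W V f f'. pres W V f f' \<and> smoothn n (prodR W W) V (\<partial> f) (\<partial> f'))"

definition smooth :: "('o, 'm) robj \<Rightarrow> ('o, 'm) robj \<Rightarrow> 'm \<Rightarrow> 'm \<Rightarrow> bool" where
  "smooth W V f f' \<longleftrightarrow> (\<forall>n. smoothn n W V f f')"

text \<open>The stage enters as a diagonal object, so derivatives in the stage variable are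
  controlled together with those in the argument; closure of the plots under
  \<open>\<partial>\<close> rests on this.\<close>

definition expR :: "('o, 'm) robj \<Rightarrow> ('o, 'm) robj \<Rightarrow> ('o, 'm) robj" where
  "expR W V = RObj (lobj W \<rightarrow> lobj V) (robj W \<rightarrow> robj V) (\<lambda>X f f'.
     f \<in> Hom C X (lobj W \<rightarrow> lobj V) \<and> f' \<in> Hom C X (robj W \<rightarrow> robj V) \<and>
     smooth (prodR (triv X) W) V (Unlam C X (lobj W) (lobj V) f) (Unlam C X (robj W) (robj V) f'))"

section \<open>Relational objects, products, and maps smooth to a given order\<close>

lemma robj_sel [simp]:
  "lobj (triv A) = A" "robj (triv A) = A"
  "lobj (totR A A') = A" "robj (totR A A') = A'"
  "lobj (prodR W V) = lobj W \<otimes> lobj V" "robj (prodR W V) = robj W \<otimes> robj V"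
  "lobj (expR W V) = lobj W \<rightarrow> lobj V" "robj (expR W V) = robj W \<rightarrow> robj V"
  "plot (triv A) X p p' \<longleftrightarrow> p \<in> Hom C X A \<and> p' = p"
  by (simp_all add: triv_def totR_def prodR_def expR_def)

lemma wf_robj_Obj [simp]: "wf_robj W \<Longrightarrow> lobj W \<in> Obj C" "wf_robj W \<Longrightarrow> robj W \<in> Obj C"
  by (simp_all add: wf_robj_def)

lemma plot_simps:
  assumes "wf_robj W" "plot W X p p'"
  shows "X \<in> Obj C" "p \<in> Arr C" "Dom C p = X" "Cod C p = lobj W"
    "p' \<in> Arr C" "Dom C p' = X" "Cod C p' = robj W"
  using assms Hom_ObjD unfolding wf_robj_def Hom_iff by blast+

lemma plot_Comp: "wf_robj W \<Longrightarrow> plot W X p p' \<Longrightarrow> h \<in> Hom C Y X \<Longrightarrow> plot W Y (p \<cdot> h) (p' \<cdot> h)"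
  unfolding wf_robj_def by blast

lemma plot_Diff: "wf_robj W \<Longrightarrow> plot W X p p' \<Longrightarrow> plot W (X \<otimes> X) (\<partial> p) (\<partial> p')"
  unfolding wf_robj_def by blast

lemma plot_Plus:
  "wf_robj W \<Longrightarrow> plot W X p p' \<Longrightarrow> plot W X q q' \<Longrightarrow> plot W X (p \<oplus> q) (p' \<oplus> q')"
  unfolding wf_robj_def by blast

lemma plot_Inf: "wf_robj W \<Longrightarrow> plot W X p p' \<Longrightarrow> plot W X (\<epsilon> p) (\<epsilon> p')"
  unfolding wf_robj_def by blast

lemma plot_Null:
  "wf_robj W \<Longrightarrow> X \<in> Obj C \<Longrightarrow> lobj W = A \<Longrightarrow> robj W = A' \<Longrightarrow> plot W X (\<zero> X A) (\<zero> X A')"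
  unfolding wf_robj_def by blast

lemma wf_triv [simp]: "A \<in> Obj C \<Longrightarrow> wf_robj (triv A)"
  by (auto simp: wf_robj_def Hom_iff)

lemma wf_totR: "A \<in> Obj C \<Longrightarrow> A' \<in> Obj C \<Longrightarrow> wf_robj (totR A A')"
  by (auto simp: wf_robj_def totR_def Hom_iff)

lemma plot_prodR_iff:
  "plot (prodR W V) X p p' \<longleftrightarrow>
     p \<in> Hom C X (lobj W \<otimes> lobj V) \<and> p' \<in> Hom C X (robj W \<otimes> robj V) \<and>
     plot W X (\<pi>\<^sub>1 (lobj W) (lobj V) \<cdot> p) (\<pi>\<^sub>1 (robj W) (robj V) \<cdot> p') \<and>
     plot V X (\<pi>\<^sub>2 (lobj W) (lobj V) \<cdot> p) (\<pi>\<^sub>2 (robj W) (robj V) \<cdot> p')"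
  by (simp add: prodR_def)

lemma wf_prodR [simp]:
  assumes "wf_robj W" "wf_robj V"
  shows "wf_robj (prodR W V)"
  unfolding wf_robj_def
proof (intro conjI allI impI ballI)
  fix X p p'
  assume pl: "plot (prodR W V) X p p'"
  then have p: "p \<in> Arr C" "Dom C p = X" "Cod C p = lobj W \<otimes> lobj V"
      "p' \<in> Arr C" "Dom C p' = X" "Cod C p' = robj W \<otimes> robj V"
    and 1: "plot W X (\<pi>\<^sub>1 (lobj W) (lobj V) \<cdot> p) (\<pi>\<^sub>1 (robj W) (robj V) \<cdot> p')"
    and 2: "plot V X (\<pi>\<^sub>2 (lobj W) (lobj V) \<cdot> p) (\<pi>\<^sub>2 (robj W) (robj V) \<cdot> p')"
    by (simp_all add: plot_prodR_iff Hom_iff)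
  have o: "X \<in> Obj C" using p by auto
  show "p \<in> Hom C X (lobj (prodR W V))" "p' \<in> Hom C X (robj (prodR W V))"
    using p by (simp_all add: Hom_iff)
  show "plot (prodR W V) Y (p \<cdot> h) (p' \<cdot> h)" if "h \<in> Hom C Y X" for Y h
    using plot_Comp[OF assms(1) 1 that] plot_Comp[OF assms(2) 2 that] that assms p
    by (simp add: plot_prodR_iff Hom_iff)
  show "plot (prodR W V) (X \<otimes> X) (\<partial> p) (\<partial> p')"
    using plot_Diff[OF assms(1) 1] plot_Diff[OF assms(2) 2] assms p o
    by (simp add: plot_prodR_iff Hom_iff)
  show "plot (prodR W V) X (\<epsilon> p) (\<epsilon> p')"
    using plot_Inf[OF assms(1) 1] plot_Inf[OF assms(2) 2] assms p
    by (simp add: plot_prodR_iff Hom_iff)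
  show "plot (prodR W V) X (p \<oplus> q) (p' \<oplus> q')" if "plot (prodR W V) X q q'" for q q'
    using plot_Plus[OF assms(1) 1] plot_Plus[OF assms(2) 2] that assms p
    by (simp add: plot_prodR_iff Hom_iff)
qed (use assms in \<open>simp_all add: plot_prodR_iff Hom_iff plot_Null\<close>)

lemma plot_Pair:
  assumes "wf_robj W" "wf_robj V" "plot W X p p'" "plot V X q q'"
  shows "plot (prodR W V) X \<langle>p, q\<rangle> \<langle>p', q'\<rangle>"
  using assms plot_simps[OF assms(1,3)] plot_simps[OF assms(2,4)]
  by (simp add: plot_prodR_iff Hom_iff)

lemma prodR_triv:
  assumes "A \<in> Obj C" "B \<in> Obj C"
  shows "prodR (triv A) (triv B) = triv (A \<otimes> B)"
proof -
  have "plot (prodR (triv A) (triv B)) X p p' \<longleftrightarrow> plot (triv (A \<otimes> B)) X p p'" for X p p'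
  proof
    assume "plot (prodR (triv A) (triv B)) X p p'"
    then show "plot (triv (A \<otimes> B)) X p p'"
      using assms by (auto simp: plot_prodR_iff Hom_iff intro: Pair_ext[of A B])
  qed (use assms in \<open>auto simp: plot_prodR_iff Hom_iff\<close>)
  then show ?thesis
    by (intro robj.expand) (auto simp: fun_eq_iff)
qed

lemma pres_Comp:
  assumes "wf_robj W" "wf_robj V" "wf_robj U" "pres W V f f'" "pres V U g g'"
  shows "pres W U (g \<cdot> f) (g' \<cdot> f')"
proof -
  have h: "f \<in> Arr C" "Dom C f = lobj W" "Cod C f = lobj V"
    "f' \<in> Arr C" "Dom C f' = robj W" "Cod C f' = robj V"
    "g \<in> Arr C" "Dom C g = lobj V" "Cod C g = lobj U"
    "g' \<in> Arr C" "Dom C g' = robj V" "Cod C g' = robj U"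
    using assms(4,5) by (auto simp: pres_def Hom_iff)
  have "plot U X ((g \<cdot> f) \<cdot> p) ((g' \<cdot> f') \<cdot> p')" if "plot W X p p'" for X p p'
  proof -
    have "plot U X (g \<cdot> (f \<cdot> p)) (g' \<cdot> (f' \<cdot> p'))"
      using that assms(4,5) by (auto simp: pres_def)
    then show ?thesis
      using h plot_simps[OF assms(1) that] by simp
  qed
  then show ?thesis
    using h by (auto simp: pres_def Hom_iff)
qed

lemma smoothn_pres: "smoothn n W V f f' \<Longrightarrow> pres W V f f'"
  by (cases n) auto

lemma smoothn_SucD: "smoothn (Suc n) W V f f' \<Longrightarrow> smoothn n W V f f'"
proof (induction n arbitrary: W f f')
  case (Suc n)
  then show ?case by (metis smoothn.simps(2))
qed simp

lemma pres_simps: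
  assumes "pres W V f f'"
  shows "f \<in> Arr C" "Dom C f = lobj W" "Cod C f = lobj V"
    "f' \<in> Arr C" "Dom C f' = robj W" "Cod C f' = robj V"
  using assms by (auto simp: pres_def Hom_iff)

lemmas smoothn_simps = smoothn_pres[THEN pres_simps(1)] smoothn_pres[THEN pres_simps(2)]
  smoothn_pres[THEN pres_simps(3)] smoothn_pres[THEN pres_simps(4)]
  smoothn_pres[THEN pres_simps(5)] smoothn_pres[THEN pres_simps(6)]

lemma pres_Pair:
  assumes "wf_robj W" "wf_robj V" "wf_robj U" "pres W V f f'" "pres W U g g'"
  shows "pres W (prodR V U) \<langle>f, g\<rangle> \<langle>f', g'\<rangle>"
proof -
  note h = pres_simps[OF assms(4)] pres_simps[OF assms(5)]
  have "plot (prodR V U) X (\<langle>f, g\<rangle> \<cdot> p) (\<langle>f', g'\<rangle> \<cdot> p')" if "plot W X p p'" for X p p'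
  proof -
    have "plot V X (f \<cdot> p) (f' \<cdot> p')" "plot U X (g \<cdot> p) (g' \<cdot> p')"
      using that assms(4,5) by (auto simp: pres_def)
    from plot_Pair[OF assms(2,3) this] show ?thesis
      using h plot_simps[OF assms(1) that] by simp
  qed
  then show ?thesis
    using h by (auto simp: pres_def Hom_iff)
qed

lemma smoothn_Pair:
  assumes "wf_robj W" "wf_robj V" "wf_robj U" "smoothn n W V f f'" "smoothn n W U g g'"
  shows "smoothn n W (prodR V U) \<langle>f, g\<rangle> \<langle>f', g'\<rangle>"
  using assms
proof (induction n arbitrary: W f f' g g')
  case 0
  then show ?case by (simp add: pres_Pair)
next
  case (Suc n)
  have "smoothn n (prodR W W) (prodR V U) \<langle>\<partial> f, \<partial> g\<rangle> \<langle>\<partial> f', \<partial> g'\<rangle>"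
    using Suc.prems by (intro Suc.IH) auto
  then show ?case
    using Suc.prems smoothn_simps[OF Suc.prems(4)] smoothn_simps[OF Suc.prems(5)]
    by (auto intro: pres_Pair)
qed

lemma pres_Pi:
  assumes "wf_robj W" "wf_robj V"
  shows "pres (prodR W V) W (\<pi>\<^sub>1 (lobj W) (lobj V)) (\<pi>\<^sub>1 (robj W) (robj V))"
    "pres (prodR W V) V (\<pi>\<^sub>2 (lobj W) (lobj V)) (\<pi>\<^sub>2 (robj W) (robj V))"
  using assms by (auto simp: pres_def plot_prodR_iff Hom_iff)

text \<open>One simultaneous induction, because the cases need each other: the chain rule contains a
  projection, and the derivative of a projection is a composite of projections.\<close>

lemma smoothn_Comp_Pi:
  shows "\<And>W V U f f' g g'. \<lbrakk>wf_robj W; wf_robj V; wf_robj U; smoothn n W V f f'; smoothn n V U g g'\<rbrakk>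
      \<Longrightarrow> smoothn n W U (g \<cdot> f) (g' \<cdot> f')"
    and "\<And>W V. \<lbrakk>wf_robj W; wf_robj V\<rbrakk>
      \<Longrightarrow> smoothn n (prodR W V) W (\<pi>\<^sub>1 (lobj W) (lobj V)) (\<pi>\<^sub>1 (robj W) (robj V))"
    and "\<And>W V. \<lbrakk>wf_robj W; wf_robj V\<rbrakk>
      \<Longrightarrow> smoothn n (prodR W V) V (\<pi>\<^sub>2 (lobj W) (lobj V)) (\<pi>\<^sub>2 (robj W) (robj V))"
proof (induction n)
  case 0
  {
    case 1
    then show ?case by (auto intro: pres_Comp)
  next
    case 2
    then show ?case by (simp add: pres_Pi)
  next
    case 3
    then show ?case by (simp add: pres_Pi)
  }
next
  case (Suc n)
  {
    case (1 W V U f f' g g')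
    have "smoothn n (prodR W W) V (f \<cdot> \<pi>\<^sub>1 (lobj W) (lobj W)) (f' \<cdot> \<pi>\<^sub>1 (robj W) (robj W))"
      using 1 smoothn_SucD[of n W V f f'] by (intro Suc.IH(1)[of _ W] Suc.IH(2)) auto
    then have "smoothn n (prodR W W) (prodR V V) \<langle>f \<cdot> \<pi>\<^sub>1 (lobj W) (lobj W), \<partial> f\<rangle>
        \<langle>f' \<cdot> \<pi>\<^sub>1 (robj W) (robj W), \<partial> f'\<rangle>"
      using 1 by (intro smoothn_Pair) auto
    then have "smoothn n (prodR W W) U (\<partial> g \<cdot> \<langle>f \<cdot> \<pi>\<^sub>1 (lobj W) (lobj W), \<partial> f\<rangle>)
        (\<partial> g' \<cdot> \<langle>f' \<cdot> \<pi>\<^sub>1 (robj W) (robj W), \<partial> f'\<rangle>)"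
      using 1 by (intro Suc.IH(1)[of _ "prodR V V"]) auto
    then show ?case
      using 1 smoothn_simps[OF 1(4)] smoothn_simps[OF 1(5)] by (auto intro: pres_Comp)
  next
    case (2 W V)
    then have "smoothn n (prodR (prodR W V) (prodR W V)) W
        (\<pi>\<^sub>1 (lobj W) (lobj V) \<cdot> \<pi>\<^sub>2 (lobj (prodR W V)) (lobj (prodR W V)))
        (\<pi>\<^sub>1 (robj W) (robj V) \<cdot> \<pi>\<^sub>2 (robj (prodR W V)) (robj (prodR W V)))"
      by (intro Suc.IH(1)[of _ "prodR W V"] Suc.IH(2,3)) auto
    with 2 show ?case by (simp add: pres_Pi)
  next
    case (3 W V)
    then have "smoothn n (prodR (prodR W V) (prodR W V)) V
        (\<pi>\<^sub>2 (lobj W) (lobj V) \<cdot> \<pi>\<^sub>2 (lobj (prodR W V)) (lobj (prodR W V)))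
        (\<pi>\<^sub>2 (robj W) (robj V) \<cdot> \<pi>\<^sub>2 (robj (prodR W V)) (robj (prodR W V)))"
      by (intro Suc.IH(1)[of _ "prodR W V"] Suc.IH(2,3)) auto
    with 3 show ?case by (simp add: pres_Pi)
  }
qed

lemma smoothn_Comp:
  assumes "wf_robj V" "smoothn n W V f f'" "smoothn n V U g g'" "wf_robj W" "wf_robj U"
  shows "smoothn n W U (g \<cdot> f) (g' \<cdot> f')"
  using smoothn_Comp_Pi(1)[of W V U n f f' g g'] assms by simp

lemma smoothn_Pi:
  assumes "wf_robj W" "wf_robj V" "lobj W = A" "lobj V = B" "robj W = A'" "robj V = B'"
  shows "smoothn n (prodR W V) W (\<pi>\<^sub>1 A B) (\<pi>\<^sub>1 A' B')" "smoothn n (prodR W V) V (\<pi>\<^sub>2 A B) (\<pi>\<^sub>2 A' B')"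
  using smoothn_Comp_Pi(2,3)[of W V n] assms by simp_all

lemma pres_Id: "wf_robj W \<Longrightarrow> pres W W (Idn C (lobj W)) (Idn C (robj W))"
  using plot_simps[of W] by (auto simp: pres_def Hom_iff)

lemma smoothn_Id: "wf_robj W \<Longrightarrow> lobj W = A \<Longrightarrow> robj W = A' \<Longrightarrow> smoothn n W W (Idn C A) (Idn C A')"
  by (cases n) (auto simp: pres_Id intro: smoothn_Pi)

lemma smoothn_Null:
  "\<lbrakk>wf_robj W; wf_robj V; lobj W = A; lobj V = B; robj W = A'; robj V = B'\<rbrakk>
    \<Longrightarrow> smoothn n W V (\<zero> A B) (\<zero> A' B')"
proof (induction n arbitrary: W A A')
  case 0
  then show ?case
    using plot_simps[of W] by (auto simp: pres_def Hom_iff intro!: plot_Null)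
next
  case (Suc n)
  have "pres W V (\<zero> A B) (\<zero> A' B')"
    using Suc.prems plot_simps[of W] by (auto simp: pres_def Hom_iff intro!: plot_Null)
  moreover have "smoothn n (prodR W W) V (\<zero> (A \<otimes> A) B) (\<zero> (A' \<otimes> A') B')"
    using Suc.prems by (intro Suc.IH) auto
  ultimately show ?case
    using Suc.prems wf_robj_Obj[of W] wf_robj_Obj[of V] by simp
qed

lemma pres_Plus:
  assumes "wf_robj W" "wf_robj V" "pres W V f f'" "pres W V g g'"
  shows "pres W V (f \<oplus> g) (f' \<oplus> g')"
proof -
  note h = pres_simps[OF assms(3)] pres_simps[OF assms(4)]
  have "plot V X ((f \<oplus> g) \<cdot> p) ((f' \<oplus> g') \<cdot> p')" if "plot W X p p'" for X p p'
  proof -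
    have "plot V X (f \<cdot> p) (f' \<cdot> p')" "plot V X (g \<cdot> p) (g' \<cdot> p')"
      using that assms(3,4) by (auto simp: pres_def)
    from plot_Plus[OF assms(2) this] show ?thesis
      using h plot_simps[OF assms(1) that] by simp
  qed
  then show ?thesis
    using h by (auto simp: pres_def Hom_iff)
qed

lemma smoothn_Plus:
  assumes "wf_robj W" "wf_robj V" "smoothn n W V f f'" "smoothn n W V g g'"
  shows "smoothn n W V (f \<oplus> g) (f' \<oplus> g')"
  using assms
proof (induction n arbitrary: W f f' g g')
  case 0
  then show ?case by (simp add: pres_Plus)
next
  case (Suc n)
  have "smoothn n (prodR W W) V (\<partial> f \<oplus> \<partial> g) (\<partial> f' \<oplus> \<partial> g')"
    using Suc.prems by (intro Suc.IH) auto
  then show ?case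
    using Suc.prems smoothn_simps[OF Suc.prems(3)] smoothn_simps[OF Suc.prems(4)]
    by (auto intro: pres_Plus)
qed

lemma pres_Inf:
  assumes "wf_robj W" "wf_robj V" "pres W V f f'"
  shows "pres W V (\<epsilon> f) (\<epsilon> f')"
proof -
  note h = pres_simps[OF assms(3)]
  have "plot V X (\<epsilon> f \<cdot> p) (\<epsilon> f' \<cdot> p')" if "plot W X p p'" for X p p'
  proof -
    have "plot V X (f \<cdot> p) (f' \<cdot> p')"
      using that assms(3) by (auto simp: pres_def)
    from plot_Inf[OF assms(2) this] show ?thesis
      using h plot_simps[OF assms(1) that] by simp
  qed
  then show ?thesis
    using h by (auto simp: pres_def Hom_iff)
qed

lemma smoothn_Inf:
  assumes "wf_robj W" "wf_robj V" "smoothn n W V f f'"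
  shows "smoothn n W V (\<epsilon> f) (\<epsilon> f')"
  using assms
proof (induction n arbitrary: W f f')
  case 0
  then show ?case by (simp add: pres_Inf)
next
  case (Suc n)
  have "smoothn n (prodR W W) V (\<epsilon> (\<partial> f)) (\<epsilon> (\<partial> f'))"
    using Suc.prems by (intro Suc.IH) auto
  then show ?case
    using Suc.prems smoothn_simps[OF Suc.prems(3)] by (auto intro: pres_Inf)
qed

text \<open>The derivative of a plot is a plot at the squared stage, and the square of a diagonal
  object is diagonal, so the induction hypothesis applies to it.\<close>

lemma smoothn_plot:
  assumes "wf_robj W" "plot W X p p'"
  shows "smoothn n (triv X) W p p'"
  using assms(2)
proof (induction n arbitrary: X p p')
  case (0 X p p')
  then show ?case
    using plot_simps[OF assms(1) 0] plot_Comp[OF assms(1) 0] by (auto simp: pres_def Hom_iff)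
next
  case (Suc n X p p')
  have "pres (triv X) W p p'"
    using plot_simps[OF assms(1) Suc.prems] plot_Comp[OF assms(1) Suc.prems]
    by (auto simp: pres_def Hom_iff)
  then show ?case
    using plot_simps[OF assms(1) Suc.prems] Suc.IH[OF plot_Diff[OF assms(1) Suc.prems]]
    by (simp add: prodR_triv)
qed

lemma smooth_pres: "smooth W V f f' \<Longrightarrow> pres W V f f'"
  by (metis smooth_def smoothn_pres)

lemmas smooth_simps = smooth_pres[THEN pres_simps(1)] smooth_pres[THEN pres_simps(2)]
  smooth_pres[THEN pres_simps(3)] smooth_pres[THEN pres_simps(4)]
  smooth_pres[THEN pres_simps(5)] smooth_pres[THEN pres_simps(6)]

lemma smooth_Diff: "smooth W V f f' \<Longrightarrow> smooth (prodR W W) V (\<partial> f) (\<partial> f')"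
  unfolding smooth_def by (metis smoothn.simps(2))

lemma smooth_Pair:
  "\<lbrakk>smooth W V f f'; smooth W U g g'; wf_robj W; wf_robj V; wf_robj U\<rbrakk>
    \<Longrightarrow> smooth W (prodR V U) \<langle>f, g\<rangle> \<langle>f', g'\<rangle>"
  by (simp add: smooth_def smoothn_Pair)

lemma smooth_Comp:
  "\<lbrakk>wf_robj V; smooth W V f f'; smooth V U g g'; wf_robj W; wf_robj U\<rbrakk>
    \<Longrightarrow> smooth W U (g \<cdot> f) (g' \<cdot> f')"
  unfolding smooth_def using smoothn_Comp by blast

lemma smooth_Pi1:
  "\<lbrakk>wf_robj W; wf_robj V; lobj W = A; lobj V = B; robj W = A'; robj V = B'\<rbrakk>
    \<Longrightarrow> smooth (prodR W V) W (\<pi>\<^sub>1 A B) (\<pi>\<^sub>1 A' B')"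
  by (simp add: smooth_def smoothn_Pi)

lemma smooth_Pi2:
  "\<lbrakk>wf_robj W; wf_robj V; lobj W = A; lobj V = B; robj W = A'; robj V = B'\<rbrakk>
    \<Longrightarrow> smooth (prodR W V) V (\<pi>\<^sub>2 A B) (\<pi>\<^sub>2 A' B')"
  by (simp add: smooth_def smoothn_Pi)

lemma smooth_Id:
  "wf_robj W \<Longrightarrow> lobj W = A \<Longrightarrow> robj W = A' \<Longrightarrow> smooth W W (Idn C A) (Idn C A')"
  by (simp add: smooth_def smoothn_Id)

lemma smooth_Null:
  "\<lbrakk>wf_robj W; wf_robj V; lobj W = A; lobj V = B; robj W = A'; robj V = B'\<rbrakk>
    \<Longrightarrow> smooth W V (\<zero> A B) (\<zero> A' B')"
  by (simp add: smooth_def smoothn_Null)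

lemma smooth_Plus:
  "\<lbrakk>smooth W V f f'; smooth W V g g'; wf_robj W; wf_robj V\<rbrakk> \<Longrightarrow> smooth W V (f \<oplus> g) (f' \<oplus> g')"
  by (simp add: smooth_def smoothn_Plus)

lemma smooth_Inf: "\<lbrakk>smooth W V f f'; wf_robj W; wf_robj V\<rbrakk> \<Longrightarrow> smooth W V (\<epsilon> f) (\<epsilon> f')"
  by (simp add: smooth_def smoothn_Inf)

lemma smooth_plot: "wf_robj W \<Longrightarrow> plot W X p p' \<Longrightarrow> smooth (triv X) W p p'"
  by (simp add: smooth_def smoothn_plot)

lemma smooth_triv: "f \<in> Hom C A B \<Longrightarrow> smooth (triv A) (triv B) f f"
  using Hom_ObjD[of f A B] by (intro smooth_plot) auto

text \<open>A Yoneda argument: the identity is related to itself, so its images under the two arrows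
  coincide.\<close>

lemma smooth_triv_iff: "smooth (triv A) (triv B) f f' \<longleftrightarrow> f \<in> Hom C A B \<and> f' = f"
proof
  assume s: "smooth (triv A) (triv B) f f'"
  note h = smooth_simps[OF s]
  have "plot (triv A) A (Idn C A) (Idn C A)"
    using h Dom_Obj[of f] Id_Hom[of A] by simp
  then have "plot (triv B) A (f \<cdot> Idn C A) (f' \<cdot> Idn C A)"
    using smooth_pres[OF s] unfolding pres_def by blast
  then show "f \<in> Hom C A B \<and> f' = f"
    using h Dom_Obj[of f] by (simp add: Hom_iff)
qed (auto intro: smooth_triv)

lemma smooth_Pair_first:
  assumes "smooth W V x x'" "wf_robj W" "wf_robj V" "wf_robj U"
    "lobj W = A" "lobj U = B" "robj W = A'" "robj U = B'"
  shows "smooth (prodR W U) (prodR V U) \<langle>x \<cdot> \<pi>\<^sub>1 A B, \<pi>\<^sub>2 A B\<rangle> \<langle>x' \<cdot> \<pi>\<^sub>1 A' B', \<pi>\<^sub>2 A' B'\<rangle>"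
  using assms by (intro smooth_Pair smooth_Comp[of W] smooth_Pi1 smooth_Pi2) auto

subsection \<open>Exponentials\<close>

lemma plot_expR_iff:
  "plot (expR W V) X f f' \<longleftrightarrow>
     f \<in> Hom C X (lobj W \<rightarrow> lobj V) \<and> f' \<in> Hom C X (robj W \<rightarrow> robj V) \<and>
     smooth (prodR (triv X) W) V (Unlam C X (lobj W) (lobj V) f) (Unlam C X (robj W) (robj V) f')"
  by (simp add: expR_def)

text \<open>In elements, ((x, u), b) goes to ((x, b), (u, 0)): the argument of the function is held
  fixed. This is the map occurring in \<open>Diff_Lam\<close>, written with projections.\<close>

definition lam_dir :: "'o \<Rightarrow> 'o \<Rightarrow> 'm" where
  "lam_dir A B = \<langle>\<langle>\<pi>\<^sub>1 A A \<cdot> \<pi>\<^sub>1 (A \<otimes> A) B, \<pi>\<^sub>2 (A \<otimes> A) B\<rangle>, \<langle>\<pi>\<^sub>2 A A \<cdot> \<pi>\<^sub>1 (A \<otimes> A) B, \<zero> ((A \<otimes> A) \<otimes> B) B\<rangle>\<rangle>"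

lemma Diff_Lam_eq:
  assumes "A \<in> Obj C" "B \<in> Obj C" "f \<in> Arr C" "Dom C f = A \<otimes> B"
  shows "\<partial> (\<Lambda> A B f) = \<Lambda> (A \<otimes> A) B (\<partial> f \<cdot> lam_dir A B)"
  using Diff_Lam[of A B f "Cod C f"] assms by (simp add: Hom_iff ProdMap_def lam_dir_def)

lemma Unlam_Diff:
  assumes "B \<in> Obj C" "D \<in> Obj C" "f \<in> Arr C" "Dom C f = A" "Cod C f = B \<rightarrow> D"
  shows "Unlam C (A \<otimes> A) B D (\<partial> f) = \<partial> (Unlam C A B D f) \<cdot> lam_dir A B"
proof -
  have [simp]: "A \<in> Obj C" using assms by auto
  have "\<partial> f = \<partial> (\<Lambda> A B (Unlam C A B D f))" using assms by simp
  also have "\<dots> = \<Lambda> (A \<otimes> A) B (\<partial> (Unlam C A B D f) \<cdot> lam_dir A B)"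
    using assms by (intro Diff_Lam_eq) auto
  finally show ?thesis using assms by (simp add: lam_dir_def)
qed

lemma smooth_lam_dir:
  assumes "wf_robj W" "wf_robj V" "lobj W = A" "lobj V = B" "robj W = A'" "robj V = B'"
  shows "smooth (prodR (prodR W W) V) (prodR (prodR W V) (prodR W V)) (lam_dir A B) (lam_dir A' B')"
  unfolding lam_dir_def using assms
  by (intro smooth_Pair smooth_Comp[of "prodR W W"] smooth_Pi1 smooth_Pi2 smooth_Null) auto

text \<open>Every closure condition is transported along uncurrying: reindexing becomes composition
  with a pairing, and differentiation becomes \<open>\<partial>\<close> followed by reindexing along
  \<open>lam_dir\<close>.\<close>

lemma wf_expR [simp]:
  assumes W: "wf_robj W" and V: "wf_robj V"
  shows "wf_robj (expR W V)"
  unfolding wf_robj_def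
proof (intro conjI allI impI ballI)
  fix X f f'
  assume pl: "plot (expR W V) X f f'"
  then have f: "f \<in> Arr C" "Dom C f = X" "Cod C f = lobj W \<rightarrow> lobj V"
      "f' \<in> Arr C" "Dom C f' = X" "Cod C f' = robj W \<rightarrow> robj V"
    and s: "smooth (prodR (triv X) W) V (Unlam C X (lobj W) (lobj V) f) (Unlam C X (robj W) (robj V) f')"
    by (simp_all add: plot_expR_iff Hom_iff)
  have o: "X \<in> Obj C" using f by auto
  show "f \<in> Hom C X (lobj (expR W V))" "f' \<in> Hom C X (robj (expR W V))"
    using f by (simp_all add: Hom_iff)
  show "plot (expR W V) Y (f \<cdot> h) (f' \<cdot> h)" if h: "h \<in> Hom C Y X" for Y h
  proof -
    have "smooth (prodR (triv Y) W) V
        (Unlam C X (lobj W) (lobj V) f \<cdot> \<langle>h \<cdot> \<pi>\<^sub>1 Y (lobj W), \<pi>\<^sub>2 Y (lobj W)\<rangle>)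
        (Unlam C X (robj W) (robj V) f' \<cdot> \<langle>h \<cdot> \<pi>\<^sub>1 Y (robj W), \<pi>\<^sub>2 Y (robj W)\<rangle>)"
      using W V o h Hom_ObjD[OF h]
      by (intro smooth_Comp[OF _ _ s] smooth_Pair_first smooth_triv) auto
    then show ?thesis
      using f h W V by (simp add: plot_expR_iff Hom_iff Unlam_Comp)
  qed
  show "plot (expR W V) (X \<otimes> X) (\<partial> f) (\<partial> f')"
  proof -
    have "smooth (prodR (prodR (triv X) (triv X)) W) V
        (\<partial> (Unlam C X (lobj W) (lobj V) f) \<cdot> lam_dir X (lobj W))
        (\<partial> (Unlam C X (robj W) (robj V) f') \<cdot> lam_dir X (robj W))"
      using W V o by (intro smooth_Comp[OF _ _ smooth_Diff[OF s]] smooth_lam_dir) auto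
    then show ?thesis
      using f W V o by (simp add: plot_expR_iff Hom_iff Unlam_Diff prodR_triv)
  qed
  show "plot (expR W V) X (\<epsilon> f) (\<epsilon> f')"
    using smooth_Inf[OF s] f W V o by (simp add: plot_expR_iff Hom_iff)
  show "plot (expR W V) X (f \<oplus> g) (f' \<oplus> g')" if "plot (expR W V) X g g'" for g g'
    using smooth_Plus[OF s] that f W V o by (simp add: plot_expR_iff Hom_iff)
qed (use assms in \<open>simp_all add: plot_expR_iff Hom_iff smooth_Null\<close>)

text \<open>The hypothesis asks for all orders although the conclusion concerns order
  \<open>n\<close>: membership in the plots of \<open>expR\<close> already involves all orders.
  Differentiating a currying gives the currying of a smooth arrow.\<close>

lemma smoothn_Lam:
  assumes "smooth (prodR W V) U f f'" "wf_robj W" "wf_robj V" "wf_robj U"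
    "lobj W = A" "lobj V = B" "robj W = A'" "robj V = B'"
  shows "smoothn n W (expR V U) (\<Lambda> A B f) (\<Lambda> A' B' f')"
  using assms
proof (induction n arbitrary: W f f' A A')
  have pres: "pres W (expR V U) (\<Lambda> A B f) (\<Lambda> A' B' f')"
    if s: "smooth (prodR W V) U f f'" and wf: "wf_robj W" "wf_robj V" "wf_robj U"
      and sel: "lobj W = A" "lobj V = B" "robj W = A'" "robj V = B'" for W f f' A A'
    unfolding pres_def
  proof (intro conjI allI impI)
    note h = smooth_simps[OF s] wf_robj_Obj[OF wf(1)] wf_robj_Obj[OF wf(2)] wf_robj_Obj[OF wf(3)] sel
    show "\<Lambda> A B f \<in> Hom C (lobj W) (lobj (expR V U))" "\<Lambda> A' B' f' \<in> Hom C (robj W) (robj (expR V U))"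
      using h by (simp_all add: Hom_iff)
    show "plot (expR V U) X (\<Lambda> A B f \<cdot> p) (\<Lambda> A' B' f' \<cdot> p')" if p: "plot W X p p'" for X p p'
    proof -
      note ps = plot_simps[OF wf(1) p]
      have "smooth (prodR (triv X) V) U (f \<cdot> \<langle>p \<cdot> \<pi>\<^sub>1 X B, \<pi>\<^sub>2 X B\<rangle>) (f' \<cdot> \<langle>p' \<cdot> \<pi>\<^sub>1 X B', \<pi>\<^sub>2 X B'\<rangle>)"
        using wf sel ps by (intro smooth_Comp[OF _ _ s] smooth_Pair_first smooth_plot[OF wf(1) p]) auto
      then show ?thesis
        using h ps by (simp add: plot_expR_iff Hom_iff Unlam_Comp)
    qed
  qed
  {
    case 0
    then show ?case by (simp add: pres)
  next
    case (Suc n)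
    have "smooth (prodR (prodR W W) V) U (\<partial> f \<cdot> lam_dir A B) (\<partial> f' \<cdot> lam_dir A' B')"
      using Suc.prems by (intro smooth_Comp[OF _ _ smooth_Diff[OF Suc.prems(1)]] smooth_lam_dir) auto
    then have "smoothn n (prodR W W) (expR V U) (\<Lambda> (A \<otimes> A) B (\<partial> f \<cdot> lam_dir A B))
        (\<Lambda> (A' \<otimes> A') B' (\<partial> f' \<cdot> lam_dir A' B'))"
      using Suc.prems by (intro Suc.IH) auto
    then show ?case
      using Suc.prems smooth_simps[OF Suc.prems(1)] wf_robj_Obj[OF Suc.prems(2)]
        wf_robj_Obj[OF Suc.prems(3)] pres[OF Suc.prems]
      by (simp add: Diff_Lam_eq)
  }
qed

lemma smooth_Lam:
  "\<lbrakk>smooth (prodR W V) U f f'; wf_robj W; wf_robj V; wf_robj U; lobj W = A; lobj V = B; robj W = A';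
    robj V = B'\<rbrakk> \<Longrightarrow> smooth W (expR V U) (\<Lambda> A B f) (\<Lambda> A' B' f')"
  using smoothn_Lam by (auto simp: smooth_def)

text \<open>The derivative of evaluation is evaluation combined with the linear operator \<open>diff_op\<close>, which
  is why smoothness of all evaluations at one order entails smoothness at the next.\<close>

definition ev_diff :: "'o \<Rightarrow> 'o \<Rightarrow> 'm" where
  "ev_diff A B = \<partial> (Ev C A B) \<cdot>
    \<langle>\<langle>\<pi>\<^sub>1 (A \<rightarrow> B) (A \<otimes> A), \<pi>\<^sub>1 A A \<cdot> \<pi>\<^sub>2 (A \<rightarrow> B) (A \<otimes> A)\<rangle>,
     \<langle>\<zero> ((A \<rightarrow> B) \<otimes> (A \<otimes> A)) (A \<rightarrow> B), \<pi>\<^sub>2 A A \<cdot> \<pi>\<^sub>2 (A \<rightarrow> B) (A \<otimes> A)\<rangle>\<rangle>"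

text \<open>The curried differential operator: a function f goes to the map sending (a, b) to the
  derivative of f at a along b.\<close>

definition diff_op :: "'o \<Rightarrow> 'o \<Rightarrow> 'm" where
  "diff_op A B = \<Lambda> (A \<rightarrow> B) (A \<otimes> A) (ev_diff A B)"

lemma ev_diff_simps [simp]:
  assumes "A \<in> Obj C" "B \<in> Obj C"
  shows "ev_diff A B \<in> Arr C" "Dom C (ev_diff A B) = (A \<rightarrow> B) \<otimes> (A \<otimes> A)" "Cod C (ev_diff A B) = B"
  using assms by (simp_all add: ev_diff_def)

lemma diff_op_simps [simp]:
  assumes "A \<in> Obj C" "B \<in> Obj C"
  shows "diff_op A B \<in> Arr C" "Dom C (diff_op A B) = A \<rightarrow> B" "Cod C (diff_op A B) = (A \<otimes> A) \<rightarrow> B"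
  using assms by (simp_all add: diff_op_def)

lemma ev_diff_Pair:
  assumes "A \<in> Obj C" "B \<in> Obj C" "f \<in> Arr C" "c \<in> Arr C" "Dom C f = X" "Dom C c = X"
    "Cod C f = A \<rightarrow> B" "Cod C c = A \<otimes> A"
  shows "ev_diff A B \<cdot> \<langle>f, c\<rangle> =
    \<partial> (Ev C A B) \<cdot> \<langle>\<langle>f, \<pi>\<^sub>1 A A \<cdot> c\<rangle>, \<langle>\<zero> X (A \<rightarrow> B), \<pi>\<^sub>2 A A \<cdot> c\<rangle>\<rangle>"
  using assms by (auto simp: ev_diff_def)

text \<open>Differentiating in the function means differentiating evaluation a second time. Axiom
  (7) exchanges the two directions, after which linearity of evaluation replaces \<open>f\<close> by
  its increment \<open>h\<close>.\<close>

lemma Diff_diff_op: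
  assumes o: "A \<in> Obj C" "B \<in> Obj C"
  shows "\<partial> (diff_op A B) = diff_op A B \<cdot> \<pi>\<^sub>2 (A \<rightarrow> B) (A \<rightarrow> B)"
proof -
  let ?E = "A \<rightarrow> B"
  let ?X = "(?E \<otimes> ?E) \<otimes> (A \<otimes> A)"
  let ?e = "\<pi>\<^sub>1 (?E \<otimes> ?E) (A \<otimes> A)" and ?c = "\<pi>\<^sub>2 (?E \<otimes> ?E) (A \<otimes> A)"
  let ?f = "\<pi>\<^sub>1 ?E ?E \<cdot> ?e" and ?h = "\<pi>\<^sub>2 ?E ?E \<cdot> ?e" and ?a = "\<pi>\<^sub>1 A A \<cdot> ?c" and ?b = "\<pi>\<^sub>2 A A \<cdot> ?c"
  let ?Z = "\<zero> ?X (?E \<otimes> A)"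
  have "\<partial> (ev_diff A B) \<cdot> lam_dir ?E (A \<otimes> A) =
    \<partial> (\<partial> (Ev C A B)) \<cdot> \<langle>\<langle>\<langle>?f, ?a\<rangle>, \<langle>\<zero> ?X ?E, ?b\<rangle>\<rangle>, \<langle>\<langle>?h, \<zero> ?X A\<rangle>, ?Z\<rangle>\<rangle>"
    using o by (simp add: ev_diff_def lam_dir_def Null_Prod)
  also have "\<dots> = \<partial> (\<partial> (Ev C A B)) \<cdot> \<langle>\<langle>\<langle>?f, ?a\<rangle>, \<langle>?h, \<zero> ?X A\<rangle>\<rangle>, \<langle>\<langle>\<zero> ?X ?E, ?b\<rangle>, ?Z\<rangle>\<rangle>"
    using o by (intro Diff_Diff_swap) auto
  also have "\<dots> = \<partial> (Ev C A B) \<cdot> \<langle>\<langle>?h, ?a\<rangle>, \<langle>\<zero> ?X ?E, ?b\<rangle>\<rangle>"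
    using o by (intro Diff_Diff_Ev) auto
  also have "\<dots> = ev_diff A B \<cdot> \<langle>?h, ?c\<rangle>"
    using o by (simp add: ev_diff_Pair)
  finally show ?thesis
    using o unfolding diff_op_def by (simp add: Diff_Lam_eq Lam_Comp)
qed

lemma pres_diff_op:
  assumes V: "wf_robj V" and U: "wf_robj U"
  shows "pres (expR V U) (expR (prodR V V) U) (diff_op (lobj V) (lobj U)) (diff_op (robj V) (robj U))"
  unfolding pres_def
proof (intro conjI allI impI)
  fix X f f'
  assume pl: "plot (expR V U) X f f'"
  then have f: "f \<in> Arr C" "Dom C f = X" "Cod C f = lobj V \<rightarrow> lobj U"
      "f' \<in> Arr C" "Dom C f' = X" "Cod C f' = robj V \<rightarrow> robj U"
    and s: "smooth (prodR (triv X) V) U (Unlam C X (lobj V) (lobj U) f) (Unlam C X (robj V) (robj U) f')"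
    by (simp_all add: plot_expR_iff Hom_iff)
  have o: "X \<in> Obj C" using f by auto
  \<comment> \<open>\<open>j A\<close> sends (x, (a, b)) to ((x, a), (0, b)): the uncurried operator
    differentiates the uncurried \<open>f\<close> with the stage variable fixed.\<close>
  define j where "j A = \<langle>\<langle>\<pi>\<^sub>1 X (A \<otimes> A), \<pi>\<^sub>1 A A \<cdot> \<pi>\<^sub>2 X (A \<otimes> A)\<rangle>,
    \<langle>\<zero> (X \<otimes> (A \<otimes> A)) X, \<pi>\<^sub>2 A A \<cdot> \<pi>\<^sub>2 X (A \<otimes> A)\<rangle>\<rangle>" for A
  have j: "smooth (prodR (triv X) (prodR V V)) (prodR (prodR (triv X) V) (prodR (triv X) V))
      (j (lobj V)) (j (robj V))"
    unfolding j_def using V o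
    by (intro smooth_Pair smooth_Comp[of "prodR V V"] smooth_Pi1 smooth_Pi2 smooth_Null) auto
  have "smooth (prodR (triv X) (prodR V V)) U
      (\<partial> (Unlam C X (lobj V) (lobj U) f) \<cdot> j (lobj V)) (\<partial> (Unlam C X (robj V) (robj U) f') \<cdot> j (robj V))"
    using V U o by (intro smooth_Comp[OF _ j smooth_Diff[OF s]]) auto
  moreover have "Unlam C X (A \<otimes> A) B (diff_op A B \<cdot> g) = \<partial> (Unlam C X A B g) \<cdot> j A"
    if "A \<in> Obj C" "B \<in> Obj C" "g \<in> Arr C" "Dom C g = X" "Cod C g = A \<rightarrow> B" for A B g
    using that o unfolding j_def diff_op_def
    by (simp add: Diff_Unlam_Pair Unlam_Comp ev_diff_Pair)
  ultimately show "plot (expR (prodR V V) U) X (diff_op (lobj V) (lobj U) \<cdot> f) (diff_op (robj V) (robj U) \<cdot> f')"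
    using V U f by (simp add: plot_expR_iff Hom_iff)
qed (use V U in \<open>simp_all add: Hom_iff\<close>)

text \<open>Linearity closes the induction: the derivative is the operator itself after a
  projection, so order \<open>n\<close> yields order \<open>n + 1\<close>.\<close>

lemma smoothn_diff_op:
  assumes V: "wf_robj V" and U: "wf_robj U"
  shows "smoothn n (expR V U) (expR (prodR V V) U)
    (diff_op (lobj V) (lobj U)) (diff_op (robj V) (robj U))"
proof (induction n)
  case 0
  then show ?case using assms by (simp add: pres_diff_op)
next
  case (Suc n)
  have "smoothn n (prodR (expR V U) (expR V U)) (expR (prodR V V) U)
    (diff_op (lobj V) (lobj U) \<cdot> \<pi>\<^sub>2 (lobj (expR V U)) (lobj (expR V U)))
    (diff_op (robj V) (robj U) \<cdot> \<pi>\<^sub>2 (robj (expR V U)) (robj (expR V U)))"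
    using V U by (intro smoothn_Comp[OF _ _ Suc.IH] smoothn_Pi) auto
  then show ?case
    using assms by (simp add: pres_diff_op Diff_diff_op)
qed

text \<open>\<open>p\<close> carries a function and its argument, \<open>q\<close> their increments.
  The summand of \<open>Diff_Ev\<close> that moves the argument is rewritten as evaluation of
  \<open>diff_op\<close>, so no \<open>\<partial>\<close> remains on the right.\<close>

lemma Diff_Ev_eq:
  assumes o: "A \<in> Obj C" "B \<in> Obj C"
  defines "E \<equiv> A \<rightarrow> B"
  defines "p \<equiv> \<pi>\<^sub>1 (E \<otimes> A) (E \<otimes> A)" and "q \<equiv> \<pi>\<^sub>2 (E \<otimes> A) (E \<otimes> A)"
  shows "\<partial> (Ev C A B) = Ev C A B \<cdot> \<langle>\<pi>\<^sub>1 E A \<cdot> q, \<pi>\<^sub>2 E A \<cdot> p\<rangle> \<oplus>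
    Ev C (A \<otimes> A) B \<cdot> \<langle>diff_op A B \<cdot> (\<pi>\<^sub>1 E A \<cdot> p \<oplus> \<epsilon> (\<pi>\<^sub>1 E A \<cdot> q)), \<langle>\<pi>\<^sub>2 E A \<cdot> p, \<pi>\<^sub>2 E A \<cdot> q\<rangle>\<rangle>"
proof -
  let ?P = "(E \<otimes> A) \<otimes> (E \<otimes> A)"
  have [simp]: "E \<in> Obj C" "p \<in> Arr C" "Dom C p = ?P" "Cod C p = E \<otimes> A"
      "q \<in> Arr C" "Dom C q = ?P" "Cod C q = E \<otimes> A"
    using o by (simp_all add: E_def p_def q_def)
  have "\<langle>\<langle>\<pi>\<^sub>1 E A \<cdot> p, \<pi>\<^sub>2 E A \<cdot> p\<rangle>, \<langle>\<pi>\<^sub>1 E A \<cdot> q, \<pi>\<^sub>2 E A \<cdot> q\<rangle>\<rangle> = Idn C ?P"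
    using o by (simp add: Pair_Pi_simp) (simp add: p_def q_def)
  then have "\<partial> (Ev C A B) = \<partial> (Ev C A B) \<cdot> \<langle>\<langle>\<pi>\<^sub>1 E A \<cdot> p, \<pi>\<^sub>2 E A \<cdot> p\<rangle>, \<langle>\<pi>\<^sub>1 E A \<cdot> q, \<pi>\<^sub>2 E A \<cdot> q\<rangle>\<rangle>"
    using o by (simp add: E_def)
  also have "\<dots> = Ev C A B \<cdot> \<langle>\<pi>\<^sub>1 E A \<cdot> q, \<pi>\<^sub>2 E A \<cdot> p\<rangle> \<oplus>
      \<partial> (Ev C A B) \<cdot> \<langle>\<langle>\<pi>\<^sub>1 E A \<cdot> p \<oplus> \<epsilon> (\<pi>\<^sub>1 E A \<cdot> q), \<pi>\<^sub>2 E A \<cdot> p\<rangle>, \<langle>\<zero> ?P (A \<rightarrow> B), \<pi>\<^sub>2 E A \<cdot> q\<rangle>\<rangle>"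
    using o by (intro Diff_Ev) (auto simp: E_def[symmetric])
  also have "\<partial> (Ev C A B) \<cdot> \<langle>\<langle>\<pi>\<^sub>1 E A \<cdot> p \<oplus> \<epsilon> (\<pi>\<^sub>1 E A \<cdot> q), \<pi>\<^sub>2 E A \<cdot> p\<rangle>, \<langle>\<zero> ?P (A \<rightarrow> B), \<pi>\<^sub>2 E A \<cdot> q\<rangle>\<rangle> =
      Ev C (A \<otimes> A) B \<cdot> \<langle>diff_op A B \<cdot> (\<pi>\<^sub>1 E A \<cdot> p \<oplus> \<epsilon> (\<pi>\<^sub>1 E A \<cdot> q)), \<langle>\<pi>\<^sub>2 E A \<cdot> p, \<pi>\<^sub>2 E A \<cdot> q\<rangle>\<rangle>"
    using o unfolding diff_op_def by (simp add: ev_diff_Pair E_def[symmetric])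
  finally show ?thesis .
qed

lemma pres_Ev:
  assumes V: "wf_robj V" and U: "wf_robj U"
  shows "pres (prodR (expR V U) V) U (Ev C (lobj V) (lobj U)) (Ev C (robj V) (robj U))"
  unfolding pres_def
proof (intro conjI allI impI)
  fix X p p'
  assume pl: "plot (prodR (expR V U) V) X p p'"
  note ps = plot_simps[OF _ pl]
  define f f' a a' where "f = \<pi>\<^sub>1 (lobj V \<rightarrow> lobj U) (lobj V) \<cdot> p" "f' = \<pi>\<^sub>1 (robj V \<rightarrow> robj U) (robj V) \<cdot> p'"
    "a = \<pi>\<^sub>2 (lobj V \<rightarrow> lobj U) (lobj V) \<cdot> p" "a' = \<pi>\<^sub>2 (robj V \<rightarrow> robj U) (robj V) \<cdot> p'"
  have p: "p = \<langle>f, a\<rangle>" "p' = \<langle>f', a'\<rangle>"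
    unfolding f_f'_a_a'_def using V U ps by (simp_all add: Pair_Pi_simp)
  have f: "plot (expR V U) X f f'" and a: "plot V X a a'"
    using pl unfolding f_f'_a_a'_def by (simp_all add: plot_prodR_iff)
  have X: "X \<in> Obj C" using plot_simps[OF V a] by simp
  have s: "smooth (prodR (triv X) V) U (Unlam C X (lobj V) (lobj U) f) (Unlam C X (robj V) (robj U) f')"
    using f by (simp add: plot_expR_iff)
  \<comment> \<open>Applying an uncurried function at its own stage means feeding it the identity as
    stage component.\<close>
  have "plot (prodR (triv X) V) X \<langle>Idn C X, a\<rangle> \<langle>Idn C X, a'\<rangle>"
    using V X a by (intro plot_Pair) (auto simp: Hom_iff)
  then have "plot U X (Unlam C X (lobj V) (lobj U) f \<cdot> \<langle>Idn C X, a\<rangle>) (Unlam C X (robj V) (robj U) f' \<cdot> \<langle>Idn C X, a'\<rangle>)"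
    using smooth_pres[OF s] by (simp add: pres_def)
  then show "plot U X (Ev C (lobj V) (lobj U) \<cdot> p) (Ev C (robj V) (robj U) \<cdot> p')"
    using V U X f plot_simps[OF V a] by (simp add: p Unlam_Pair plot_expR_iff Hom_iff)
qed (use V U in \<open>simp_all add: Hom_iff\<close>)

text \<open>The induction ranges over all \<open>V\<close>, because \<open>Diff_Ev_eq\<close>
  expresses the derivative through evaluation at \<open>V\<close> and at its square.\<close>

lemma smoothn_Ev:
  assumes "wf_robj V" and U: "wf_robj U"
  shows "smoothn n (prodR (expR V U) V) U (Ev C (lobj V) (lobj U)) (Ev C (robj V) (robj U))"
  using assms(1)
proof (induction n arbitrary: V)
  case 0
  then show ?case using U by (simp add: pres_Ev)
next
  case (Suc n)
  let ?E = "expR V U"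
  let ?W = "prodR (prodR ?E V) (prodR ?E V)"
  define p q p' q' where "p = \<pi>\<^sub>1 (lobj (prodR ?E V)) (lobj (prodR ?E V))"
    "q = \<pi>\<^sub>2 (lobj (prodR ?E V)) (lobj (prodR ?E V))"
    "p' = \<pi>\<^sub>1 (robj (prodR ?E V)) (robj (prodR ?E V))"
    "q' = \<pi>\<^sub>2 (robj (prodR ?E V)) (robj (prodR ?E V))"
  have pq: "smoothn n ?W (prodR ?E V) p p'" "smoothn n ?W (prodR ?E V) q q'"
    unfolding p_q_p'_q'_def using Suc.prems U by (intro smoothn_Pi; simp)+
  have Pi: "smoothn n ?W ?E (\<pi>\<^sub>1 (lobj ?E) (lobj V) \<cdot> r) (\<pi>\<^sub>1 (robj ?E) (robj V) \<cdot> r')"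
    "smoothn n ?W V (\<pi>\<^sub>2 (lobj ?E) (lobj V) \<cdot> r) (\<pi>\<^sub>2 (robj ?E) (robj V) \<cdot> r')"
    if "smoothn n ?W (prodR ?E V) r r'" for r r'
    using Suc.prems U by (intro smoothn_Comp[OF _ that] smoothn_Pi; simp)+
  note Pis = Pi[OF pq(1)] Pi[OF pq(2)]
  have 1: "smoothn n ?W U
      (Ev C (lobj V) (lobj U) \<cdot> \<langle>\<pi>\<^sub>1 (lobj ?E) (lobj V) \<cdot> q, \<pi>\<^sub>2 (lobj ?E) (lobj V) \<cdot> p\<rangle>)
      (Ev C (robj V) (robj U) \<cdot> \<langle>\<pi>\<^sub>1 (robj ?E) (robj V) \<cdot> q', \<pi>\<^sub>2 (robj ?E) (robj V) \<cdot> p'\<rangle>)"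
    using Suc.prems U by (intro smoothn_Comp[OF _ _ Suc.IH] smoothn_Pair Pis; simp)
  have 2: "smoothn n ?W U
      (Ev C (lobj (prodR V V)) (lobj U) \<cdot>
        \<langle>diff_op (lobj V) (lobj U) \<cdot> (\<pi>\<^sub>1 (lobj ?E) (lobj V) \<cdot> p \<oplus> \<epsilon> (\<pi>\<^sub>1 (lobj ?E) (lobj V) \<cdot> q)),
         \<langle>\<pi>\<^sub>2 (lobj ?E) (lobj V) \<cdot> p, \<pi>\<^sub>2 (lobj ?E) (lobj V) \<cdot> q\<rangle>\<rangle>)
      (Ev C (robj (prodR V V)) (robj U) \<cdot>
        \<langle>diff_op (robj V) (robj U) \<cdot> (\<pi>\<^sub>1 (robj ?E) (robj V) \<cdot> p' \<oplus> \<epsilon> (\<pi>\<^sub>1 (robj ?E) (robj V) \<cdot> q')),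
         \<langle>\<pi>\<^sub>2 (robj ?E) (robj V) \<cdot> p', \<pi>\<^sub>2 (robj ?E) (robj V) \<cdot> q'\<rangle>\<rangle>)"
    using Suc.prems U
    by (intro smoothn_Comp[OF _ _ Suc.IH] smoothn_Pair smoothn_Comp[OF _ _ smoothn_diff_op]
        smoothn_Plus smoothn_Inf Pis; simp)
  have "smoothn n ?W U (\<partial> (Ev C (lobj V) (lobj U))) (\<partial> (Ev C (robj V) (robj U)))"
    using smoothn_Plus[OF _ _ 1 2] Suc.prems U unfolding p_q_p'_q'_def
    by (simp add: Diff_Ev_eq)
  then show ?case using Suc.prems U by (simp add: pres_Ev)
qed

lemma smooth_Ev:
  "\<lbrakk>smooth W (expR V U) f f'; smooth W V g g'; wf_robj W; wf_robj V; wf_robj U;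
    lobj V = A; lobj U = B; robj V = A'; robj U = B'\<rbrakk>
    \<Longrightarrow> smooth W U (Ev C A B \<cdot> \<langle>f, g\<rangle>) (Ev C A' B' \<cdot> \<langle>f', g'\<rangle>)"
  using smoothn_Ev[of V U]
  by (intro smooth_Comp[of "prodR (expR V U) V"] smooth_Pair) (auto simp: smooth_def)

lemma smooth_Unlam:
  assumes s: "smooth W (expR V U) f f'" and wf: "wf_robj W" "wf_robj V" "wf_robj U"
    and "lobj W = A" "lobj V = B" "lobj U = D" "robj W = A'" "robj V = B'" "robj U = D'"
  shows "smooth (prodR W V) U (Unlam C A B D f) (Unlam C A' B' D' f')"
proof -
  have "smooth (prodR W V) U (Ev C B D \<cdot> \<langle>f \<cdot> \<pi>\<^sub>1 A B, \<pi>\<^sub>2 A B\<rangle>) (Ev C B' D' \<cdot> \<langle>f' \<cdot> \<pi>\<^sub>1 A' B', \<pi>\<^sub>2 A' B'\<rangle>)"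
    using assms by (intro smooth_Ev[of _ V] smooth_Comp[OF _ _ s] smooth_Pi1 smooth_Pi2) auto
  then show ?thesis
    using assms smooth_simps[OF s] wf_robj_Obj[OF wf(2)] wf_robj_Obj[OF wf(3)] by (simp add: Unlam_eq)
qed

lemma smooth_dapp:
  assumes "smooth W (expR V U) f f'" "smooth W V g g'" "wf_robj W" "wf_robj V" "wf_robj U"
    "lobj W = A" "lobj V = B" "lobj U = D" "robj W = A'" "robj V = B'" "robj U = D'"
  shows "smooth W (expR V U) (dapp A B D f g) (dapp A' B' D' f' g')"
  unfolding dapp_def
proof (rule smooth_Lam[OF smooth_Comp[OF _ _ smooth_Diff[OF smooth_Unlam[OF assms(1)]]]])
  show "smooth (prodR W V) (prodR (prodR W V) (prodR W V))
      \<langle>Idn C (A \<otimes> B), \<langle>\<zero> (A \<otimes> B) A, g \<cdot> \<pi>\<^sub>1 A B\<rangle>\<rangle> \<langle>Idn C (A' \<otimes> B'), \<langle>\<zero> (A' \<otimes> B') A', g' \<cdot> \<pi>\<^sub>1 A' B'\<rangle>\<rangle>"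
    using assms by (intro smooth_Pair smooth_Comp[OF _ _ assms(2)] smooth_Id smooth_Null smooth_Pi1) auto
qed (use assms in auto)

text \<open>Between diagonal objects smoothness is equality, and uncurrying is injective.\<close>

lemma expR_triv:
  assumes "A \<in> Obj C" "B \<in> Obj C"
  shows "expR (triv A) (triv B) = triv (A \<rightarrow> B)"
proof -
  have "plot (expR (triv A) (triv B)) X f f' \<longleftrightarrow> plot (triv (A \<rightarrow> B)) X f f'" for X f f'
  proof
    assume p: "plot (expR (triv A) (triv B)) X f f'"
    then have "X \<in> Obj C" by (auto simp: plot_expR_iff Hom_iff)
    with p show "plot (triv (A \<rightarrow> B)) X f f'"
      using assms
      by (auto simp: plot_expR_iff prodR_triv smooth_triv_iff Hom_iff intro: Unlam_inject[of A B])
  next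
    assume "plot (triv (A \<rightarrow> B)) X f f'"
    then show "plot (expR (triv A) (triv B)) X f f'"
      using assms by (auto simp: plot_expR_iff prodR_triv smooth_triv_iff Hom_iff)
  qed
  then show ?thesis
    by (intro robj.expand) (auto simp: fun_eq_iff)
qed

subsection \<open>Types and contexts\<close>

text \<open>Two unrelated derivations of one term may disagree on the types of its subterms. The relation
  between the interpretations of two types is therefore defined for arbitrary pairs of types: it
  is the total relation where they differ in shape, and equality on the diagonal.\<close>

primrec tyR :: "('b \<Rightarrow> 'o) \<Rightarrow> 'b ty \<Rightarrow> 'b ty \<Rightarrow> ('o, 'm) robj" where
  "tyR I (Base b) = (\<lambda>\<tau>'. if \<tau>' = Base b then triv (I b) else totR (I b) (ty_obj C I \<tau>'))"
| "tyR I (\<sigma> \<Rrightarrow> \<tau>) = (\<lambda>\<rho>. case \<rho> of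
     Base b \<Rightarrow> totR (ty_obj C I (\<sigma> \<Rrightarrow> \<tau>)) (I b)
   | \<sigma>' \<Rrightarrow> \<tau>' \<Rightarrow> expR (tyR I \<sigma> \<sigma>') (tyR I \<tau> \<tau>'))"

text \<open>Contexts are compared at equal length only; the last equation provides the base case of
  two empty contexts.\<close>

fun ctxR :: "('b \<Rightarrow> 'o) \<Rightarrow> 'b ctx \<Rightarrow> 'b ctx \<Rightarrow> ('o, 'm) robj" where
  "ctxR I (\<tau> # \<Gamma>) (\<tau>' # \<Gamma>') = prodR (ctxR I \<Gamma> \<Gamma>') (tyR I \<tau> \<tau>')"
| "ctxR I _ _ = triv (One C)"

context
  fixes I :: "'b \<Rightarrow> 'o"
  assumes I: "\<And>b. I b \<in> Obj C"
begin

lemma wf_tyR: "wf_robj (tyR I \<tau> \<tau>')"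
  and tyR_sel [simp]: "lobj (tyR I \<tau> \<tau>') = ty_obj C I \<tau>" "robj (tyR I \<tau> \<tau>') = ty_obj C I \<tau>'"
proof -
  have "wf_robj (tyR I \<tau> \<tau>') \<and> lobj (tyR I \<tau> \<tau>') = ty_obj C I \<tau> \<and> robj (tyR I \<tau> \<tau>') = ty_obj C I \<tau>'"
  proof (induction \<tau> arbitrary: \<tau>')
    case (Base b)
    then show ?case by (auto intro: wf_totR wf_triv I ty_obj_Obj)
  next
    case (Fun \<sigma> \<tau>)
    then show ?case
      by (cases \<tau>') (auto intro!: wf_totR wf_expR I ty_obj_Obj Exp_Obj)
  qed
  then show "wf_robj (tyR I \<tau> \<tau>')" "lobj (tyR I \<tau> \<tau>') = ty_obj C I \<tau>"
    "robj (tyR I \<tau> \<tau>') = ty_obj C I \<tau>'" by auto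
qed

lemma tyR_diag: "tyR I \<tau> \<tau> = triv (ty_obj C I \<tau>)"
  by (induction \<tau>) (simp_all add: expR_triv ty_obj_Obj I)

lemma ctxR_sel [simp]:
  "length \<Gamma> = length \<Gamma>' \<Longrightarrow> lobj (ctxR I \<Gamma> \<Gamma>') = ctx_obj C I \<Gamma>"
  "length \<Gamma> = length \<Gamma>' \<Longrightarrow> robj (ctxR I \<Gamma> \<Gamma>') = ctx_obj C I \<Gamma>'"
  by (induction \<Gamma> \<Gamma>' rule: list_induct2) simp_all

lemma wf_ctxR: "length \<Gamma> = length \<Gamma>' \<Longrightarrow> wf_robj (ctxR I \<Gamma> \<Gamma>')"
  by (induction \<Gamma> \<Gamma>' rule: list_induct2) (simp_all add: wf_tyR)

lemma ctxR_diag: "ctxR I \<Gamma> \<Gamma> = triv (ctx_obj C I \<Gamma>)"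
  by (induction \<Gamma>) (simp_all add: tyR_diag prodR_triv ctx_obj_Obj ty_obj_Obj I)

lemma smooth_var_arr:
  assumes "length \<Gamma> = length \<Gamma>'" "k < length \<Gamma>"
  shows "smooth (ctxR I \<Gamma> \<Gamma>') (tyR I (\<Gamma> ! k) (\<Gamma>' ! k)) (var_arr C I \<Gamma> k) (var_arr C I \<Gamma>' k)"
  using assms
proof (induction \<Gamma> \<Gamma>' arbitrary: k rule: list_induct2)
  case (Cons \<tau> \<Gamma> \<tau>' \<Gamma>')
  show ?case
  proof (cases k)
    case 0
    then show ?thesis using Cons by (simp add: smooth_Pi2 wf_ctxR wf_tyR)
  next
    case (Suc j)
    then show ?thesis
      using Cons by (auto intro!: smooth_Comp[of "ctxR I \<Gamma> \<Gamma>'"] smooth_Pi1 simp: wf_ctxR wf_tyR)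
  qed
qed simp

end

end

section \<open>Canonical forms of untyped terms\<close>

text \<open>An abstract interface: sums and zero are left to multisets, so only these laws have to
  be checked for atoms. \<open>app\<close> takes a multiset since application is nonlinear in its
  argument. \<open>small\<close> must hold of every \<open>eps s\<close>; it may also hold of other
  atoms.\<close>

locale difference_atoms =
  fixes var :: "nat \<Rightarrow> 'a"
    and lam :: "'a \<Rightarrow> 'a"
    and eps :: "'a \<Rightarrow> 'a"
    and dif :: "'a \<Rightarrow> 'a \<Rightarrow> 'a"
    and app :: "'a \<Rightarrow> 'a multiset \<Rightarrow> 'a"
    and small :: "'a \<Rightarrow> bool"
  assumes dif_swap: "dif (dif s t) u = dif (dif s u) t"
    and dif_eps_left: "dif (eps s) t = eps (dif s t)"
    and dif_eps_right: "dif s (eps t) = eps (dif s t)"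
    and eps_eps_dif_dif: "eps (eps (dif (dif s t) u)) = eps (dif (dif s t) u)"
    and lam_eps: "lam (eps s) = eps (lam s)"
    and app_eps: "app (eps s) M = eps (app s M)"
    and small_eps: "small (eps s)"
begin

abbreviation epsM :: "'a multiset \<Rightarrow> 'a multiset" where
  "epsM \<equiv> image_mset eps"

abbreviation difM :: "'a multiset \<Rightarrow> 'a \<Rightarrow> 'a multiset" where
  "difM R x \<equiv> image_mset (\<lambda>r. dif r x) R"

text \<open>\<open>dd s T\<close> expands \<open>D(s) \<cdot> \<Sum>T\<close> by the rule
  \<open>D(s) \<cdot> (x + t) \<sim> D(s) \<cdot> x + D(s) \<cdot> t + \<epsilon>(D(D(s) \<cdot> t) \<cdot> x)\<close>, and \<open>app1 s T\<close> applies \<open>s\<close> to \<open>\<Sum>T\<close> after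
  moving the infinitesimal summands of \<open>T\<close> into a derivative of \<open>s\<close>.\<close>

definition dif_step :: "'a \<Rightarrow> 'a \<Rightarrow> 'a multiset \<Rightarrow> 'a multiset" where
  "dif_step s x R = add_mset (dif s x) (R + epsM (difM R x))"

definition dd :: "'a \<Rightarrow> 'a multiset \<Rightarrow> 'a multiset" where
  "dd s T = fold_mset (dif_step s) {#} T"

definition ddM :: "'a multiset \<Rightarrow> 'a multiset \<Rightarrow> 'a multiset" where
  "ddM S T = (\<Sum>s\<in>#S. dd s T)"

definition app1 :: "'a \<Rightarrow> 'a multiset \<Rightarrow> 'a multiset" where
  "app1 s T = (let T0 = filter_mset (\<lambda>x. \<not> small x) T
     in add_mset (app s T0) (image_mset (\<lambda>r. app r T0) (dd s (filter_mset small T))))"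

definition appM :: "'a multiset \<Rightarrow> 'a multiset \<Rightarrow> 'a multiset" where
  "appM S T = (\<Sum>s\<in>#S. app1 s T)"

primrec can :: "trm \<Rightarrow> 'a multiset" where
  "can (TVar k) = {#var k#}"
| "can (TLam t) = image_mset lam (can t)"
| "can (TApp s t) = appM (can s) (can t)"
| "can (TDiff s t) = ddM (can s) (can t)"
| "can (TEps t) = epsM (can t)"
| "can (TPlus s t) = can s + can t"
| "can TZero = {#}"

section \<open>Algebra of the multiset expansions\<close>

lemma dd_empty [simp]: "dd s {#} = {#}"
  by (simp add: dd_def)

text \<open>The fold is well defined because the order in which summands are processed does not
  matter: the double correction terms are symmetric by \<open>dif_swap\<close>.\<close>

lemma dd_add [simp]: "dd s (add_mset x T) = add_mset (dif s x) (dd s T + epsM (difM (dd s T) x))"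
proof -
  have "dif_step s y (dif_step s x R) = dif_step s x (dif_step s y R)" for x y R
    by (simp add: dif_step_def image_mset.compositionality o_def dif_eps_left dif_swap[of s x y]
        dif_swap[of _ x y])
  then interpret comp_fun_commute "dif_step s"
    by unfold_locales auto
  show ?thesis
    by (simp add: dd_def dif_step_def)
qed

lemma ddM_simps [simp]:
  "ddM {#} T = {#}" "ddM (add_mset s S) T = dd s T + ddM S T" "ddM (S + S') T = ddM S T + ddM S' T"
  by (simp_all add: ddM_def)

lemma appM_simps [simp]:
  "appM {#} T = {#}" "appM (add_mset s S) T = app1 s T + appM S T" "appM (S + S') T = appM S T + appM S' T"
  by (simp_all add: appM_def)

lemma difM_eps: "difM R (eps x) = epsM (difM R x)"
  by (simp add: image_mset.compositionality o_def dif_eps_right)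

lemma difM_epsM: "difM (epsM R) x = epsM (difM R x)"
  by (simp add: image_mset.compositionality o_def dif_eps_left)

lemma dd_eps_left: "dd (eps s) T = epsM (dd s T)"
  by (induction T) (simp_all add: image_mset.compositionality o_def dif_eps_left)

lemma ddM_eps_left: "ddM (epsM S) T = epsM (ddM S T)"
  by (induction S) (simp_all add: dd_eps_left)

lemma dd_dif: "dd (dif s x) T = difM (dd s T) x"
  by (induction T) (simp_all add: image_mset.compositionality o_def dif_eps_left dif_swap[of _ _ x])

lemma ddM_difM: "ddM (difM S x) T = difM (ddM S T) x"
  by (induction S) (simp_all add: dd_dif)

lemma ddM_empty_right [simp]: "ddM S {#} = {#}"
  by (induction S) simp_all

lemma ddM_add_right: "ddM S (add_mset x T) = difM S x + ddM S T + epsM (difM (ddM S T) x)"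
  by (induction S) simp_all

text \<open>\<open>dif_swap\<close> for sums: adding a summand to \<open>T\<close> changes both
  sides by the same recursion, since \<open>difM\<close> by a fixed atom commutes with
  \<open>ddM\<close>.\<close>

lemma ddM_dd_swap: "ddM (dd s T) U = ddM (dd s U) T"
  by (induction T)
    (simp_all add: ddM_add_right ddM_eps_left ddM_difM dd_dif)

lemma ddM_swap: "ddM (ddM S T) U = ddM (ddM S U) T"
  by (induction S) (simp_all add: ddM_dd_swap)

lemma dd_union: "dd s (T + U) = dd s T + dd s U + epsM (ddM (dd s T) U)"
  by (induction T) (simp_all add: ddM_eps_left ddM_difM dd_dif difM_epsM)

lemma ddM_union_right: "ddM S (T + U) = ddM S T + ddM S U + epsM (ddM (ddM S T) U)"
  by (induction S) (simp_all add: dd_union)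

text \<open>Lifts \<open>eps_eps_dif_dif\<close> to a sum in one direction; the next two lemmas
  extend this to the other direction and to the function.\<close>

lemma eps_eps_difM_dd: "epsM (epsM (difM (dd s T) y)) = epsM (difM (dd s T) y)"
proof (induction T)
  case (add x T)
  \<comment> \<open>Correction terms of \<open>dd\<close> bring an \<open>eps\<close> of their own,
    so the law is also needed one level further down.\<close>
  have "eps (eps (eps (dif (dif r x) y))) = eps (eps (dif (dif r x) y))" for r
    by (simp only: eps_eps_dif_dif)
  then have "epsM (epsM (epsM (difM (difM (dd s T) x) y))) = epsM (epsM (difM (difM (dd s T) x) y))"
    by (simp add: image_mset.compositionality o_def)
  moreover have "difM (epsM (difM R x)) y = epsM (difM (difM R x) y)" for R
    by (simp add: image_mset.compositionality o_def dif_eps_left)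
  ultimately show ?case
    using add.IH by (simp add: eps_eps_dif_dif)
qed simp

lemma eps_eps_ddM_dd: "epsM (epsM (ddM (dd s T) U)) = epsM (ddM (dd s T) U)"
proof (induction U)
  case (add x U)
  have "epsM (epsM (epsM (difM (ddM (dd s T) U) x))) = epsM (epsM (difM (ddM (dd s T) U) x))"
    unfolding ddM_difM[symmetric] ddM_eps_left[symmetric] eps_eps_difM_dd ..
  then show ?case
    using add.IH by (simp add: ddM_add_right eps_eps_difM_dd)
qed simp

lemma eps_eps_ddM: "epsM (epsM (ddM (ddM S T) U)) = epsM (ddM (ddM S T) U)"
  by (induction S) (simp_all add: eps_eps_ddM_dd)

text \<open>The correction term picks up an \<open>eps\<close> from each of its two directions,
  three in all, where the right side has two. Here \<open>eps_eps_dif_dif\<close> becomes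
  indispensable.\<close>

lemma dd_eps_right: "dd s (epsM T) = epsM (dd s T)"
proof (induction T)
  case (add x T)
  have "dd s (epsM (add_mset x T)) =
      add_mset (dif s (eps x)) (dd s (epsM T) + epsM (difM (dd s (epsM T)) (eps x)))"
    by simp
  also have "\<dots> = add_mset (eps (dif s x)) (epsM (dd s T) + epsM (epsM (difM (dd s T) x)))"
    by (simp only: add.IH difM_eps difM_epsM eps_eps_difM_dd dif_eps_right[of s x])
  finally show ?case by simp
qed simp

lemma ddM_eps_right: "ddM S (epsM T) = epsM (ddM S T)"
  by (induction S) (simp_all add: dd_eps_right)

lemma app1_eps_left: "app1 (eps s) T = epsM (app1 s T)"
  by (simp add: app1_def Let_def dd_eps_left app_eps image_mset.compositionality o_def)

lemma appM_eps_left: "appM (epsM S) T = epsM (appM S T)"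
  by (induction S) (simp_all add: app1_eps_left)

lemma appM_eq:
  "appM S T = image_mset (\<lambda>r. app r (filter_mset (\<lambda>x. \<not> small x) T)) (S + ddM S (filter_mset small T))"
  by (induction S) (simp_all add: app1_def Let_def)

lemma filter_small_epsM [simp]:
  "filter_mset small (epsM T) = epsM T" "filter_mset (\<lambda>x. \<not> small x) (epsM T) = {#}"
  by (induction T) (simp_all add: small_eps)

text \<open>Adding \<open>epsM U\<close> leaves the non-small part of the argument alone and
  enlarges the small part, so the claim reduces to \<open>ddM_union_right\<close>. The cross term
  has one \<open>eps\<close> too many, which \<open>eps_eps_ddM\<close> removes.\<close>

lemma appM_Taylor: "appM S (T + epsM U) = appM S T + epsM (appM (ddM S U) T)"
proof -
  let ?T = "filter_mset small T" and ?N = "filter_mset (\<lambda>x. \<not> small x) T"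
  have "ddM S (?T + epsM U) = ddM S ?T + epsM (ddM S U) + epsM (ddM (ddM S U) ?T)"
    by (simp add: ddM_union_right ddM_eps_right eps_eps_ddM ddM_swap[of S ?T U])
  moreover have "epsM (image_mset (\<lambda>r. app r ?N) R) = image_mset (\<lambda>r. app r ?N) (epsM R)" for R
    by (simp add: image_mset.compositionality o_def app_eps)
  ultimately show ?thesis
    by (simp add: appM_eq)
qed

lemma can_diff_equiv: "s \<sim>\<^sub>\<epsilon> t \<Longrightarrow> can s = can t"
proof (induction rule: diff_equiv.induct)
  case (Lam_Eps t)
  show ?case by (simp add: image_mset.compositionality o_def lam_eps)
qed (simp_all add: ddM_eps_left ddM_union_right ddM_eps_right ddM_swap eps_eps_ddM appM_eps_left
    appM_Taylor)

lemma dd_closed: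
  assumes eps: "\<And>s. Q s \<Longrightarrow> Q (eps s)" and dif: "\<And>s t. Q s \<Longrightarrow> Q t \<Longrightarrow> Q (dif s t)"
    and "Q s" "\<forall>x\<in>#T. Q x"
  shows "\<forall>x\<in>#dd s T. Q x"
  using assms(4) by (induction T) (auto intro: eps dif assms(3))

text \<open>An induction principle for the atoms that occur in canonical forms. It serves for
  properties that fail for arbitrary atoms, namely correct flags and coherence.\<close>

lemma can_closed:
  assumes var: "\<And>k. Q (var k)" and lam: "\<And>s. Q s \<Longrightarrow> Q (lam s)" and eps: "\<And>s. Q s \<Longrightarrow> Q (eps s)"
    and dif: "\<And>s t. Q s \<Longrightarrow> Q t \<Longrightarrow> Q (dif s t)"
    and app: "\<And>s M. Q s \<Longrightarrow> \<forall>x\<in>#M. Q x \<Longrightarrow> Q (app s M)"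
  shows "\<forall>x\<in>#can t. Q x"
proof -
  have ddM: "\<forall>x\<in>#ddM S T. Q x" if "\<forall>x\<in>#S. Q x" "\<forall>x\<in>#T. Q x" for S T
    using that(1)
  proof (induction S)
    case (add s S)
    then have "\<forall>x\<in>#dd s T. Q x"
      using that(2) by (intro dd_closed[where Q = Q] eps dif) simp_all
    with add show ?case by auto
  qed simp
  show ?thesis
  proof (induction t)
    case (TApp s t)
    let ?N = "filter_mset (\<lambda>x. \<not> small x) (can t)" and ?R = "can s + ddM (can s) (filter_mset small (can t))"
    have P: "\<forall>x\<in>#filter_mset small (can t). Q x" and N: "\<forall>x\<in>#?N. Q x"
      using TApp.IH(2) by simp_all
    have R: "\<forall>r\<in>#?R. Q r"
      using TApp.IH(1) ddM[OF TApp.IH(1) P] by (simp add: ball_Un)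
    have "Q (app r ?N)" if "r \<in># ?R" for r
      using app[OF bspec[OF R that] N] .
    then show ?case by (simp add: appM_eq ball_Un)
  next
    case (TDiff s t)
    then show ?case unfolding can.simps by (rule ddM)
  qed (auto intro: var lam eps)
qed

end

section \<open>Atoms as multivalued arrows\<close>

text \<open>An atom collects the values of a summand of a canonical form under all of its typings.\<close>

type_synonym ('b, 'm) atom = "bool \<times> ('b ctx \<times> 'b ty \<times> 'm) set"

context difference_lambda_category
begin

context
  fixes I :: "'b \<Rightarrow> 'o"
  assumes I: "\<And>b. I b \<in> Obj C"
begin

text \<open>The laws of atoms must hold for arbitrary sets of triples, so well-typedness is tested
  wherever values are combined.\<close>

definition wt :: "'b ctx \<Rightarrow> 'b ty \<Rightarrow> 'm \<Rightarrow> bool" where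
  "wt \<Gamma> \<tau> f \<longleftrightarrow> f \<in> Hom C (ctx_obj C I \<Gamma>) (ty_obj C I \<tau>)"

text \<open>One value is chosen from each occurrence of an atom, all at the same context and type,
  and the choices are added.\<close>

inductive val :: "('b, 'm) atom multiset \<Rightarrow> 'b ctx \<Rightarrow> 'b ty \<Rightarrow> 'm \<Rightarrow> bool" where
  val_empty: "val {#} \<Gamma> \<tau> (\<zero> (ctx_obj C I \<Gamma>) (ty_obj C I \<tau>))"
| val_add: "val M \<Gamma> \<tau> g \<Longrightarrow> (\<Gamma>, \<tau>, f) \<in> snd a \<Longrightarrow> wt \<Gamma> \<tau> f \<Longrightarrow> val (add_mset a M) \<Gamma> \<tau> (g \<oplus> f)"

definition varA :: "nat \<Rightarrow> ('b, 'm) atom" where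
  "varA k = (False, {(\<Gamma>, \<Gamma> ! k, var_arr C I \<Gamma> k) | \<Gamma>. k < length \<Gamma>})"

definition lamA :: "('b, 'm) atom \<Rightarrow> ('b, 'm) atom" where
  "lamA a = (fst a, {(\<Gamma>, \<tau> \<Rrightarrow> \<sigma>, \<Lambda> (ctx_obj C I \<Gamma>) (ty_obj C I \<tau>) f) | \<Gamma> \<tau> \<sigma> f.
     (\<tau> # \<Gamma>, \<sigma>, f) \<in> snd a \<and> wt (\<tau> # \<Gamma>) \<sigma> f})"

definition epsA :: "('b, 'm) atom \<Rightarrow> ('b, 'm) atom" where
  "epsA a = (True, {(\<Gamma>, \<tau>, \<epsilon> f) | \<Gamma> \<tau> f. (\<Gamma>, \<tau>, f) \<in> snd a \<and> wt \<Gamma> \<tau> f})"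

definition difA :: "('b, 'm) atom \<Rightarrow> ('b, 'm) atom \<Rightarrow> ('b, 'm) atom" where
  "difA a b = (fst a \<or> fst b,
     {(\<Gamma>, \<tau> \<Rrightarrow> \<sigma>, dapp (ctx_obj C I \<Gamma>) (ty_obj C I \<tau>) (ty_obj C I \<sigma>) f g) | \<Gamma> \<tau> \<sigma> f g.
       (\<Gamma>, \<tau> \<Rrightarrow> \<sigma>, f) \<in> snd a \<and> wt \<Gamma> (\<tau> \<Rrightarrow> \<sigma>) f \<and> (\<Gamma>, \<tau>, g) \<in> snd b \<and> wt \<Gamma> \<tau> g})"

text \<open>The argument type \<open>\<tau>\<close> disappears from the resulting triple. Values
  from different typings of the argument thus land at one context and type, which is why coherence
  must relate distinct types.\<close>

definition appA :: "('b, 'm) atom \<Rightarrow> ('b, 'm) atom multiset \<Rightarrow> ('b, 'm) atom" where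
  "appA a M = (fst a,
     {(\<Gamma>, \<sigma>, Ev C (ty_obj C I \<tau>) (ty_obj C I \<sigma>) \<cdot> \<langle>f, g\<rangle>) | \<Gamma> \<tau> \<sigma> f g.
       (\<Gamma>, \<tau> \<Rrightarrow> \<sigma>, f) \<in> snd a \<and> wt \<Gamma> (\<tau> \<Rrightarrow> \<sigma>) f \<and> val M \<Gamma> \<tau> g})"

section \<open>The laws of the concrete atoms\<close>

lemma obj [simp]: "ctx_obj C I \<Gamma> \<in> Obj C" "ty_obj C I \<tau> \<in> Obj C"
  using I by (simp_all add: ctx_obj_Obj ty_obj_Obj)

lemma wt_simps [simp]:
  "wt \<Gamma> \<tau> (\<zero> (ctx_obj C I \<Gamma>) (ty_obj C I \<tau>))"
  "wt \<Gamma> \<tau> f \<Longrightarrow> wt \<Gamma> \<tau> g \<Longrightarrow> wt \<Gamma> \<tau> (f \<oplus> g)"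
  "wt \<Gamma> \<tau> f \<Longrightarrow> wt \<Gamma> \<tau> (\<epsilon> f)"
  "wt (\<tau> # \<Gamma>) \<sigma> f \<Longrightarrow> wt \<Gamma> (\<tau> \<Rrightarrow> \<sigma>) (\<Lambda> (ctx_obj C I \<Gamma>) (ty_obj C I \<tau>) f)"
  "wt \<Gamma> (\<tau> \<Rrightarrow> \<sigma>) f \<Longrightarrow> wt \<Gamma> \<tau> g \<Longrightarrow>
     wt \<Gamma> (\<tau> \<Rrightarrow> \<sigma>) (dapp (ctx_obj C I \<Gamma>) (ty_obj C I \<tau>) (ty_obj C I \<sigma>) f g)"
  "wt \<Gamma> (\<tau> \<Rrightarrow> \<sigma>) f \<Longrightarrow> wt \<Gamma> \<tau> g \<Longrightarrow> wt \<Gamma> \<sigma> (Ev C (ty_obj C I \<tau>) (ty_obj C I \<sigma>) \<cdot> \<langle>f, g\<rangle>)"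
  by (simp_all add: wt_def Hom_iff)

lemma val_wt: "val M \<Gamma> \<tau> f \<Longrightarrow> wt \<Gamma> \<tau> f"
  by (induction rule: val.induct) simp_all

lemma mem_lamA_iff: "(\<Gamma>, \<rho>, h) \<in> snd (lamA a) \<longleftrightarrow> (\<exists>\<tau> \<sigma> f. \<rho> = \<tau> \<Rrightarrow> \<sigma> \<and>
    h = \<Lambda> (ctx_obj C I \<Gamma>) (ty_obj C I \<tau>) f \<and> (\<tau> # \<Gamma>, \<sigma>, f) \<in> snd a \<and> wt (\<tau> # \<Gamma>) \<sigma> f)"
  by (auto simp: lamA_def)

lemma mem_epsA_iff: "(\<Gamma>, \<tau>, h) \<in> snd (epsA a) \<longleftrightarrow> (\<exists>f. h = \<epsilon> f \<and> (\<Gamma>, \<tau>, f) \<in> snd a \<and> wt \<Gamma> \<tau> f)"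
  by (auto simp: epsA_def)

lemma mem_difA_iff: "(\<Gamma>, \<rho>, h) \<in> snd (difA a b) \<longleftrightarrow> (\<exists>\<tau> \<sigma> f g. \<rho> = \<tau> \<Rrightarrow> \<sigma> \<and>
    h = dapp (ctx_obj C I \<Gamma>) (ty_obj C I \<tau>) (ty_obj C I \<sigma>) f g \<and>
    (\<Gamma>, \<tau> \<Rrightarrow> \<sigma>, f) \<in> snd a \<and> wt \<Gamma> (\<tau> \<Rrightarrow> \<sigma>) f \<and> (\<Gamma>, \<tau>, g) \<in> snd b \<and> wt \<Gamma> \<tau> g)"
  by (auto simp: difA_def)

lemma mem_appA_iff: "(\<Gamma>, \<sigma>, h) \<in> snd (appA a M) \<longleftrightarrow> (\<exists>\<tau> f g.
    h = Ev C (ty_obj C I \<tau>) (ty_obj C I \<sigma>) \<cdot> \<langle>f, g\<rangle> \<and>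
    (\<Gamma>, \<tau> \<Rrightarrow> \<sigma>, f) \<in> snd a \<and> wt \<Gamma> (\<tau> \<Rrightarrow> \<sigma>) f \<and> val M \<Gamma> \<tau> g)"
  by (auto simp: appA_def)

lemma lamAI:
  "\<lbrakk>(\<tau> # \<Gamma>, \<sigma>, f) \<in> snd a; wt (\<tau> # \<Gamma>) \<sigma> f; h = \<Lambda> (ctx_obj C I \<Gamma>) (ty_obj C I \<tau>) f\<rbrakk>
    \<Longrightarrow> (\<Gamma>, \<tau> \<Rrightarrow> \<sigma>, h) \<in> snd (lamA a)"
  unfolding mem_lamA_iff by blast

lemma epsAI: "\<lbrakk>(\<Gamma>, \<tau>, f) \<in> snd a; wt \<Gamma> \<tau> f; h = \<epsilon> f\<rbrakk> \<Longrightarrow> (\<Gamma>, \<tau>, h) \<in> snd (epsA a)"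
  unfolding mem_epsA_iff by blast

lemma difAI:
  "\<lbrakk>(\<Gamma>, \<tau> \<Rrightarrow> \<sigma>, f) \<in> snd a; wt \<Gamma> (\<tau> \<Rrightarrow> \<sigma>) f; (\<Gamma>, \<tau>, g) \<in> snd b; wt \<Gamma> \<tau> g;
    h = dapp (ctx_obj C I \<Gamma>) (ty_obj C I \<tau>) (ty_obj C I \<sigma>) f g\<rbrakk> \<Longrightarrow> (\<Gamma>, \<tau> \<Rrightarrow> \<sigma>, h) \<in> snd (difA a b)"
  unfolding mem_difA_iff by blast

lemma appAI:
  "\<lbrakk>(\<Gamma>, \<tau> \<Rrightarrow> \<sigma>, f) \<in> snd a; wt \<Gamma> (\<tau> \<Rrightarrow> \<sigma>) f; val M \<Gamma> \<tau> g;
    h = Ev C (ty_obj C I \<tau>) (ty_obj C I \<sigma>) \<cdot> \<langle>f, g\<rangle>\<rbrakk> \<Longrightarrow> (\<Gamma>, \<sigma>, h) \<in> snd (appA a M)"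
  unfolding mem_appA_iff by blast

lemma fst_atom [simp]:
  "fst (varA k) = False" "fst (lamA a) = fst a" "fst (epsA a) = True"
  "fst (difA a b) = (fst a \<or> fst b)" "fst (appA a M) = fst a"
  by (simp_all add: varA_def lamA_def epsA_def difA_def appA_def)

lemma dapp_laws:
  assumes "wt \<Gamma> (\<tau> \<Rrightarrow> \<sigma>) f" "wt \<Gamma> \<tau> g" "wt \<Gamma> \<tau> h"
  defines "d \<equiv> dapp (ctx_obj C I \<Gamma>) (ty_obj C I \<tau>) (ty_obj C I \<sigma>)"
  shows "d (d f g) h = d (d f h) g" "d (\<epsilon> f) g = \<epsilon> (d f g)" "d f (\<epsilon> g) = \<epsilon> (d f g)"
    "\<epsilon> (\<epsilon> (d (d f g) h)) = \<epsilon> (d (d f g) h)"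
    "d f (g \<oplus> h) = (d f g \<oplus> d f h) \<oplus> \<epsilon> (d (d f g) h)"
  using assms(1-3) unfolding d_def wt_def ty_obj.simps
  by (blast intro: dapp_swap dapp_Inf_left dapp_Inf_right Inf_Inf_dapp_dapp dapp_Plus_right obj)+

lemma atom_eqI:
  fixes a b :: "('b, 'm) atom"
  assumes "fst a = fst b" "\<And>\<Gamma> \<tau> f. (\<Gamma>, \<tau>, f) \<in> snd a \<Longrightarrow> (\<Gamma>, \<tau>, f) \<in> snd b"
    "\<And>\<Gamma> \<tau> f. (\<Gamma>, \<tau>, f) \<in> snd b \<Longrightarrow> (\<Gamma>, \<tau>, f) \<in> snd a"
  shows "a = b"
  using assms by (intro prod_eqI) auto

lemma difA_swap: "difA (difA s t) u = difA (difA s u) t"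
proof (rule atom_eqI)
  have *: "(\<Gamma>, \<rho>, h) \<in> snd (difA (difA s u) t)" if "(\<Gamma>, \<rho>, h) \<in> snd (difA (difA s t) u)"
    for \<Gamma> \<rho> h and s t u :: "('b, 'm) atom"
  proof -
    from that obtain \<tau> \<sigma> f g k where "\<rho> = \<tau> \<Rrightarrow> \<sigma>"
      "h = dapp (ctx_obj C I \<Gamma>) (ty_obj C I \<tau>) (ty_obj C I \<sigma>)
        (dapp (ctx_obj C I \<Gamma>) (ty_obj C I \<tau>) (ty_obj C I \<sigma>) f g) k"
      "(\<Gamma>, \<tau> \<Rrightarrow> \<sigma>, f) \<in> snd s" "wt \<Gamma> (\<tau> \<Rrightarrow> \<sigma>) f" "(\<Gamma>, \<tau>, g) \<in> snd t" "wt \<Gamma> \<tau> g"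
      "(\<Gamma>, \<tau>, k) \<in> snd u" "wt \<Gamma> \<tau> k"
      unfolding mem_difA_iff by blast
    then show ?thesis
      using dapp_laws(1)[of \<Gamma> \<tau> \<sigma> f g k] by (auto intro!: difAI)
  qed
  show "(\<Gamma>, \<rho>, h) \<in> snd (difA (difA s u) t)" if "(\<Gamma>, \<rho>, h) \<in> snd (difA (difA s t) u)" for \<Gamma> \<rho> h
    using that by (rule *)
  show "(\<Gamma>, \<rho>, h) \<in> snd (difA (difA s t) u)" if "(\<Gamma>, \<rho>, h) \<in> snd (difA (difA s u) t)" for \<Gamma> \<rho> h
    using that by (rule *)
qed auto

lemma difA_eps_left: "difA (epsA s) t = epsA (difA s t)"
proof (rule atom_eqI)
  fix \<Gamma> \<rho> h
  {
    assume "(\<Gamma>, \<rho>, h) \<in> snd (difA (epsA s) t)"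
    then obtain \<tau> \<sigma> f g where "\<rho> = \<tau> \<Rrightarrow> \<sigma>"
      "h = dapp (ctx_obj C I \<Gamma>) (ty_obj C I \<tau>) (ty_obj C I \<sigma>) (\<epsilon> f) g"
      "(\<Gamma>, \<tau> \<Rrightarrow> \<sigma>, f) \<in> snd s" "wt \<Gamma> (\<tau> \<Rrightarrow> \<sigma>) f" "(\<Gamma>, \<tau>, g) \<in> snd t" "wt \<Gamma> \<tau> g"
      unfolding mem_difA_iff mem_epsA_iff by blast
    then show "(\<Gamma>, \<rho>, h) \<in> snd (epsA (difA s t))"
      using dapp_laws(2)[of \<Gamma> \<tau> \<sigma> f g g] by (auto intro!: epsAI difAI)
  next
    assume "(\<Gamma>, \<rho>, h) \<in> snd (epsA (difA s t))"
    then obtain \<tau> \<sigma> f g where "\<rho> = \<tau> \<Rrightarrow> \<sigma>"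
      "h = \<epsilon> (dapp (ctx_obj C I \<Gamma>) (ty_obj C I \<tau>) (ty_obj C I \<sigma>) f g)"
      "(\<Gamma>, \<tau> \<Rrightarrow> \<sigma>, f) \<in> snd s" "wt \<Gamma> (\<tau> \<Rrightarrow> \<sigma>) f" "(\<Gamma>, \<tau>, g) \<in> snd t" "wt \<Gamma> \<tau> g"
      unfolding mem_difA_iff mem_epsA_iff by blast
    then show "(\<Gamma>, \<rho>, h) \<in> snd (difA (epsA s) t)"
      using dapp_laws(2)[of \<Gamma> \<tau> \<sigma> f g g] by (auto intro!: epsAI difAI)
  }
qed auto

lemma difA_eps_right: "difA s (epsA t) = epsA (difA s t)"
proof (rule atom_eqI)
  fix \<Gamma> \<rho> h
  {
    assume "(\<Gamma>, \<rho>, h) \<in> snd (difA s (epsA t))"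
    then obtain \<tau> \<sigma> f g where "\<rho> = \<tau> \<Rrightarrow> \<sigma>"
      "h = dapp (ctx_obj C I \<Gamma>) (ty_obj C I \<tau>) (ty_obj C I \<sigma>) f (\<epsilon> g)"
      "(\<Gamma>, \<tau> \<Rrightarrow> \<sigma>, f) \<in> snd s" "wt \<Gamma> (\<tau> \<Rrightarrow> \<sigma>) f" "(\<Gamma>, \<tau>, g) \<in> snd t" "wt \<Gamma> \<tau> g"
      unfolding mem_difA_iff mem_epsA_iff by blast
    then show "(\<Gamma>, \<rho>, h) \<in> snd (epsA (difA s t))"
      using dapp_laws(3)[of \<Gamma> \<tau> \<sigma> f g g] by (auto intro!: epsAI difAI)
  next
    assume "(\<Gamma>, \<rho>, h) \<in> snd (epsA (difA s t))"
    then obtain \<tau> \<sigma> f g where "\<rho> = \<tau> \<Rrightarrow> \<sigma>"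
      "h = \<epsilon> (dapp (ctx_obj C I \<Gamma>) (ty_obj C I \<tau>) (ty_obj C I \<sigma>) f g)"
      "(\<Gamma>, \<tau> \<Rrightarrow> \<sigma>, f) \<in> snd s" "wt \<Gamma> (\<tau> \<Rrightarrow> \<sigma>) f" "(\<Gamma>, \<tau>, g) \<in> snd t" "wt \<Gamma> \<tau> g"
      unfolding mem_difA_iff mem_epsA_iff by blast
    then show "(\<Gamma>, \<rho>, h) \<in> snd (difA s (epsA t))"
      using dapp_laws(3)[of \<Gamma> \<tau> \<sigma> f g g] by (auto intro!: epsAI difAI)
  }
qed auto

lemma epsA_epsA_difA_difA: "epsA (epsA (difA (difA s t) u)) = epsA (difA (difA s t) u)"
proof (rule atom_eqI)
  fix \<Gamma> \<rho> h
  {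
    assume "(\<Gamma>, \<rho>, h) \<in> snd (epsA (epsA (difA (difA s t) u)))"
    then obtain f where f: "(\<Gamma>, \<rho>, f) \<in> snd (difA (difA s t) u)" "wt \<Gamma> \<rho> f" "h = \<epsilon> (\<epsilon> f)"
      unfolding mem_epsA_iff by blast
    from f(1) have "\<epsilon> (\<epsilon> f) = \<epsilon> f"
      unfolding mem_difA_iff using dapp_laws(4) by blast
    with f show "(\<Gamma>, \<rho>, h) \<in> snd (epsA (difA (difA s t) u))"
      by (auto intro: epsAI)
  next
    assume "(\<Gamma>, \<rho>, h) \<in> snd (epsA (difA (difA s t) u))"
    then obtain f where f: "(\<Gamma>, \<rho>, f) \<in> snd (difA (difA s t) u)" "wt \<Gamma> \<rho> f" "h = \<epsilon> f"
      unfolding mem_epsA_iff by blast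
    from f(1) have "\<epsilon> (\<epsilon> f) = \<epsilon> f"
      unfolding mem_difA_iff using dapp_laws(4) by blast
    with f show "(\<Gamma>, \<rho>, h) \<in> snd (epsA (epsA (difA (difA s t) u)))"
      using epsAI[OF epsAI[OF f(1,2) HOL.refl] wt_simps(3)[OF f(2)], of h] by simp
  }
qed auto

lemma Lam_Inf_wt:
  "wt (\<tau> # \<Gamma>) \<sigma> f \<Longrightarrow>
    \<Lambda> (ctx_obj C I \<Gamma>) (ty_obj C I \<tau>) (\<epsilon> f) = \<epsilon> (\<Lambda> (ctx_obj C I \<Gamma>) (ty_obj C I \<tau>) f)"
  using Lam_Inf[of "ctx_obj C I \<Gamma>" "ty_obj C I \<tau>" f] by (simp add: wt_def)

lemma lamA_eps: "lamA (epsA s) = epsA (lamA s)"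
proof (rule atom_eqI)
  fix \<Gamma> \<rho> h
  {
    assume "(\<Gamma>, \<rho>, h) \<in> snd (lamA (epsA s))"
    then obtain \<tau> \<sigma> f where "\<rho> = \<tau> \<Rrightarrow> \<sigma>" "h = \<Lambda> (ctx_obj C I \<Gamma>) (ty_obj C I \<tau>) (\<epsilon> f)"
      "(\<tau> # \<Gamma>, \<sigma>, f) \<in> snd s" "wt (\<tau> # \<Gamma>) \<sigma> f"
      unfolding mem_lamA_iff mem_epsA_iff by blast
    then show "(\<Gamma>, \<rho>, h) \<in> snd (epsA (lamA s))"
      by (auto intro!: epsAI lamAI simp: Lam_Inf_wt)
  next
    assume "(\<Gamma>, \<rho>, h) \<in> snd (epsA (lamA s))"
    then obtain \<tau> \<sigma> f where "\<rho> = \<tau> \<Rrightarrow> \<sigma>" "h = \<epsilon> (\<Lambda> (ctx_obj C I \<Gamma>) (ty_obj C I \<tau>) f)"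
      "(\<tau> # \<Gamma>, \<sigma>, f) \<in> snd s" "wt (\<tau> # \<Gamma>) \<sigma> f"
      unfolding mem_lamA_iff mem_epsA_iff by blast
    then show "(\<Gamma>, \<rho>, h) \<in> snd (lamA (epsA s))"
      by (auto intro!: epsAI lamAI simp: Lam_Inf_wt)
  }
qed auto

lemma Ev_Inf_wt:
  "wt \<Gamma> (\<tau> \<Rrightarrow> \<sigma>) f \<Longrightarrow> wt \<Gamma> \<tau> g \<Longrightarrow>
    Ev C (ty_obj C I \<tau>) (ty_obj C I \<sigma>) \<cdot> \<langle>\<epsilon> f, g\<rangle> = \<epsilon> (Ev C (ty_obj C I \<tau>) (ty_obj C I \<sigma>) \<cdot> \<langle>f, g\<rangle>)"
  using Ev_Inf[of "ctx_obj C I \<Gamma>"] by (simp add: wt_def)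

lemma appA_eps: "appA (epsA s) M = epsA (appA s M)"
proof (rule atom_eqI)
  fix \<Gamma> \<sigma> h
  {
    assume "(\<Gamma>, \<sigma>, h) \<in> snd (appA (epsA s) M)"
    then obtain \<tau> f g where *: "h = Ev C (ty_obj C I \<tau>) (ty_obj C I \<sigma>) \<cdot> \<langle>\<epsilon> f, g\<rangle>"
      "(\<Gamma>, \<tau> \<Rrightarrow> \<sigma>, f) \<in> snd s" "wt \<Gamma> (\<tau> \<Rrightarrow> \<sigma>) f" "val M \<Gamma> \<tau> g"
      unfolding mem_appA_iff mem_epsA_iff by blast
    then have "h = \<epsilon> (Ev C (ty_obj C I \<tau>) (ty_obj C I \<sigma>) \<cdot> \<langle>f, g\<rangle>)"
      using Ev_Inf_wt val_wt by simp
    with * show "(\<Gamma>, \<sigma>, h) \<in> snd (epsA (appA s M))"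
      using val_wt by (auto intro!: epsAI appAI)
  next
    assume "(\<Gamma>, \<sigma>, h) \<in> snd (epsA (appA s M))"
    then obtain \<tau> f g where *: "h = \<epsilon> (Ev C (ty_obj C I \<tau>) (ty_obj C I \<sigma>) \<cdot> \<langle>f, g\<rangle>)"
      "(\<Gamma>, \<tau> \<Rrightarrow> \<sigma>, f) \<in> snd s" "wt \<Gamma> (\<tau> \<Rrightarrow> \<sigma>) f" "val M \<Gamma> \<tau> g"
      unfolding mem_appA_iff mem_epsA_iff by blast
    then have "h = Ev C (ty_obj C I \<tau>) (ty_obj C I \<sigma>) \<cdot> \<langle>\<epsilon> f, g\<rangle>"
      using Ev_Inf_wt val_wt by simp
    with * show "(\<Gamma>, \<sigma>, h) \<in> snd (appA (epsA s) M)"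
      by (auto intro!: epsAI appAI[where f = "\<epsilon> f"])
  }
qed auto

interpretation difference_atoms varA lamA epsA difA appA fst
  by unfold_locales
    (simp_all add: difA_swap difA_eps_left difA_eps_right epsA_epsA_difA_difA lamA_eps appA_eps)

section \<open>Values of canonical forms\<close>

lemma val_empty_iff: "val {#} \<Gamma> \<tau> f \<longleftrightarrow> f = \<zero> (ctx_obj C I \<Gamma>) (ty_obj C I \<tau>)"
  by (auto intro: val_empty elim: val.cases)

lemma wt_arr: "wt \<Gamma> \<tau> f \<Longrightarrow> f \<in> Arr C \<and> Dom C f = ctx_obj C I \<Gamma> \<and> Cod C f = ty_obj C I \<tau>"
  by (simp add: wt_def Hom_iff)

text \<open>Any chosen atom can be made the last summand, since sums of arrows may be
  reordered.\<close>

lemma val_addE: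
  assumes "val (add_mset a M) \<Gamma> \<tau> h"
  obtains f g where "(\<Gamma>, \<tau>, f) \<in> snd a" "wt \<Gamma> \<tau> f" "val M \<Gamma> \<tau> g" "h = g \<oplus> f"
proof -
  have "\<exists>f g. (\<Gamma>, \<tau>, f) \<in> snd a \<and> wt \<Gamma> \<tau> f \<and> val M \<Gamma> \<tau> g \<and> h = g \<oplus> f"
    if "val N \<Gamma> \<tau> h" "N = add_mset a M" for N
    using that
  proof (induction arbitrary: M rule: val.induct)
    case (val_add N \<Gamma> \<tau> g' f' a')
    show ?case
    \<comment> \<open>Either the atom added last is the one sought, or the latter sits deeper and
      the two summands trade places.\<close>
    proof (cases "a' = a \<and> N = M")
      case True
      then show ?thesis using val_add by blast
    next
      case False
      then obtain K where K: "N = add_mset a K" "M = add_mset a' K"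
        using val_add.prems by (auto simp: add_eq_conv_ex)
      obtain f g where f: "(\<Gamma>, \<tau>, f) \<in> snd a" "wt \<Gamma> \<tau> f" and g: "val K \<Gamma> \<tau> g" "g' = g \<oplus> f"
        using val_add.IH[OF K(1)] by blast
      have "g' \<oplus> f' = (g \<oplus> f') \<oplus> f"
        using wt_arr[OF f(2)] wt_arr[OF val_wt[OF g(1)]] wt_arr[OF val_add.hyps(3)] g(2)
        by (simp add: Plus_ac)
      moreover have "val M \<Gamma> \<tau> (g \<oplus> f')"
        unfolding K(2) by (rule val.val_add[OF g(1) val_add.hyps(2,3)])
      ultimately show ?thesis using f by blast
    qed
  qed simp
  then show ?thesis using assms that by blast
qed

lemma val_union:
  assumes M: "val M \<Gamma> \<tau> g" and "val N \<Gamma> \<tau> h"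
  shows "val (M + N) \<Gamma> \<tau> (g \<oplus> h)"
  using assms(2)
proof (induction N arbitrary: h)
  case empty
  then show ?case using M wt_arr[OF val_wt[OF M]] by (simp add: val_empty_iff)
next
  case (add a N)
  obtain f k where f: "(\<Gamma>, \<tau>, f) \<in> snd a" "wt \<Gamma> \<tau> f" and k: "val N \<Gamma> \<tau> k" "h = k \<oplus> f"
    using add.prems by (rule val_addE)
  have "g \<oplus> h = (g \<oplus> k) \<oplus> f"
    using wt_arr[OF val_wt[OF M]] wt_arr[OF val_wt[OF k(1)]] wt_arr[OF f(2)] k(2)
    by (simp add: Plus_assoc_simp)
  then show ?case
    using val_add[OF add.IH[OF k(1)] f] by simp
qed

lemma val_unionE:
  assumes "val (M + N) \<Gamma> \<tau> h"
  obtains g k where "val M \<Gamma> \<tau> g" "val N \<Gamma> \<tau> k" "h = g \<oplus> k"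
proof -
  have "\<exists>g k. val M \<Gamma> \<tau> g \<and> val N \<Gamma> \<tau> k \<and> h = g \<oplus> k"
    using assms
  proof (induction N arbitrary: h)
    case empty
    then show ?case using wt_arr[OF val_wt[of M \<Gamma> \<tau> h]] val_empty[of \<Gamma> \<tau>] by fastforce
  next
    case (add a N)
    obtain f l where f: "(\<Gamma>, \<tau>, f) \<in> snd a" "wt \<Gamma> \<tau> f" and l: "val (M + N) \<Gamma> \<tau> l" "h = l \<oplus> f"
      using add.prems by (auto elim: val_addE)
    obtain g k where g: "val M \<Gamma> \<tau> g" "val N \<Gamma> \<tau> k" "l = g \<oplus> k"
      using add.IH[OF l(1)] by blast
    have "h = g \<oplus> (k \<oplus> f)"
      using wt_arr[OF val_wt[OF g(1)]] wt_arr[OF val_wt[OF g(2)]] wt_arr[OF f(2)] l(2) g(3)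
      by (simp add: Plus_assoc_simp)
    then show ?case using g(1) val_add[OF g(2) f] by blast
  qed
  then show ?thesis using that by blast
qed

lemma val_singleton: "(\<Gamma>, \<tau>, f) \<in> snd a \<Longrightarrow> wt \<Gamma> \<tau> f \<Longrightarrow> val {#a#} \<Gamma> \<tau> f"
  using val_add[OF val_empty, of \<Gamma> \<tau> f a] wt_arr[of \<Gamma> \<tau> f] by simp

text \<open>Covers all linear positions uniformly: abstraction, \<epsilon>, the function under D and
  the function of an application.\<close>

lemma val_image:
  assumes M: "val M \<Gamma> \<tau> g"
    and mem: "\<And>a f. (\<Gamma>, \<tau>, f) \<in> snd a \<Longrightarrow> wt \<Gamma> \<tau> f \<Longrightarrow> (\<Delta>, \<sigma>, F f) \<in> snd (H a) \<and> wt \<Delta> \<sigma> (F f)"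
    and Null: "F (\<zero> (ctx_obj C I \<Gamma>) (ty_obj C I \<tau>)) = \<zero> (ctx_obj C I \<Delta>) (ty_obj C I \<sigma>)"
    and Plus: "\<And>f g. wt \<Gamma> \<tau> f \<Longrightarrow> wt \<Gamma> \<tau> g \<Longrightarrow> F (f \<oplus> g) = F f \<oplus> F g"
  shows "val (image_mset H M) \<Delta> \<sigma> (F g)"
  using M
proof (induction M arbitrary: g)
  case empty
  then show ?case by (simp add: val_empty_iff Null)
next
  case (add a M)
  obtain f k where f: "(\<Gamma>, \<tau>, f) \<in> snd a" "wt \<Gamma> \<tau> f" and k: "val M \<Gamma> \<tau> k" "g = k \<oplus> f"
    using add.prems by (rule val_addE)
  show ?case
    using val_add[OF add.IH[OF k(1)]] mem[OF f] Plus[OF val_wt[OF k(1)] f(2)] k(2) by simp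
qed

lemma val_lam:
  assumes "val M (\<tau> # \<Gamma>) \<sigma> f"
  shows "val (image_mset lamA M) \<Gamma> (\<tau> \<Rrightarrow> \<sigma>) (\<Lambda> (ctx_obj C I \<Gamma>) (ty_obj C I \<tau>) f)"
  using assms
  by (rule val_image) (auto simp: mem_lamA_iff wt_def intro: Lam_Null Lam_Plus Lam_Hom)

lemma val_eps: "val M \<Gamma> \<tau> f \<Longrightarrow> val (epsM M) \<Gamma> \<tau> (\<epsilon> f)"
  by (rule val_image) (auto simp: mem_epsA_iff wt_def Hom_iff)

lemma val_difM:
  assumes "val R \<Gamma> (\<tau> \<Rrightarrow> \<sigma>) f" "(\<Gamma>, \<tau>, g) \<in> snd a" "wt \<Gamma> \<tau> g"
  shows "val (difM R a) \<Gamma> (\<tau> \<Rrightarrow> \<sigma>) (dapp (ctx_obj C I \<Gamma>) (ty_obj C I \<tau>) (ty_obj C I \<sigma>) f g)"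
  using assms(1)
proof (rule val_image)
  fix a' :: "('b, 'm) atom" and f assume "(\<Gamma>, \<tau> \<Rrightarrow> \<sigma>, f) \<in> snd a'" "wt \<Gamma> (\<tau> \<Rrightarrow> \<sigma>) f"
  then show "(\<Gamma>, \<tau> \<Rrightarrow> \<sigma>, dapp (ctx_obj C I \<Gamma>) (ty_obj C I \<tau>) (ty_obj C I \<sigma>) f g) \<in> snd (difA a' a) \<and>
      wt \<Gamma> (\<tau> \<Rrightarrow> \<sigma>) (dapp (ctx_obj C I \<Gamma>) (ty_obj C I \<tau>) (ty_obj C I \<sigma>) f g)"
    using assms by (auto simp: mem_difA_iff)
qed (use assms(3) in \<open>auto simp: wt_def intro: dapp_Null_left dapp_Plus_left\<close>)

text \<open>The recursion of \<open>dd\<close> matches the expansion of \<open>dapp\<close> along a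
  sum, with the tail of the sum as first direction and the new atom as second.\<close>

lemma val_dd:
  assumes f: "(\<Gamma>, \<tau> \<Rrightarrow> \<sigma>, f) \<in> snd s" "wt \<Gamma> (\<tau> \<Rrightarrow> \<sigma>) f" and "val T \<Gamma> \<tau> g"
  shows "val (dd s T) \<Gamma> (\<tau> \<Rrightarrow> \<sigma>) (dapp (ctx_obj C I \<Gamma>) (ty_obj C I \<tau>) (ty_obj C I \<sigma>) f g)"
  using assms(3)
proof (induction T arbitrary: g)
  case empty
  then show ?case
    using f(2) val_empty[of \<Gamma> "\<tau> \<Rrightarrow> \<sigma>"] by (simp add: val_empty_iff dapp_Null_right wt_def)
next
  case (add a T)
  obtain h k where h: "(\<Gamma>, \<tau>, h) \<in> snd a" "wt \<Gamma> \<tau> h" and k: "val T \<Gamma> \<tau> k" "g = k \<oplus> h"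
    using add.prems by (rule val_addE)
  let ?d = "dapp (ctx_obj C I \<Gamma>) (ty_obj C I \<tau>) (ty_obj C I \<sigma>)"
  have "val {#difA s a#} \<Gamma> (\<tau> \<Rrightarrow> \<sigma>) (?d f h)"
    using f h by (intro val_singleton) (auto simp: mem_difA_iff)
  note v = val_union[OF val_union[OF add.IH[OF k(1)] this]
      val_eps[OF val_difM[OF add.IH[OF k(1)] h]]]
  have "dd s T + {#difA s a#} + epsM (difM (dd s T) a) = dd s (add_mset a T)"
    by simp
  then show ?case
    using v dapp_laws(5)[OF f(2) val_wt[OF k(1)] h(2)] k(2) by simp
qed

lemma val_ddM:
  assumes "val S \<Gamma> (\<tau> \<Rrightarrow> \<sigma>) f" "val T \<Gamma> \<tau> g"
  shows "val (ddM S T) \<Gamma> (\<tau> \<Rrightarrow> \<sigma>) (dapp (ctx_obj C I \<Gamma>) (ty_obj C I \<tau>) (ty_obj C I \<sigma>) f g)"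
  using assms(1)
proof (induction S arbitrary: f)
  case empty
  then show ?case
    using val_wt[OF assms(2)] val_empty[of \<Gamma> "\<tau> \<Rrightarrow> \<sigma>"]
    by (simp add: val_empty_iff dapp_Null_left wt_def)
next
  case (add s S)
  obtain h k where h: "(\<Gamma>, \<tau> \<Rrightarrow> \<sigma>, h) \<in> snd s" "wt \<Gamma> (\<tau> \<Rrightarrow> \<sigma>) h"
    and k: "val S \<Gamma> (\<tau> \<Rrightarrow> \<sigma>) k" "f = k \<oplus> h"
    using add.prems by (rule val_addE)
  show ?case
    using val_union[OF add.IH[OF k(1)] val_dd[OF h assms(2)]] h(2) val_wt[OF k(1)] val_wt[OF assms(2)] k(2)
    by (simp add: dapp_Plus_left wt_def add.commute)
qed

text \<open>The flag of an atom marks values of the form \<open>\<epsilon> h\<close>, which is what allows an infinitesimal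
  summand to be moved out of an argument.\<close>

definition flag_ok :: "('b, 'm) atom \<Rightarrow> bool" where
  "flag_ok a \<longleftrightarrow> (fst a \<longrightarrow> (\<forall>\<Gamma> \<tau> f. (\<Gamma>, \<tau>, f) \<in> snd a \<longrightarrow> (\<exists>h. wt \<Gamma> \<tau> h \<and> f = \<epsilon> h)))"

lemma flag_ok_can: "\<forall>a\<in>#can t. flag_ok a"
proof (rule can_closed)
  show "flag_ok (varA k)" for k
    by (simp add: flag_ok_def)
  show "flag_ok (lamA s)" if "flag_ok s" for s
    unfolding flag_ok_def
  proof (intro impI allI)
    fix \<Gamma> \<rho> h assume "fst (lamA s)" "(\<Gamma>, \<rho>, h) \<in> snd (lamA s)"
    then obtain \<tau> \<sigma> f where *: "\<rho> = \<tau> \<Rrightarrow> \<sigma>" "h = \<Lambda> (ctx_obj C I \<Gamma>) (ty_obj C I \<tau>) f"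
        "(\<tau> # \<Gamma>, \<sigma>, f) \<in> snd s" "fst s"
      unfolding mem_lamA_iff by auto
    then obtain k where k: "wt (\<tau> # \<Gamma>) \<sigma> k" "f = \<epsilon> k"
      using \<open>flag_ok s\<close> unfolding flag_ok_def by blast
    then have "h = \<epsilon> (\<Lambda> (ctx_obj C I \<Gamma>) (ty_obj C I \<tau>) k)"
      using * by (simp add: Lam_Inf_wt)
    then show "\<exists>h'. wt \<Gamma> \<rho> h' \<and> h = \<epsilon> h'"
      using wt_simps(4)[OF k(1)] *(1) by blast
  qed
  show "flag_ok (epsA s)" for s
    by (auto simp: flag_ok_def mem_epsA_iff)
  show "flag_ok (difA s t)" if "flag_ok s" "flag_ok t" for s t
    unfolding flag_ok_def
  proof (intro impI allI)
    fix \<Gamma> \<rho> h assume "fst (difA s t)" "(\<Gamma>, \<rho>, h) \<in> snd (difA s t)"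
    then obtain \<tau> \<sigma> f g where *: "\<rho> = \<tau> \<Rrightarrow> \<sigma>"
        "h = dapp (ctx_obj C I \<Gamma>) (ty_obj C I \<tau>) (ty_obj C I \<sigma>) f g"
        "(\<Gamma>, \<tau> \<Rrightarrow> \<sigma>, f) \<in> snd s" "wt \<Gamma> (\<tau> \<Rrightarrow> \<sigma>) f" "(\<Gamma>, \<tau>, g) \<in> snd t" "wt \<Gamma> \<tau> g"
      and "fst s \<or> fst t"
      unfolding mem_difA_iff by auto
    from \<open>fst s \<or> fst t\<close> show "\<exists>h'. wt \<Gamma> \<rho> h' \<and> h = \<epsilon> h'"
    proof
      assume "fst s"
      then obtain k where k: "wt \<Gamma> (\<tau> \<Rrightarrow> \<sigma>) k" "f = \<epsilon> k"
        using \<open>flag_ok s\<close> *(3) unfolding flag_ok_def by blast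
      show ?thesis
        using wt_simps(5)[OF k(1) *(6)] dapp_laws(2)[OF k(1) *(6) *(6)] k(2) *(1,2) by blast
    next
      assume "fst t"
      then obtain k where k: "wt \<Gamma> \<tau> k" "g = \<epsilon> k"
        using \<open>flag_ok t\<close> *(5) unfolding flag_ok_def by blast
      show ?thesis
        using wt_simps(5)[OF *(4) k(1)] dapp_laws(3)[OF *(4) k(1) k(1)] k(2) *(1,2) by blast
    qed
  qed
  show "flag_ok (appA s M)" if "flag_ok s" "\<forall>x\<in>#M. flag_ok x" for s M
    unfolding flag_ok_def
  proof (intro impI allI)
    fix \<Gamma> \<sigma> h assume "fst (appA s M)" "(\<Gamma>, \<sigma>, h) \<in> snd (appA s M)"
    then obtain \<tau> f g where *: "h = Ev C (ty_obj C I \<tau>) (ty_obj C I \<sigma>) \<cdot> \<langle>f, g\<rangle>"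
        "(\<Gamma>, \<tau> \<Rrightarrow> \<sigma>, f) \<in> snd s" "val M \<Gamma> \<tau> g" "fst s"
      unfolding mem_appA_iff by auto
    then obtain k where k: "wt \<Gamma> (\<tau> \<Rrightarrow> \<sigma>) k" "f = \<epsilon> k"
      using \<open>flag_ok s\<close> unfolding flag_ok_def by blast
    have "h = \<epsilon> (Ev C (ty_obj C I \<tau>) (ty_obj C I \<sigma>) \<cdot> \<langle>k, g\<rangle>)"
      using * k val_wt[OF *(3)] Ev_Inf_wt by simp
    then show "\<exists>h'. wt \<Gamma> \<sigma> h' \<and> h = \<epsilon> h'"
      using wt_simps(6)[OF k(1) val_wt[OF *(3)]] by blast
  qed
qed

text \<open>Since \<epsilon> is additive and preserves zero, the witnesses of the summands add up to
  one witness for the whole sum.\<close>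

lemma val_flagged:
  assumes "val M \<Gamma> \<tau> f" "\<forall>a\<in>#M. fst a \<and> flag_ok a"
  obtains h where "wt \<Gamma> \<tau> h" "f = \<epsilon> h"
proof -
  have "\<exists>h. wt \<Gamma> \<tau> h \<and> f = \<epsilon> h"
    using assms
  proof (induction rule: val.induct)
    case (val_empty \<Gamma> \<tau>)
    show ?case by (metis Inf_Null obj wt_simps(1))
  next
    case (val_add M \<Gamma> \<tau> g f a)
    obtain h where h: "wt \<Gamma> \<tau> h" "g = \<epsilon> h"
      using val_add by auto
    obtain k where k: "wt \<Gamma> \<tau> k" "f = \<epsilon> k"
      using val_add.prems val_add.hyps(2) unfolding flag_ok_def by fastforce
    have "g \<oplus> f = \<epsilon> (h \<oplus> k)"
      using h k wt_arr[OF h(1)] wt_arr[OF k(1)] by simp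
    then show ?case using h k wt_simps(2) by blast
  qed
  then show ?thesis using that by blast
qed

lemma val_app_image:
  assumes "val R \<Gamma> (\<tau> \<Rrightarrow> \<sigma>) f" and g: "val M \<Gamma> \<tau> g"
  shows "val (image_mset (\<lambda>r. appA r M) R) \<Gamma> \<sigma> (Ev C (ty_obj C I \<tau>) (ty_obj C I \<sigma>) \<cdot> \<langle>f, g\<rangle>)"
  using assms(1)
proof (rule val_image)
  fix a :: "('b, 'm) atom" and f assume "(\<Gamma>, \<tau> \<Rrightarrow> \<sigma>, f) \<in> snd a" "wt \<Gamma> (\<tau> \<Rrightarrow> \<sigma>) f"
  then show "(\<Gamma>, \<sigma>, Ev C (ty_obj C I \<tau>) (ty_obj C I \<sigma>) \<cdot> \<langle>f, g\<rangle>) \<in> snd (appA a M) \<and>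
      wt \<Gamma> \<sigma> (Ev C (ty_obj C I \<tau>) (ty_obj C I \<sigma>) \<cdot> \<langle>f, g\<rangle>)"
    using g val_wt[OF g] by (auto simp: mem_appA_iff)
qed (use val_wt[OF g] in \<open>simp_all add: wt_def Hom_iff\<close>)

text \<open>The argument splits into its unflagged and flagged parts; the latter is \<epsilon> of
  some arrow, so \<open>Ev_Taylor\<close> yields the two summands listed by
  \<open>appM_eq\<close>.\<close>

lemma val_app:
  assumes f: "val S \<Gamma> (\<tau> \<Rrightarrow> \<sigma>) f" and g: "val T \<Gamma> \<tau> g" and ok: "\<forall>a\<in>#T. flag_ok a"
  shows "val (appM S T) \<Gamma> \<sigma> (Ev C (ty_obj C I \<tau>) (ty_obj C I \<sigma>) \<cdot> \<langle>f, g\<rangle>)"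
proof -
  let ?N = "filter_mset (\<lambda>x. \<not> fst x) T" and ?P = "filter_mset fst T"
  have "T = ?N + ?P"
    by (metis multiset_partition add.commute)
  with g obtain g0 g1 where g01: "val ?N \<Gamma> \<tau> g0" "val ?P \<Gamma> \<tau> g1" "g = g0 \<oplus> g1"
    by (metis val_unionE)
  obtain h where h: "wt \<Gamma> \<tau> h" "g1 = \<epsilon> h"
    using val_flagged[OF g01(2)] ok by auto
  let ?e = "Ev C (ty_obj C I \<tau>) (ty_obj C I \<sigma>)"
  let ?d = "dapp (ctx_obj C I \<Gamma>) (ty_obj C I \<tau>) (ty_obj C I \<sigma>)"
  have "?e \<cdot> \<langle>f, g\<rangle> = ?e \<cdot> \<langle>f, g0\<rangle> \<oplus> ?e \<cdot> \<langle>?d f g1, g0\<rangle>"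
    using Ev_Taylor[of "ctx_obj C I \<Gamma>" "ty_obj C I \<tau>" "ty_obj C I \<sigma>" f g0 h]
      val_wt[OF f] val_wt[OF g01(1)] h g01(3) by (simp add: wt_def)
  then show ?thesis
    using val_union[OF val_app_image[OF f g01(1)] val_app_image[OF val_ddM[OF f g01(2)] g01(1)]]
    by (simp add: appM_eq)
qed

lemma val_interp: "d \<triangleright> \<Gamma> \<turnstile> t : \<tau> \<Longrightarrow> val (can t) \<Gamma> \<tau> (interp C I d)"
proof (induction rule: derives.induct)
  case (1 k \<Gamma>)
  then have "(\<Gamma>, \<Gamma> ! k, var_arr C I \<Gamma> k) \<in> snd (varA k)"
    by (auto simp: varA_def)
  from val_singleton[OF this] show ?case
    using var_arr_Hom[of I k \<Gamma>] 1 I by (simp add: wt_def)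
next
  case (2 d \<Gamma> s \<tau> \<sigma> e t)
  then show ?case using flag_ok_can by (simp add: val_app)
next
  case (3 d \<Gamma> s \<tau> \<sigma> e t)
  then show ?case using val_ddM[OF 3(3,4)] by (simp add: dapp_def Let_def)
next
  case (4 d \<tau> \<Gamma> t \<sigma>)
  then show ?case by (simp add: val_lam)
next
  case (5 \<Gamma> \<tau>)
  then show ?case by (simp add: val_empty)
next
  case (6 d \<Gamma> s \<tau> e t)
  then show ?case by (simp add: val_union)
next
  case (7 d \<Gamma> t \<tau>)
  then show ?case by (simp add: val_eps)
qed

text \<open>Stronger than uniqueness of values, as the induction through \<open>appA\<close>
  requires. Contexts need only agree in length, so that a de Bruijn index denotes the same position
  in both.\<close>

definition coherent :: "('b, 'm) atom \<Rightarrow> bool" where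
  "coherent a \<longleftrightarrow> (\<forall>\<Gamma> \<Gamma>' \<tau> \<tau>' f f'. (\<Gamma>, \<tau>, f) \<in> snd a \<longrightarrow> (\<Gamma>', \<tau>', f') \<in> snd a \<longrightarrow>
     length \<Gamma> = length \<Gamma>' \<longrightarrow> smooth (ctxR I \<Gamma> \<Gamma>') (tyR I \<tau> \<tau>') f f')"

lemma coherentD:
  "\<lbrakk>coherent a; (\<Gamma>, \<tau>, f) \<in> snd a; (\<Gamma>', \<tau>', f') \<in> snd a; length \<Gamma> = length \<Gamma>'\<rbrakk>
    \<Longrightarrow> smooth (ctxR I \<Gamma> \<Gamma>') (tyR I \<tau> \<tau>') f f'"
  unfolding coherent_def by blast

lemma smooth_val:
  assumes "\<forall>a\<in>#M. coherent a" "val M \<Gamma> \<tau> f" "val M \<Gamma>' \<tau>' f'" and len: "length \<Gamma> = length \<Gamma>'"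
  shows "smooth (ctxR I \<Gamma> \<Gamma>') (tyR I \<tau> \<tau>') f f'"
  using assms(1-3)
proof (induction M arbitrary: f f')
  case empty
  then show ?case
    using len I by (simp add: val_empty_iff smooth_Null wf_ctxR wf_tyR)
next
  case (add a M)
  obtain h k where h: "(\<Gamma>, \<tau>, h) \<in> snd a" and k: "val M \<Gamma> \<tau> k" "f = k \<oplus> h"
    using add.prems(2) by (rule val_addE)
  obtain h' k' where h': "(\<Gamma>', \<tau>', h') \<in> snd a" and k': "val M \<Gamma>' \<tau>' k'" "f' = k' \<oplus> h'"
    using add.prems(3) by (rule val_addE)
  have "smooth (ctxR I \<Gamma> \<Gamma>') (tyR I \<tau> \<tau>') h h'"
    using add.prems(1) h h' len by (auto intro: coherentD)
  then show ?case
    using add k k' len I by (simp add: smooth_Plus wf_ctxR wf_tyR)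
qed

text \<open>The fundamental lemma of the logical relations: each atom constructor is matched by the
  smoothness of the corresponding categorical operation.\<close>

lemma coherent_can: "\<forall>a\<in>#can t. coherent a"
proof (rule can_closed)
  show "coherent (varA k)" for k
    using I by (auto simp: coherent_def varA_def intro: smooth_var_arr)
  show "coherent (lamA s)" if "coherent s" for s
    unfolding coherent_def mem_lamA_iff
    using coherentD[OF that] I
    by (fastforce intro!: smooth_Lam simp: wf_ctxR wf_tyR)
  show "coherent (epsA s)" if "coherent s" for s
    unfolding coherent_def mem_epsA_iff
    using coherentD[OF that] I by (auto intro!: smooth_Inf simp: wf_ctxR wf_tyR)
  show "coherent (difA s t)" if "coherent s" "coherent t" for s t
    unfolding coherent_def mem_difA_iff
    using coherentD[OF that(1)] coherentD[OF that(2)] I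
    by (fastforce intro!: smooth_dapp simp: wf_ctxR wf_tyR)
  show "coherent (appA s M)" if "coherent s" "\<forall>x\<in>#M. coherent x" for s M
    unfolding coherent_def mem_appA_iff
    using coherentD[OF that(1)] smooth_val[OF that(2)] I
    by (fastforce intro!: smooth_Ev simp: wf_ctxR wf_tyR)
qed

lemma interp_diff_equiv:
  assumes "s \<sim>\<^sub>\<epsilon> t" "d \<triangleright> \<Gamma> \<turnstile> s : \<tau>" "e \<triangleright> \<Gamma> \<turnstile> t : \<tau>"
  shows "interp C I d = interp C I e"
proof -
  have "val (can t) \<Gamma> \<tau> (interp C I d)"
    using val_interp[OF assms(2)] can_diff_equiv[OF assms(1)] by simp
  \<comment> \<open>Both arrows are values of \<open>can t\<close>; at equal contexts and types the
    relational objects are diagonal, so smoothness amounts to equality.\<close>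
  then have "smooth (ctxR I \<Gamma> \<Gamma>) (tyR I \<tau> \<tau>) (interp C I d) (interp C I e)"
    using coherent_can val_interp[OF assms(3)] by (intro smooth_val) auto
  then show ?thesis
    using I by (simp add: ctxR_diag tyR_diag smooth_triv_iff)
qed

end

end

theorem mainTheorem18:
  fixes C :: "('o, 'm, 'x) diff_lambda_cat_scheme"
    and I :: "'b \<Rightarrow> 'o"
    and s t :: trm
    and \<Gamma> :: "'b ctx"
    and \<tau> :: "'b ty"
    and d e :: "'b deriv"
  assumes "difference_lambda_category C"
    and "\<And>b. I b \<in> Obj C"
    and "s \<sim>\<^sub>\<epsilon> t"
    and "d \<triangleright> \<Gamma> \<turnstile> s : \<tau>"
    and "e \<triangleright> \<Gamma> \<turnstile> t : \<tau>"
  shows "interp C I d = interp C I e"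
  using difference_lambda_category.interp_diff_equiv[OF assms] .

end
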